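(* Let $r\ge0$ be an integer and let $m_-,m_+>0$ be such that $m_\pm\in\mathbb{Z}\pm\tfrac14$ (that is, each of $m_-$ and $m_+$ lies in $(\mathbb{Z}+\tfrac14)\cup(\mathbb{Z}-\tfrac14)$). Let $\kappa_\pm,\epsilon_\pm,\delta_\pm$ be the integers determined by $m_\pm$, put $l=2r+\lfloor l_-\rfloor+\lfloor l_+\rfloor$ with $l_\pm=\kappa_\pm(\kappa_\pm+\epsilon_\pm-\tfrac12)$, and consider the morphism of complex algebraic tori $$\xi^{r}_{T,m_-,m_+}:T^r\to T^l,\qquad \xi^{r}_{T,m_-,m_+}(t_1,\dots,t_r)=\bigl(-r_e(m_-),\,v^{-1}t_1,\,vt_1,\,\dots,\,v^{-1}t_r,\,vt_r,\,r_e(m_+)\bigr).$$ Then $\xi^{r}_{T,m_-,m_+}$ defines a spectral transfer morphism from the normalised affine Hecke algebra of rank $r$ with $\mu$-function $\mu^{r}_{m_-,m_+}$ (base $q^2$) to the normalised affine Hecke algebra of rank $l$ with $\mu$-function $\mu^{l}_{\delta_-,\delta_+}$ (base $q$).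
   Context: Throughout $v>1$ is a real parameter, $q=v^2$, and $T^N=(\mathbb{C}^\times)^N$ with coordinates $t_1,\dots,t_N$ and character lattice $X=\mathbb{Z}^N$ (characters written multiplicatively). $R_0$ is the root system of type $B_N$ in $X$: short roots $t_i^{\pm1}$ and long roots $t_i^{\pm1}t_j^{\pm1}$ ($i<j$, all signs), with a fixed set $R_0^+$ of positive roots. **The integers $\kappa,\epsilon,\delta$ and the points $r_e(m)$.** For $m>0$ with $m\in\mathbb{Z}\pm\tfrac14$ write uniquely $m=\kappa+\frac{2\epsilon-1}{4}$ with $\kappa\in\mathbb{Z}_{\ge0}$, $\epsilon\in\{0,1\}$, and let $\delta\in\{0,1\}$ be determined by $\kappa-\delta\in2\mathbb{Z}$. The values attached to $m_\pm$ are $\kappa_\pm,\epsilon_\pm,\delta_\pm$. For $m>1$ put $\sigma_e(m)=(q^{\delta},q^{\delta+1},\dots,q^{2m-3/2})$ (with $\delta$ the value attached to $m$). Define finite sequences recursively by $r_e(\tfrac14)=r_e(\tfrac34)=\emptyset$ and $r_e(m)=(\sigma_e(m);r_e(m-1))$ (concatenation) for $m>1$. The sequence $-r_e(m)$ is obtained by multiplying each entry of $r_e(m)$ by $-1$. The length of $r_e(m_\pm)$ is $\lfloor l_\pm\rfloor$. **Parameters and $\mu$-function.** Let $b$ be a positive integer and $m_\pm$ real numbers. Define functions $\mathtt m_\pm$ on $R_0$ by $\mathtt m_+(\alpha)=b$, $\mathtt m_-(\alpha)=0$ for long $\alpha$, and $\mathtt m_+(\alpha)=b\,m_+$, $\mathtt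 m_-(\alpha)=b\,m_-$ for short $\alpha$. The $\mu$-function with normalisation factor $d=d(v)$ is $$\mu_{\mathtt m,d}=d\,v^{-2\sum_{\alpha\in R_0^+}(\mathtt m_+(\alpha)+\mathtt m_-(\alpha))}\prod_{\alpha\in R_0}\frac{1-\alpha^{-2}}{(1-v^{-2\mathtt m_+(\alpha)}\alpha^{-1})(1+v^{-2\mathtt m_-(\alpha)}\alpha^{-1})}.$$ Source: $\mu^r_{m_-,m_+}$ is this function on $T^r$ with $b=2$, parameters $(m_-,m_+)$, and $$d=(v^2-v^{-2})^{-r}\prod_{i=1}^{\lfloor |m_--m_+|\rfloor}\Bigl(\frac{v^{2|m_--m_+|-2i}}{1+q^{2|m_--m_+|-2i}}\Bigr)^{i}\prod_{j=1}^{\lfloor m_-+m_+\rfloor}\Bigl(\frac{v^{2(m_-+m_+)-2j}}{1+q^{2(m_-+m_+)-2j}}\Bigr)^{j}.$$ Target: $\mu^l_{\delta_-,\delta_+}$ is this function on $T^l$ with $b=1$, parameters $(m_-,m_+)$ replaced by $(\delta_-,\delta_+)$, and $d=(v-v^{-1})^{-l}(v+v^{-1})^{-\delta_-\delta_+}$. **Residual cosets.** Let $L\subset T$ be a coset of a subtorus $T^L\subset T$. Put, for $\epsilon=\pm$, $$p_\epsilon(L)=\{\alpha\in R_0:\epsilon\alpha|_L= v^{-2\mathtt m_\epsilon(\alpha)}\},\qquad z_\epsilon(L)=\{\alpha\in R_0:\epsilon\alpha|_L= 1\}$$ (here $\epsilon\alpha$ means the function $\pm\alpha$, i.e. the character value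 multiplied by the sign). $L$ is residual if $|p_+(L)|+|p_-(L)|-|z_+(L)|-|z_-(L)|=\operatorname{codim}(L)$. For $L$ residual, the regularisation of $\mu_{\mathtt m,d}$ along $L$ is $$\mu^L_{\mathtt m,d}=\frac{d\,v^{-2\sum_{\alpha\in R_0^+}(\mathtt m_+(\alpha)+\mathtt m_-(\alpha))}\prod_{\alpha\in R_0\setminus z_-(L)}(1+\alpha^{-1})\prod_{\alpha\in R_0\setminus z_+(L)}(1-\alpha^{-1})}{\prod_{\alpha\in R_0\setminus p_-(L)}(1+v^{-2\mathtt m_-(\alpha)}\alpha^{-1})\prod_{\alpha\in R_0\setminus p_+(L)}(1-v^{-2\mathtt m_+(\alpha)}\alpha^{-1})},$$ and $\mu^{(L)}_{\mathtt m,d}$ denotes its restriction to $L$, a nonzero rational function. Let $R_L\subset R_0$ be the set of roots that are constant on $L$, and let $T_L\subset T$ be the subtorus whose cocharacter lattice is $Y\cap\mathbb{Q}R_L^\vee$, where $Y$ is the cocharacter lattice of $T$. **Spectral transfer morphism.** Given two normalised affine Hecke algebras with tori $T_1,T_2$ and $\mu$-functions $\mu_1,\mu_2$, and a residual coset $L\subset T_2$ for $\mu_2$, a morphism $\phi_T:T_1\to T_2$ with image $L$ is a spectral transfer morphism if: (T1) $\phi_T$ is a finite morphism of algebraic varieties; (T2) $\phi_T$ maps the identity $e$ of $T_1$ into $L\cap T_L$, and when $\phi_T(e)$ is declared to be the base point (identity) of $L$, $\phi_T$ becomes a homomorphism of algebraic tori; (T3) there is a constant $c\in\mathbb{Q}^\times$,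 independent of $v$, with $\phi_T^*\bigl(\mu_2^{(L)}\bigr)=c\,\mu_1$. Thus part of the assertion is that the image of the morphism is a residual coset of the target. *)

theory Defs
  imports Complex_Main
begin

section \<open>Complex algebraic tori\<close>

text \<open>
  A point of the torus of rank \<open>N\<close> is a list of \<open>N\<close> nonzero complex numbers, indexed from \<open>0\<close>.
  The character lattice \<open>X\<close> and the cocharacter lattice \<open>Y\<close> are both the lattice of
  integer vectors of length \<open>N\<close>, represented as functions vanishing outside \<open>{..<N}\<close>.
\<close>

definition torus :: "nat \<Rightarrow> complex list set" where
  "torus N = {t. length t = N \<and> 0 \<notin> set t}"

definition torus_one :: "nat \<Rightarrow> complex list" where
  "torus_one N = replicate N 1"

definition tmul :: "complex list \<Rightarrow> complex list \<Rightarrow> complex list" where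
  "tmul s t = map2 (*) s t"

definition tinv :: "complex list \<Rightarrow> complex list" where
  "tinv t = map inverse t"

definition lattice_of_rank :: "nat \<Rightarrow> (nat \<Rightarrow> int) set" where
  "lattice_of_rank N = {x. \<forall>i\<ge>N. x i = 0}"

definition chr :: "nat \<Rightarrow> (nat \<Rightarrow> int) \<Rightarrow> complex list \<Rightarrow> complex" where
  "chr N x t = (\<Prod>i<N. (t ! i) powi (x i))"

definition cochr :: "nat \<Rightarrow> (nat \<Rightarrow> int) \<Rightarrow> complex \<Rightarrow> complex list" where
  "cochr N y z = map (\<lambda>i. z powi (y i)) [0..<N]"

text \<open>Regular functions on the torus are the Laurent polynomials, that is, the finite
  linear combinations of characters.\<close>

definition regular_fun :: "nat \<Rightarrow> (complex list \<Rightarrow> complex) \<Rightarrow> bool" where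
  "regular_fun N f \<longleftrightarrow>
     (\<exists>S c. finite S \<and> S \<subseteq> lattice_of_rank N \<and> (\<forall>t\<in>torus N. f t = (\<Sum>x\<in>S. c x * chr N x t)))"

definition torus_morphism :: "nat \<Rightarrow> nat \<Rightarrow> (complex list \<Rightarrow> complex list) \<Rightarrow> bool" where
  "torus_morphism M N \<phi> \<longleftrightarrow>
     \<phi> ` torus M \<subseteq> torus N \<and> (\<forall>i<N. regular_fun M (\<lambda>t. \<phi> t ! i))"

definition torus_hom :: "nat \<Rightarrow> nat \<Rightarrow> (complex list \<Rightarrow> complex list) \<Rightarrow> bool" where
  "torus_hom M N \<phi> \<longleftrightarrow>
     torus_morphism M N \<phi> \<and>
     (\<forall>s\<in>torus M. \<forall>t\<in>torus M. \<phi> (tmul s t) = tmul (\<phi> s) (\<phi> t))"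

text \<open>Finiteness of a morphism of affine varieties: the coordinate ring of the source is a
  finitely generated module over the coordinate ring of the target.\<close>

definition finite_morphism :: "nat \<Rightarrow> nat \<Rightarrow> (complex list \<Rightarrow> complex list) \<Rightarrow> bool" where
  "finite_morphism M N \<phi> \<longleftrightarrow>
     torus_morphism M N \<phi> \<and>
     (\<exists>B. finite B \<and> (\<forall>b\<in>B. regular_fun M b) \<and>
        (\<forall>f. regular_fun M f \<longrightarrow>
          (\<exists>g. (\<forall>b\<in>B. regular_fun N (g b)) \<and>
               (\<forall>t\<in>torus M. f t = (\<Sum>b\<in>B. g b (\<phi> t) * b t)))))"

text \<open>A subtorus of dimension \<open>k\<close>. In characteristic \<open>0\<close> an injective homomorphism of
  tori is a closed immersion, so its image is a closed subgroup isomorphic to the torus of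
  rank \<open>k\<close>.\<close>

definition subtorus :: "nat \<Rightarrow> nat \<Rightarrow> complex list set \<Rightarrow> bool" where
  "subtorus N k S \<longleftrightarrow> (\<exists>\<psi>. torus_hom k N \<psi> \<and> inj_on \<psi> (torus k) \<and> S = \<psi> ` torus k)"

definition subtorus_coset :: "nat \<Rightarrow> nat \<Rightarrow> complex list set \<Rightarrow> bool" where
  "subtorus_coset N k L \<longleftrightarrow> (\<exists>S. subtorus N k S \<and> (\<exists>a\<in>torus N. L = tmul a ` S))"

definition cochr_lattice :: "nat \<Rightarrow> complex list set \<Rightarrow> (nat \<Rightarrow> int) set" where
  "cochr_lattice N S = {y \<in> lattice_of_rank N. \<forall>z. z \<noteq> 0 \<longrightarrow> cochr N y z \<in> S}"


section \<open>The root system\<close>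

definition short_roots :: "nat \<Rightarrow> (nat \<Rightarrow> int) set" where
  "short_roots N = {(\<lambda>k. if k = i then s else 0) | i s. i < N \<and> s \<in> {1, -1}}"

definition long_roots :: "nat \<Rightarrow> (nat \<Rightarrow> int) set" where
  "long_roots N = {(\<lambda>k. if k = i then s else if k = j then s' else 0) | i j s s'.
     i < j \<and> j < N \<and> s \<in> {1, -1} \<and> s' \<in> {1, -1}}"

definition roots :: "nat \<Rightarrow> (nat \<Rightarrow> int) set" where
  "roots N = short_roots N \<union> long_roots N"

text \<open>Positive roots: those whose first nonzero coordinate is positive. They only enter
  through the sum of the labels, which is the same for every choice of positive roots.\<close>

definition pos_roots :: "nat \<Rightarrow> (nat \<Rightarrow> int) set" where
  "pos_roots N = {\<alpha> \<in> roots N. \<exists>i<N. \<alpha> i > 0 \<and> (\<forall>k<i. \<alpha> k = 0)}"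

text \<open>\<open>2 \<alpha> / (\<alpha>, \<alpha>)\<close>, where \<open>(\<alpha>, \<alpha>)\<close> is \<open>1\<close> for short and \<open>2\<close> for long roots.\<close>

definition coroot :: "nat \<Rightarrow> (nat \<Rightarrow> int) \<Rightarrow> nat \<Rightarrow> int" where
  "coroot N \<alpha> = (if \<alpha> \<in> short_roots N then (\<lambda>k. 2 * \<alpha> k) else \<alpha>)"


section \<open>Rational functions\<close>

text \<open>A rational function on an irreducible variety is represented by a pair of regular
  functions, a numerator and a denominator that does not vanish identically; equality is
  equality in the function field.\<close>

type_synonym ratfun = "(complex list \<Rightarrow> complex) \<times> (complex list \<Rightarrow> complex)"

definition ratfun_eq :: "complex list set \<Rightarrow> ratfun \<Rightarrow> ratfun \<Rightarrow> bool" where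
  "ratfun_eq V f g \<longleftrightarrow>
     (\<exists>t\<in>V. snd f t \<noteq> 0) \<and> (\<exists>t\<in>V. snd g t \<noteq> 0) \<and>
     (\<forall>t\<in>V. fst f t * snd g t = fst g t * snd f t)"

definition ratfun_pullback :: "(complex list \<Rightarrow> complex list) \<Rightarrow> ratfun \<Rightarrow> ratfun" where
  "ratfun_pullback \<phi> f = (fst f \<circ> \<phi>, snd f \<circ> \<phi>)"

definition ratfun_scale :: "complex \<Rightarrow> ratfun \<Rightarrow> ratfun" where
  "ratfun_scale c f = (\<lambda>t. c * fst f t, snd f)"


section \<open>The \<open>\<mu>\<close>-function and residual cosets\<close>

text \<open>The data of a normalised affine Hecke algebra of type \<open>B\<close>: the rank, the integer \<open>b\<close>
  (the base is \<open>q^b\<close>), the parameters \<open>m_-\<close> and \<open>m_+\<close>, and the normalisation factor as a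
  function of \<open>v\<close>.\<close>

record hecke_data =
  rank :: nat
  base :: nat
  par_minus :: real
  par_plus :: real
  norm_factor :: "real \<Rightarrow> real"

definition lab_plus :: "hecke_data \<Rightarrow> (nat \<Rightarrow> int) \<Rightarrow> real" where
  "lab_plus H \<alpha> =
     (if \<alpha> \<in> long_roots (rank H) then real (base H) else real (base H) * par_plus H)"

definition lab_minus :: "hecke_data \<Rightarrow> (nat \<Rightarrow> int) \<Rightarrow> real" where
  "lab_minus H \<alpha> =
     (if \<alpha> \<in> long_roots (rank H) then 0 else real (base H) * par_minus H)"

definition mu_const :: "hecke_data \<Rightarrow> real \<Rightarrow> real" where
  "mu_const H v = norm_factor H v *
     v powr (- 2 * (\<Sum>\<alpha>\<in>pos_roots (rank H). lab_plus H \<alpha> + lab_minus H \<alpha>))"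

definition mu :: "hecke_data \<Rightarrow> real \<Rightarrow> ratfun" where
  "mu H v =
    (\<lambda>t. of_real (mu_const H v) * (\<Prod>\<alpha>\<in>roots (rank H). 1 - chr (rank H) \<alpha> t powi (- 2)),
     \<lambda>t. \<Prod>\<alpha>\<in>roots (rank H).
           (1 - of_real (v powr (- 2 * lab_plus H \<alpha>)) * inverse (chr (rank H) \<alpha> t)) *
           (1 + of_real (v powr (- 2 * lab_minus H \<alpha>)) * inverse (chr (rank H) \<alpha> t)))"

definition p_plus :: "hecke_data \<Rightarrow> real \<Rightarrow> complex list set \<Rightarrow> (nat \<Rightarrow> int) set" where
  "p_plus H v L =
     {\<alpha> \<in> roots (rank H). \<forall>t\<in>L. chr (rank H) \<alpha> t = of_real (v powr (- 2 * lab_plus H \<alpha>))}"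

definition p_minus :: "hecke_data \<Rightarrow> real \<Rightarrow> complex list set \<Rightarrow> (nat \<Rightarrow> int) set" where
  "p_minus H v L =
     {\<alpha> \<in> roots (rank H). \<forall>t\<in>L. - chr (rank H) \<alpha> t = of_real (v powr (- 2 * lab_minus H \<alpha>))}"

definition z_plus :: "hecke_data \<Rightarrow> complex list set \<Rightarrow> (nat \<Rightarrow> int) set" where
  "z_plus H L = {\<alpha> \<in> roots (rank H). \<forall>t\<in>L. chr (rank H) \<alpha> t = 1}"

definition z_minus :: "hecke_data \<Rightarrow> complex list set \<Rightarrow> (nat \<Rightarrow> int) set" where
  "z_minus H L = {\<alpha> \<in> roots (rank H). \<forall>t\<in>L. - chr (rank H) \<alpha> t = 1}"

definition residual_coset :: "hecke_data \<Rightarrow> real \<Rightarrow> complex list set \<Rightarrow> bool" where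
  "residual_coset H v L \<longleftrightarrow>
     (\<exists>k. subtorus_coset (rank H) k L \<and>
        int (card (p_plus H v L)) + int (card (p_minus H v L))
          - int (card (z_plus H L)) - int (card (z_minus H L)) = int (rank H) - int k)"

text \<open>The regularisation along \<open>L\<close>. Its denominator does not vanish identically on \<open>L\<close>, so the
  same pair of functions, evaluated at points of \<open>L\<close> only, represents its restriction to \<open>L\<close>.\<close>

definition mu_reg :: "hecke_data \<Rightarrow> real \<Rightarrow> complex list set \<Rightarrow> ratfun" where
  "mu_reg H v L =
    (\<lambda>t. of_real (mu_const H v) *
         (\<Prod>\<alpha>\<in>roots (rank H) - z_minus H L. 1 + inverse (chr (rank H) \<alpha> t)) *
         (\<Prod>\<alpha>\<in>roots (rank H) - z_plus H L. 1 - inverse (chr (rank H) \<alpha> t)),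
     \<lambda>t. (\<Prod>\<alpha>\<in>roots (rank H) - p_minus H v L.
             1 + of_real (v powr (- 2 * lab_minus H \<alpha>)) * inverse (chr (rank H) \<alpha> t)) *
         (\<Prod>\<alpha>\<in>roots (rank H) - p_plus H v L.
             1 - of_real (v powr (- 2 * lab_plus H \<alpha>)) * inverse (chr (rank H) \<alpha> t)))"


section \<open>Spectral transfer morphisms\<close>

definition roots_const_on :: "nat \<Rightarrow> complex list set \<Rightarrow> (nat \<Rightarrow> int) set" where
  "roots_const_on N L = {\<alpha> \<in> roots N. \<forall>s\<in>L. \<forall>t\<in>L. chr N \<alpha> s = chr N \<alpha> t}"

text \<open>The intersection of \<open>Y\<close> with the rational span of the coroots of the roots in \<open>R\<close>.\<close>

definition coroot_sat :: "nat \<Rightarrow> (nat \<Rightarrow> int) set \<Rightarrow> (nat \<Rightarrow> int) set" where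
  "coroot_sat N R = {y \<in> lattice_of_rank N.
     \<exists>c :: (nat \<Rightarrow> int) \<Rightarrow> rat. \<forall>k. of_int (y k) = (\<Sum>\<alpha>\<in>R. c \<alpha> * of_int (coroot N \<alpha> k))}"

text \<open>\<open>S\<close> is the subtorus \<open>T_L\<close> attached to \<open>L\<close>; a subtorus is determined by its cocharacter
  lattice, so there is at most one such \<open>S\<close>.\<close>

definition is_T_L :: "nat \<Rightarrow> complex list set \<Rightarrow> complex list set \<Rightarrow> bool" where
  "is_T_L N L S \<longleftrightarrow>
     (\<exists>k. subtorus N k S) \<and> cochr_lattice N S = coroot_sat N (roots_const_on N L)"

text \<open>The torus structure on the coset \<open>L\<close> with identity \<open>\<phi> e\<close> is the one transported from
  the subtorus \<open>L (\<phi> e)\<^sup>-\<^sup>1\<close>; hence the translate of \<open>\<phi>\<close> by the inverse of \<open>\<phi> e\<close> in the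
  second condition.\<close>

definition stm_T2 :: "nat \<Rightarrow> nat \<Rightarrow> (complex list \<Rightarrow> complex list) \<Rightarrow> bool" where
  "stm_T2 M N \<phi> \<longleftrightarrow>
     (\<exists>S. is_T_L N (\<phi> ` torus M) S \<and> \<phi> (torus_one M) \<in> \<phi> ` torus M \<inter> S) \<and>
     torus_hom M N (\<lambda>t. tmul (\<phi> t) (tinv (\<phi> (torus_one M))))"

text \<open>Everything depends on the parameter \<open>v > 1\<close>: \<open>\<phi> v\<close> is the morphism for the value \<open>v\<close>,
  and its image \<open>L\<close> must be a residual coset. The rational constant \<open>c\<close> is chosen before \<open>v\<close>.\<close>

definition spectral_transfer_morphism ::
  "hecke_data \<Rightarrow> hecke_data \<Rightarrow> (real \<Rightarrow> complex list \<Rightarrow> complex list) \<Rightarrow> bool" where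
  "spectral_transfer_morphism H1 H2 \<phi> \<longleftrightarrow>
     (\<forall>v>1. torus_morphism (rank H1) (rank H2) (\<phi> v) \<and>
            residual_coset H2 v (\<phi> v ` torus (rank H1)) \<and>
            finite_morphism (rank H1) (rank H2) (\<phi> v) \<and>
            stm_T2 (rank H1) (rank H2) (\<phi> v)) \<and>
     (\<exists>c :: rat. c \<noteq> 0 \<and>
        (\<forall>v>1. ratfun_eq (torus (rank H1))
                 (ratfun_pullback (\<phi> v) (mu_reg H2 v (\<phi> v ` torus (rank H1))))
                 (ratfun_scale (of_rat c) (mu H1 v))))"


section \<open>The integers attached to a parameter and the sequences \<open>r_e\<close>\<close>

definition quarter_par :: "real \<Rightarrow> bool" where
  "quarter_par m \<longleftrightarrow> m - 1/4 \<in> \<int> \<or> m + 1/4 \<in> \<int>"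

definition kappa :: "real \<Rightarrow> nat" where
  "kappa m = (THE k. \<exists>e\<in>{0, 1::nat}. m = real k + (2 * real e - 1) / 4)"

definition eps :: "real \<Rightarrow> nat" where
  "eps m = (THE e. e \<in> {0, 1} \<and> (\<exists>k::nat. m = real k + (2 * real e - 1) / 4))"

definition delta :: "real \<Rightarrow> nat" where
  "delta m = (THE d. d \<in> {0, 1} \<and> even (int (kappa m) - int d))"

lemma quarter_par_decomp:
  assumes "m > 0" "quarter_par m"
  obtains k e :: nat where "e \<in> {0, 1}" "m = real k + (2 * real e - 1) / 4"
proof -
  from assms(2) consider (a) i where "m = of_int i + 1/4" | (b) i where "m = of_int i - 1/4"
    unfolding quarter_par_def by (auto elim!: Ints_cases simp: algebra_simps)
  then show ?thesis
  proof cases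
    case a
    with assms(1) have "i \<ge> 0" by linarith
    with a show ?thesis by (intro that[of 1 "nat i"]) auto
  next
    case b
    with assms(1) have "i \<ge> 0" by linarith
    with b show ?thesis by (intro that[of 0 "nat i"]) auto
  qed
qed

lemma quarter_par_unique:
  fixes k k' e e' :: nat
  assumes "e \<in> {0, 1}" "e' \<in> {0, 1}"
    and "real k + (2 * real e - 1) / 4 = real k' + (2 * real e' - 1) / 4"
  shows "k = k' \<and> e = e'"
proof -
  from assms(3) have "real (4 * k + 2 * e) = real (4 * k' + 2 * e')" by (simp add: field_simps)
  then have "4 * k + 2 * e = 4 * k' + 2 * e'" by linarith
  with assms(1,2) show ?thesis by (elim insertE emptyE) (simp_all, presburger+)
qed

lemma kappa_eq:
  assumes "e \<in> {0, 1}" "m = real k + (2 * real e - 1) / 4"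
  shows "kappa m = k"
  unfolding kappa_def
proof (rule the_equality)
  show "\<exists>e\<in>{0, 1::nat}. m = real k + (2 * real e - 1) / 4"
    using assms by (rule bexI[rotated])
next
  fix k' :: nat assume "\<exists>e\<in>{0, 1::nat}. m = real k' + (2 * real e - 1) / 4"
  then obtain e' where "e' \<in> {0, 1::nat}" "m = real k' + (2 * real e' - 1) / 4" ..
  with quarter_par_unique[of e' e k' k] assms show "k' = k" by argo
qed

lemma eps_eq:
  assumes "e \<in> {0, 1}" "m = real k + (2 * real e - 1) / 4"
  shows "eps m = e"
  unfolding eps_def
proof (rule the_equality)
  show "e \<in> {0, 1} \<and> (\<exists>k::nat. m = real k + (2 * real e - 1) / 4)"
    using assms by (intro conjI exI)
next
  fix e' :: nat assume *: "e' \<in> {0, 1} \<and> (\<exists>k::nat. m = real k + (2 * real e' - 1) / 4)"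
  then obtain k' :: nat where "m = real k' + (2 * real e' - 1) / 4" by (elim conjE exE)
  with quarter_par_unique[of e' e k' k] assms * show "e' = e" by argo
qed

lemma delta_eq: "delta m = kappa m mod 2"
  unfolding delta_def
proof (rule the_equality)
  show "kappa m mod 2 \<in> {0, 1} \<and> even (int (kappa m) - int (kappa m mod 2))"
    by (simp; presburger)
next
  fix d :: nat assume "d \<in> {0, 1} \<and> even (int (kappa m) - int d)"
  then show "d = kappa m mod 2" by (simp; presburger)
qed

text \<open>\<open>2 m - 3/2\<close> is the integer \<open>2 \<kappa> + \<epsilon> - 2\<close> for the parameters considered.\<close>

definition sigma_e :: "real \<Rightarrow> real \<Rightarrow> complex list" where
  "sigma_e v m = map (\<lambda>k. of_real ((v\<^sup>2) ^ k)) [delta m..<Suc (nat \<lfloor>2 * m - 3/2\<rfloor>)]"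

function r_e :: "real \<Rightarrow> real \<Rightarrow> complex list" where
  "r_e v m = (if m > 1 then sigma_e v m @ r_e v (m - 1) else [])"
  by pat_completeness auto
termination
proof (relation "measure (\<lambda>(v, m). nat \<lfloor>m\<rfloor>)")
  fix v m :: real assume "1 < m"
  then have "\<lfloor>m - 1\<rfloor> < \<lfloor>m\<rfloor>" "0 < \<lfloor>m\<rfloor>" by linarith+
  then show "((v, m - 1), (v, m)) \<in> measure (\<lambda>(v, m). nat \<lfloor>m\<rfloor>)" by simp
qed (rule wf_measure)

declare r_e.simps [simp del]

definition l_par :: "real \<Rightarrow> real" where
  "l_par m = real (kappa m) * (real (kappa m) + real (eps m) - 1/2)"

definition target_rank :: "nat \<Rightarrow> real \<Rightarrow> real \<Rightarrow> nat" where
  "target_rank r mm mp = 2 * r + nat \<lfloor>l_par mm\<rfloor> + nat \<lfloor>l_par mp\<rfloor>"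


section \<open>The source, the target and the morphism\<close>

definition source_norm :: "nat \<Rightarrow> real \<Rightarrow> real \<Rightarrow> real \<Rightarrow> real" where
  "source_norm r mm mp v =
     (v powi 2 - v powi (- 2)) powi (- int r) *
     (\<Prod>i = 1..nat \<lfloor>\<bar>mm - mp\<bar>\<rfloor>.
        (v powr (2 * \<bar>mm - mp\<bar> - 2 * real i) / (1 + (v\<^sup>2) powr (2 * \<bar>mm - mp\<bar> - 2 * real i))) ^ i) *
     (\<Prod>j = 1..nat \<lfloor>mm + mp\<rfloor>.
        (v powr (2 * (mm + mp) - 2 * real j) / (1 + (v\<^sup>2) powr (2 * (mm + mp) - 2 * real j))) ^ j)"

definition source_hecke :: "nat \<Rightarrow> real \<Rightarrow> real \<Rightarrow> hecke_data" where
  "source_hecke r mm mp =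
     \<lparr>rank = r, base = 2, par_minus = mm, par_plus = mp, norm_factor = source_norm r mm mp\<rparr>"

definition target_norm :: "nat \<Rightarrow> nat \<Rightarrow> nat \<Rightarrow> real \<Rightarrow> real" where
  "target_norm l dm dp v =
     (v - v powi (- 1)) powi (- int l) * (v + v powi (- 1)) powi (- (int dm * int dp))"

definition target_hecke :: "nat \<Rightarrow> nat \<Rightarrow> nat \<Rightarrow> hecke_data" where
  "target_hecke l dm dp =
     \<lparr>rank = l, base = 1, par_minus = real dm, par_plus = real dp,
      norm_factor = target_norm l dm dp\<rparr>"

definition xi :: "real \<Rightarrow> real \<Rightarrow> real \<Rightarrow> complex list \<Rightarrow> complex list" where
  "xi mm mp v ts =
     map uminus (r_e v mm) @
     concat (map (\<lambda>t. [of_real (inverse v) * t, of_real v * t]) ts) @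
     r_e v mp"

end

theory Submission
  imports Defs "HOL-Analysis.Analysis" "HOL-Library.Function_Algebras" "HOL-Library.Z2"
begin

text \<open>
  Restricted to the image \<open>L\<close> of \<open>\<xi>\<close>, every root of the target becomes a monomial
  \<open>\<plusminus> v\<^sup>k t\<^sup>\<beta>\<close> in the coordinates of the source. Such monomials are recorded as elements
  of an additive group of weights. The \<open>\<mu>\<close>-functions and the sets \<open>p\<^sub>\<plusminus>\<close>, \<open>z\<^sub>\<plusminus>\<close> depend only on the
  multiset of weights of the roots, so the theorem is an identity between two such multisets.

  To a weight \<open>w\<close> attach the factor \<open>1 - w\<close>, and a nonzero parameter \<open>u\<close> if \<open>w\<close> is trivial. For
  \<open>u = 1\<close> this is the regularisation along \<open>L\<close>, while the exponent of \<open>u\<close> in a product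
  counts trivial factors; comparing exponents of \<open>u\<close> in the identity below yields
  \<open>|p\<^sub>+| + |p\<^sub>-| - |z\<^sub>+| - |z\<^sub>-| = l - r\<close>, so residuality of \<open>L\<close> and the formula for the pullback are one
  statement. Scaling the factor to \<open>E(w) = v\<^bsup>-k/2\<^esup> (1 - w)\<close> absorbs the constant
  \<open>v\<^bsup>-2\<Sigma>(m\<^sub>+ + m\<^sub>-)\<^esup>\<close> exactly, and no power of \<open>v\<close> survives (\<open>mu_value\<close>).

  Put \<open>K(w) = E(w) / E(w/q)\<close>. Because \<open>\<delta>\<^sub>\<plusminus>\<close> is \<open>0\<close> or \<open>1\<close>, the short roots can be treated as
  long roots of a larger system: the target \<open>\<mu>\<close> is the product of \<open>K(xy)\<close> over unordered
  pairs from the multiset \<open>U\<close> of all coordinates and their inverses together with \<open>1\<close> if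
  \<open>\<delta>\<^sub>+ = 1\<close> and \<open>-1\<close> if \<open>\<delta>\<^sub>- = 1\<close>, divided by \<open>K(1)\<^sup>l K(-1)\<^bsup>\<delta>\<^sub>-\<delta>\<^sub>+\<^esup>\<close>
  (\<open>mu_product_target\<close>). The divisor is what the target normalisation cancels, up to a power of
  \<open>u\<close> and of \<open>2\<close>.

  The point of the definition of \<open>r\<^sub>e(m)\<close> is that the constant part of \<open>U\<close> consists of complete
  strings \<open>\<plusminus> q\<^bsup>-a\<^esup>, \<dots>, \<plusminus> q\<^bsup>a\<^esup>\<close> with \<open>a = \<epsilon> + 2j\<close>, \<open>j < \<kappa>\<close>
  (\<open>mset_target_weights\<close>). Products of \<open>K\<close> along a string telescope. A string against the four
  weights \<open>v\<^bsup>\<plusminus>1\<^esup> t\<^bsup>\<plusminus>1\<^esup>\<close> leaves a quotient that telescopes once more in \<open>j\<close> and ends at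
  \<open>v\<^bsup>-4m\<^esup>\<close>, the short root label of the source (\<open>cross_segs_block\<close>). The four weights of one
  coordinate among themselves give the numerator of the short roots (\<open>pairK_block\<close>), and those of two
  coordinates against each other give the long roots of the source with \<open>q\<^sup>2\<close> in place of
  \<open>q\<close> (\<open>crossK_block_block\<close>).

  There remains the product over pairs of strings, a constant in \<open>t\<close>. It is a quotient of numbers
  \<open>v\<^sup>n - v\<^bsup>-n\<^esup>\<close> and \<open>v\<^sup>n + v\<^bsup>-n\<^esup>\<close>. The former combine to the latter because
  \<open>v\<^bsup>2n\<^esup> - v\<^bsup>-2n\<^esup> = (v\<^sup>n - v\<^bsup>-n\<^esup>)(v\<^sup>n + v\<^bsup>-n\<^esup>)\<close> (\<open>quantum_quotient\<close>), and the outcome equals the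
  source normalisation up to a rational number because both satisfy the same recursion under
  \<open>m\<^sub>\<plusminus> \<mapsto> m\<^sub>\<plusminus> + 1\<close> (\<open>res_const_rat_prop\<close>).

  These computations divide by factors \<open>1 - w\<close>, so they are carried out at generic \<open>t\<close> and extended
  to all of the torus by continuity along a curve (\<open>zero_off_generic\<close>). The geometric conditions hold
  because \<open>\<xi>\<close> is a translate of an injective monomial homomorphism through which every
  coordinate of \<open>t\<close> can be read off, and because the torus \<open>T\<^sub>L\<close> is cut out by
  \<open>x y = 1\<close> for each pair of adjacent coordinates \<open>x, y\<close> in the middle part, which \<open>\<xi>(1)\<close> satisfies as
  \<open>v\<^bsup>-1\<^esup> v = 1\<close> (\<open>TL_eq\<close>, \<open>xi_T2\<close>).
\<close>

section \<open>Products over pairs of list entries\<close>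

primrec pairprod :: "('a \<Rightarrow> 'a \<Rightarrow> 'b::comm_monoid_mult) \<Rightarrow> 'a list \<Rightarrow> 'b" where
  "pairprod g [] = 1"
| "pairprod g (x # xs) = (\<Prod>y\<leftarrow>xs. g x y) * pairprod g xs"

definition crossprod :: "('a \<Rightarrow> 'b \<Rightarrow> 'c::comm_monoid_mult) \<Rightarrow> 'a list \<Rightarrow> 'b list \<Rightarrow> 'c" where
  "crossprod g xs ys = (\<Prod>x\<leftarrow>xs. \<Prod>y\<leftarrow>ys. g x y)"

lemma prod_list_mult_map:
  "(\<Prod>x\<leftarrow>xs. f x * g x) = (\<Prod>x\<leftarrow>xs. f x) * (\<Prod>x\<leftarrow>xs. g x :: 'b::comm_monoid_mult)"
  by (induction xs) (auto simp: ac_simps)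

lemma prod_list_divide_map:
  "(\<Prod>x\<leftarrow>xs. f x / g x) = (\<Prod>x\<leftarrow>xs. f x) / (\<Prod>x\<leftarrow>xs. g x :: 'b::field)"
  by (induction xs) auto

lemma prod_list_ones [simp]: "(\<Prod>x\<leftarrow>xs. 1) = 1"
  by (induction xs) auto

lemma crossprod_Nil [simp]: "crossprod g [] ys = 1" "crossprod g xs [] = 1"
  by (auto simp: crossprod_def)

lemma crossprod_Cons: "crossprod g (x # xs) ys = (\<Prod>y\<leftarrow>ys. g x y) * crossprod g xs ys"
  by (simp add: crossprod_def)

lemma crossprod_append_left:
  "crossprod g (xs @ xs') ys = crossprod g xs ys * crossprod g xs' ys"
  by (simp add: crossprod_def)

lemma crossprod_append_right:
  "crossprod g xs (ys @ ys') = crossprod g xs ys * crossprod g xs ys'"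
  by (simp add: crossprod_def prod_list_mult_map)

lemma crossprod_commute: "crossprod g xs ys = crossprod (\<lambda>y x. g x y) ys xs"
  by (induction xs) (auto simp: crossprod_Cons crossprod_def prod_list_mult_map)

lemma crossprod_concat_right:
  "crossprod g xs (concat yss) = (\<Prod>ys\<leftarrow>yss. crossprod g xs ys)"
  by (induction yss) (auto simp: crossprod_append_right)

lemma pairprod_append:
  "pairprod g (xs @ ys) = pairprod g xs * pairprod g ys * crossprod g xs ys"
  by (induction xs) (auto simp: crossprod_Cons ac_simps)

lemma pairprod_concat:
  "pairprod g (concat xss) = (\<Prod>xs\<leftarrow>xss. pairprod g xs) * pairprod (crossprod g) xss"
  by (induction xss) (auto simp: pairprod_append crossprod_concat_right ac_simps)

lemma pairprod_map: "pairprod g (map h xs) = pairprod (\<lambda>x y. g (h x) (h y)) xs"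
  by (induction xs) (auto simp: o_def)

lemma pairprod_distinct_cong:
  assumes "distinct xs" "\<And>x y. x \<in> set xs \<Longrightarrow> y \<in> set xs \<Longrightarrow> x \<noteq> y \<Longrightarrow> g x y = g' x y"
  shows "pairprod g xs = pairprod g' xs"
  using assms
proof (induction xs)
  case (Cons a xs)
  have "(\<Prod>y\<leftarrow>xs. g a y) = (\<Prod>y\<leftarrow>xs. g' a y)"
    using Cons.prems by (intro arg_cong[where f = prod_list] map_cong) auto
  moreover have "pairprod g xs = pairprod g' xs" using Cons by auto
  ultimately show ?case by simp
qed simp

text \<open>Only the multiset of entries matters for a symmetric function. This is what permits the weights of the
  target to be rearranged into strings.\<close>

lemma pairprod_mset:
  assumes sym: "\<And>x y. g x y = g y x" and "mset xs = mset ys"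
  shows "pairprod g xs = pairprod g ys"
  using assms(2)
proof (induction xs arbitrary: ys)
  case (Cons x xs)
  then have "x \<in> set ys" by (metis list.set_intros(1) set_mset_mset)
  then obtain as bs where ys: "ys = as @ x # bs" by (meson split_list)
  with Cons.prems have m: "mset xs = mset (as @ bs)" by simp
  have "pairprod g ys = pairprod g (as @ bs) * (\<Prod>y\<leftarrow>as @ bs. g x y)"
    using sym by (simp add: ys pairprod_append crossprod_def prod_list_mult_map ac_simps)
  also have "(\<Prod>y\<leftarrow>as @ bs. g x y) = (\<Prod>y\<leftarrow>xs. g x y)"
    using m by (metis mset_map prod_mset_prod_list)
  also have "pairprod g (as @ bs) = pairprod g xs" using Cons.IH m by metis
  finally show ?case by (simp add: mult.commute)
qed simp

lemma prod_list_nth: "(\<Prod>x\<leftarrow>xs. f x) = (\<Prod>i<length xs. f (xs ! i))"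
  by (induction xs rule: rev_induct) (auto simp: nth_append)

lemma pairprod_nth:
  "pairprod g xs = (\<Prod>j<length xs. \<Prod>i<j. g (xs ! i) (xs ! j))"
proof (induction xs rule: rev_induct)
  case (snoc x xs)
  show ?case
    by (simp add: pairprod_append crossprod_def snoc nth_append prod_list_nth)
qed simp

text \<open>The products of \<open>K\<close> along a string of powers of \<open>q\<close> have this shape.\<close>

lemma prod_list_telescope:
  fixes F :: "int \<Rightarrow> 'b::field"
  assumes "\<And>k. l - 1 \<le> k \<Longrightarrow> k \<le> h \<Longrightarrow> F k \<noteq> 0" "l \<le> h + 1"
  shows "(\<Prod>k\<leftarrow>[l..h]. F k / F (k - 1)) = F h / F (l - 1)"
  using assms
proof (induction "nat (h + 1 - l)" arbitrary: h)
  case 0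
  then have "h = l - 1" by simp
  with 0(2) show ?case by simp
next
  case (Suc n)
  then have "l \<le> h" by linarith
  then have "[l..h] = [l..h - 1] @ [h]" by (simp add: upto_rec2)
  moreover have "(\<Prod>k\<leftarrow>[l..h - 1]. F k / F (k - 1)) = F (h - 1) / F (l - 1)"
    using Suc by (intro Suc) auto
  ultimately show ?case using Suc.prems(1)[of "h - 1"] \<open>l \<le> h\<close> by simp
qed

section \<open>Products over the roots of type B\<close>

definition sroot :: "nat \<Rightarrow> int \<Rightarrow> nat \<Rightarrow> int" where
  "sroot i s = (\<lambda>k. if k = i then s else 0)"

definition lroot :: "nat \<Rightarrow> nat \<Rightarrow> int \<Rightarrow> int \<Rightarrow> nat \<Rightarrow> int" where
  "lroot i j s s' = (\<lambda>k. if k = i then s else if k = j then s' else 0)"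

lemma short_roots_image: "short_roots N = (\<lambda>(i, s). sroot i s) ` ({..<N} \<times> {1, -1})"
  by (auto simp: short_roots_def sroot_def image_iff) 

lemma long_roots_image:
  "long_roots N = (\<lambda>(j, i, s, s'). lroot i j s s') ` (SIGMA j:{..<N}. {..<j} \<times> {1, -1} \<times> {1, -1})"
proof (rule set_eqI, rule iffI)
  fix \<alpha> assume "\<alpha> \<in> long_roots N"
  then obtain i j s s' where "\<alpha> = lroot i j s s'" "i < j" "j < N" "s \<in> {1, -1}" "s' \<in> {1, -1}"
    unfolding long_roots_def lroot_def by blast
  then show "\<alpha> \<in> (\<lambda>(j, i, s, s'). lroot i j s s') `
      (SIGMA j:{..<N}. {..<j} \<times> {1, -1} \<times> {1, -1})"
    by (intro image_eqI[where x = "(j, i, s, s')"]) auto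
next
  fix \<alpha> assume "\<alpha> \<in> (\<lambda>(j, i, s, s'). lroot i j s s') `
      (SIGMA j:{..<N}. {..<j} \<times> {1, -1} \<times> {1, -1})"
  then obtain p where p: "p \<in> (SIGMA j:{..<N}. {..<j} \<times> {1, -1} \<times> {1, -1})"
      "\<alpha> = (\<lambda>(j, i, s, s'). lroot i j s s') p"
    by (rule imageE)
  obtain j i s s' where "p = (j, i, s, s')" by (rule prod_cases4)
  with p have "\<alpha> = lroot i j s s'" "i < j" "j < N" "s \<in> {1, -1}" "s' \<in> {1, -1}"
    by auto
  then show "\<alpha> \<in> long_roots N"
    unfolding long_roots_def lroot_def by blast
qed

lemma finite_roots [simp]: "finite (short_roots N)" "finite (long_roots N)" "finite (roots N)"
  by (auto simp: short_roots_image long_roots_image roots_def)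

lemma inj_sroot: "inj_on (\<lambda>(i, s). sroot i s) ({..<N} \<times> {1, -1})"
  unfolding inj_on_def sroot_def by (auto simp: fun_eq_iff split: if_splits) 

lemma inj_lroot:
  "inj_on (\<lambda>(j, i, s, s'). lroot i j s s') (SIGMA j:{..<N}. {..<j} \<times> {1, -1} \<times> {1, -1})"
proof (rule inj_onI, clarsimp, goal_cases)
  case (1 j i s s' j' i' z z')
  have e: "lroot i j s s' k = lroot i' j' z z' k" for k using 1 by simp
  have ne: "s \<noteq> 0" "s' \<noteq> 0" "z \<noteq> 0" "z' \<noteq> 0" using 1 by auto
  have "{i, j} = {i', j'}"
    using e ne by (auto simp: lroot_def) (metis)+
  then have "i = i'" "j = j'" using 1 by (auto simp: doubleton_eq_iff)
  with e[of i] e[of j] 1 show ?case by (auto simp: lroot_def)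
qed

lemma short_long_disjoint: "short_roots N \<inter> long_roots N = {}"
proof -
  have False if "i < j" "s \<in> {1,-1}" "s' \<in> {1,-1}" "sroot k z = lroot i j s s'" for i j k s s' z
    using that(2,3,1) fun_cong[OF that(4), of i] fun_cong[OF that(4), of j]
    by (auto simp: sroot_def lroot_def split: if_splits)
  then show ?thesis by (force simp: short_roots_image long_roots_image)
qed

lemma prod_short_roots:
  "prod f (short_roots N) = (\<Prod>i<N. f (sroot i 1) * f (sroot i (-1)))"
proof -
  have "prod f (short_roots N) = (\<Prod>(i, s)\<in>{..<N} \<times> {1, -1}. f (sroot i s))"
    unfolding short_roots_image by (subst prod.reindex[OF inj_sroot]) (simp add: o_def case_prod_unfold)
  then show ?thesis by (simp add: prod.cartesian_product[symmetric])
qed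

lemma prod_long_roots:
  "prod f (long_roots N) = (\<Prod>j<N. \<Prod>i<j. f (lroot i j 1 1) * f (lroot i j 1 (-1)) *
      (f (lroot i j (-1) 1) * f (lroot i j (-1) (-1))))"
proof -
  have "prod f (long_roots N) =
      (\<Prod>(j, p)\<in>(SIGMA j:{..<N}. {..<j} \<times> {1, -1} \<times> {1, -1}).
         (case p of (i, s, s') \<Rightarrow> f (lroot i j s s')))"
    unfolding long_roots_image by (subst prod.reindex[OF inj_lroot]) (simp add: o_def case_prod_unfold)
  also have "\<dots> = (\<Prod>j<N. \<Prod>(i, p)\<in>{..<j} \<times> ({1, -1} \<times> {1, -1}).
         (case p of (s, s') \<Rightarrow> f (lroot i j s s')))"
    by (subst prod.Sigma[symmetric]) auto
  also have "\<dots> = (\<Prod>j<N. \<Prod>i<j. \<Prod>(s, s')\<in>{1, -1} \<times> {1, -1}. f (lroot i j s s'))"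
    by (subst prod.cartesian_product) (simp add: case_prod_unfold)
  finally show ?thesis by (simp add: prod.cartesian_product[symmetric] mult.assoc)
qed

lemma prod_roots: "prod f (roots N) = prod f (short_roots N) * prod f (long_roots N)"
  unfolding roots_def by (rule prod.union_disjoint) (auto simp: short_long_disjoint)

section \<open>Weights and their factors\<close>

text \<open>The weight \<open>(s, k, \<beta>)\<close> stands for the monomial \<open>(-1)\<^sup>s v\<^sup>k t\<^sup>\<beta>\<close>. Written additively, weights form an
  abelian group by the product and pointwise structure of the type, so that rearranging monomials is
  left to the simplifier.\<close>

type_synonym wt = "bit \<times> int \<times> (nat \<Rightarrow> int)"

definition vexp :: "wt \<Rightarrow> int" where "vexp w = fst (snd w)"
definition texp :: "wt \<Rightarrow> nat \<Rightarrow> int" where "texp w = snd (snd w)"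

definition sg :: wt where "sg = (1, 0, 0)"
definition vw :: "int \<Rightarrow> wt" where "vw k = (0, k, 0)"
definition tw :: "nat \<Rightarrow> wt" where "tw i = (0, 0, sroot i 1)"

definition val :: "real \<Rightarrow> nat \<Rightarrow> complex list \<Rightarrow> wt \<Rightarrow> complex" where
  "val v r t w = (if fst w = 0 then 1 else -1) * of_real (v powi vexp w) * chr r (texp w) t"

lemma exp_simps [simp]:
  "vexp (w + w') = vexp w + vexp w'" "vexp (- w) = - vexp w" "vexp (w - w') = vexp w - vexp w'"
  "texp (w + w') = texp w + texp w'" "texp (- w) = - texp w" "texp (w - w') = texp w - texp w'"
  "vexp sg = 0" "texp sg = 0" "vexp (vw k) = k" "texp (vw k) = 0" "vexp (tw i) = 0"
  "texp (tw i) = sroot i 1" "vexp 0 = 0" "texp 0 = 0"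
  by (simp_all add: vexp_def texp_def sg_def vw_def tw_def)

lemma wt_eq_iff: "w = w' \<longleftrightarrow> fst w = fst w' \<and> vexp w = vexp w' \<and> texp w = texp w'"
  by (auto simp: vexp_def texp_def prod_eq_iff)

lemma fst_simps [simp]: "fst sg = 1" "fst (vw k) = 0" "fst (tw i) = 0"
  by (simp_all add: sg_def vw_def tw_def)

lemma vw_add: "vw a + vw b = vw (a + b)" "vw a - vw b = vw (a - b)" "- vw a = vw (- a)"
  by (simp_all add: vw_def)

lemma vw_0: "vw 0 = 0" by (simp add: vw_def zero_prod_def)

lemma vw_eq_0_iff [simp]: "vw k = 0 \<longleftrightarrow> k = 0"
  by (simp add: wt_eq_iff)

lemma sg_sg [simp]: "sg + sg = 0" "- sg = sg" "sg + (sg + w) = w"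
  by (simp_all add: wt_eq_iff)

lemma sg_neq [simp]: "sg \<noteq> 0" "sg + vw k \<noteq> 0"
  by (simp_all add: wt_eq_iff)

lemma torus_nth: "t \<in> torus r \<Longrightarrow> i < r \<Longrightarrow> t ! i \<noteq> 0"
  unfolding torus_def using nth_mem[of i t] by force

lemma chr_add:
  assumes "t \<in> torus r"
  shows "chr r (a + b) t = chr r a t * chr r b t"
  using torus_nth[OF assms] by (simp add: chr_def power_int_add prod.distrib[symmetric])

lemma chr_0 [simp]: "chr r 0 t = 1"
  by (simp add: chr_def)

lemma chr_uminus: "chr r (- a) t = inverse (chr r a t)"
  by (simp add: chr_def power_int_minus prod_inversef[symmetric] o_def)

lemma chr_nz: "t \<in> torus r \<Longrightarrow> chr r a t \<noteq> 0"
  by (auto simp: chr_def torus_nth)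

lemma bit_cases: "(b::bit) = 0 \<or> b = 1" by (cases b) auto

lemma val_add:
  assumes "t \<in> torus r" "v > 0"
  shows "val v r t (w + w') = val v r t w * val v r t w'"
  using assms bit_cases[of "fst w"] bit_cases[of "fst w'"]
  by (auto simp: val_def chr_add power_int_add)

lemma val_0 [simp]: "val v r t 0 = 1"
  by (simp add: val_def)

lemma val_minus: "val v r t (- w) = inverse (val v r t w)"
  using bit_cases[of "fst w"]
  by (auto simp: val_def chr_uminus power_int_minus)

lemma val_nz: "t \<in> torus r \<Longrightarrow> v > 0 \<Longrightarrow> val v r t w \<noteq> 0"
  by (auto simp: val_def chr_nz)

lemma val_vw: "val v r t (vw k) = of_real (v powi k)"
  by (simp add: val_def)

lemma val_sg: "val v r t sg = -1"
  by (simp add: val_def)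

lemma val_diff:
  assumes "t \<in> torus r" "v > 0"
  shows "val v r t (w - w') = val v r t w / val v r t w'"
  using val_add[OF assms, of w "- w'"] by (simp add: val_minus divide_inverse)

text \<open>Every weight met below is a sum of two weights whose exponents are at most \<open>1\<close> in absolute value,
  hence the bound \<open>2\<close>. A bound makes the exponents a finite set, so that one curve can be chosen that
  separates them all.\<close>

definition small_exps :: "nat \<Rightarrow> (nat \<Rightarrow> int) set" where
  "small_exps r = {b \<in> lattice_of_rank r. \<forall>i. \<bar>b i\<bar> \<le> 2}"

text \<open>At such a point a nonconstant weight with small exponents never takes the value \<open>1\<close>, whatever
  its power of \<open>v\<close> and its sign.\<close>

definition generic :: "real \<Rightarrow> nat \<Rightarrow> complex list \<Rightarrow> bool" where
  "generic v r t \<longleftrightarrow> t \<in> torus r \<and>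
     (\<forall>b\<in>small_exps r - {0}. \<forall>k. chr r b t \<noteq> of_real (v powi k) \<and> chr r b t \<noteq> - of_real (v powi k))"

lemma powi_eq_1_iff:
  assumes "(v::real) > 1" shows "v powi k = 1 \<longleftrightarrow> k = 0"
  by (smt (verit) assms power_int_strict_increasing power_int_0_right)

text \<open>If \<open>\<beta> = 0\<close> the value is \<open>\<plusminus> v\<^sup>k\<close>, which is \<open>1\<close> only for the trivial weight as \<open>v > 1\<close>; otherwise
  genericity applies.\<close>

lemma val_neq_1:
  assumes "generic v r t" "v > 1" "texp w \<in> small_exps r" "w \<noteq> 0"
  shows "val v r t w \<noteq> 1"
proof (cases "texp w = 0")
  case True
  then have "fst w \<noteq> 0 \<or> vexp w \<noteq> 0" using assms(4) by (auto simp: wt_eq_iff)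
  moreover have "v powi vexp w > 0" using assms(2) by simp
  moreover have "- complex_of_real (v powi vexp w) \<noteq> 1"
  proof
    assume h: "- complex_of_real (v powi vexp w) = 1"
    from arg_cong[OF h, of Re] have "- (v powi vexp w) = 1" by (simp del: of_real_power_int)
    with \<open>v powi vexp w > 0\<close> show False by linarith
  qed
  ultimately show ?thesis
    using True assms(2) powi_eq_1_iff[OF assms(2), of "vexp w"]
    by (auto simp: val_def simp flip: of_real_power_int)
next
  case False
  show ?thesis
  proof
    assume v1: "val v r t w = 1"
    have "chr r (texp w) t = inverse ((if fst w = 0 then 1 else -1) * of_real (v powi vexp w))"
      using v1 unfolding val_def by (metis inverse_unique)
    then have "chr r (texp w) t = of_real (v powi (- vexp w))
        \<or> chr r (texp w) t = - of_real (v powi (- vexp w))"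
      by (auto simp: power_int_minus)
    with assms(1,3) False show False unfolding generic_def by blast
  qed
qed

text \<open>The factor \<open>1 - w\<close> is scaled so that opposite weights give symmetric values: for a constant
  \<open>w = v\<^bsup>2n\<^esup>\<close> it is \<open>v\<^bsup>-n\<^esup> - v\<^sup>n\<close>. The trivial weight gets the parameter \<open>u\<close>, which keeps track of the
  factors omitted in the regularisation.\<close>

definition sym_factor :: "real \<Rightarrow> nat \<Rightarrow> complex list \<Rightarrow> complex \<Rightarrow> wt \<Rightarrow> complex" where
  "sym_factor v r t u w = (if w = 0 then u
     else (1 - val v r t w) * of_real (v powr (- real_of_int (vexp w) / 2)))"

locale generic_point =
  fixes v :: real and r :: nat and t :: "complex list" and u :: complex
  assumes v1: "v > 1" and gen: "generic v r t" and u: "u \<noteq> 0"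
begin

abbreviation "V \<equiv> val v r t"
abbreviation "E \<equiv> sym_factor v r t u"

definition K :: "wt \<Rightarrow> complex" where "K w = E w / E (w - vw 2)"

lemma tor: "t \<in> torus r" using gen by (simp add: generic_def)
lemma v0: "v > 0" using v1 by simp

lemma E_nz: "texp w \<in> small_exps r \<Longrightarrow> E w \<noteq> 0"
  using val_neq_1[OF gen v1, of w] u v1 by (auto simp: sym_factor_def)

lemma zero_small_exps: "0 \<in> small_exps r" by (simp add: small_exps_def lattice_of_rank_def)

lemma E_0 [simp]: "E 0 = u" by (simp add: sym_factor_def)

text \<open>The scaling is by real powers because \<open>k\<close> may be odd.\<close>

lemma powr_half: "v powr (- real_of_int (a + b) / 2) =
    v powr (- real_of_int a / 2) * v powr (- real_of_int b / 2)"
  by (simp add: powr_add[symmetric] diff_divide_distrib)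

text \<open>The contribution of a pair of opposite short roots.\<close>

definition Theta :: "wt \<Rightarrow> int \<Rightarrow> complex" where
  "Theta x c = E (x - vw c) * E (- x - vw c)"

abbreviation "short_ratio x a b \<equiv> Theta (sg + x) 0 * Theta x 0 / (Theta (sg + x) a * Theta x b)"

text \<open>The form \<open>v\<^sup>c + v\<^bsup>-c\<^esup> - x - x\<^bsup>-1\<^esup>\<close> is visibly even in \<open>c\<close>. This symmetry replaces all bookkeeping
  of signs and powers of \<open>v\<close> for nonconstant weights.\<close>

lemma Theta_eq:
  assumes "texp x \<noteq> 0"
  shows "Theta x c = of_real (v powi c + v powi (- c)) - V x - inverse (V x)"
proof -
  have nz: "x - vw c \<noteq> 0" "- x - vw c \<noteq> 0" using assms by (auto simp: wt_eq_iff)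
  have p: "v powr (- real_of_int (- vexp x - c) / 2) * v powr (- real_of_int (vexp x - c) / 2) = v powi c"
    using v1 by (simp add: powr_add[symmetric] powr_real_of_int' field_simps)
  define a where "a = complex_of_real (v powi c)"
  have a: "a \<noteq> 0" "V x \<noteq> 0" using v1 val_nz[OF tor v0] by (auto simp: a_def)
  have "Theta x c = (1 - V x / a) * (1 - inverse (V x) / a) *
      of_real (v powr (- real_of_int (- vexp x - c) / 2) * v powr (- real_of_int (vexp x - c) / 2))"
    using nz by (simp add: Theta_def sym_factor_def val_diff[OF tor v0] val_minus val_vw a_def)
  also have "\<dots> = (1 - V x / a) * (1 - inverse (V x) / a) * a"
    by (simp only: p a_def)
  also have "\<dots> = a + inverse a - V x - inverse (V x)"
    using a by (simp add: field_simps)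
  finally show ?thesis by (simp add: a_def power_int_minus)
qed

lemma Theta_even: "texp x \<noteq> 0 \<Longrightarrow> Theta x (- c) = Theta x c"
  by (simp add: Theta_eq add.commute)

lemma Theta_nz: "texp x \<in> small_exps r \<Longrightarrow> Theta x c \<noteq> 0"
  by (auto simp: Theta_def intro!: E_nz) (auto simp: small_exps_def lattice_of_rank_def)

text \<open>The factorisation \<open>1 - w\<^sup>2 = (1 - w)(1 + w)\<close>, with the scaling distributed evenly.\<close>

lemma E_double:
  assumes "texp x \<noteq> 0"
  shows "E (x + x) = E x * E (sg + x)"
proof -
  have nz: "x + x \<noteq> 0" "x \<noteq> 0" "sg + x \<noteq> 0" 
    using assms by (auto simp: wt_eq_iff fun_eq_iff)
  define h where "h = complex_of_real (v powr (- real_of_int (vexp x) / 2))"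
  have h: "complex_of_real (v powr (- real_of_int (vexp x + vexp x) / 2)) = h * h"
    by (simp only: powr_half of_real_mult h_def)
  have "E (x + x) = (1 - V x * V x) * (h * h)"
    using nz by (simp only: sym_factor_def exp_simps h if_False val_add[OF tor v0])
  also have "\<dots> = ((1 - V x) * h) * ((1 - (- 1) * V x) * h)"
    by (simp add: algebra_simps)
  also have "\<dots> = E x * E (sg + x)"
    using nz by (simp add: sym_factor_def val_add[OF tor v0] val_sg h_def)
  finally show ?thesis .
qed

lemma E_const:
  "n \<noteq> 0 \<Longrightarrow> E (vw (2 * n)) = of_real (v powi (- n) - v powi n)"
  "E (sg + vw (2 * n)) = of_real (v powi (- n) + v powi n)"
proof -
  define a where "a = v powi n"
  have a1: "a \<noteq> 0" "v powi (- n) = inverse a" using v1 by (simp_all add: a_def power_int_minus)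
  have a2: "v powi (2 * n) = a * a" using v1 unfolding a_def mult_2 by (intro power_int_add) auto
  have "v powr (- real_of_int (2 * n) / 2) = v powr (real_of_int (- n))" by simp
  also have "\<dots> = v powi (- n)" using v1 by (subst powr_real_of_int') auto
  finally have a3: "v powr (- real_of_int (2 * n) / 2) = inverse a" by (simp only: a1)
  note a = a1 a2 a3
  have "E (sg + vw (2 * n)) = of_real ((1 + a * a) * inverse a)"
    by (simp only: sym_factor_def sg_neq if_False exp_simps add_0 a val_add[OF tor v0] val_sg val_vw
        of_real_mult of_real_add of_real_1) simp
  also have "(1 + a * a) * inverse a = inverse a + a" using a(1) by (simp add: field_simps)
  finally show "E (sg + vw (2 * n)) = of_real (v powi (- n) + v powi n)"
    by (simp only: a a_def[symmetric])
  assume "n \<noteq> 0"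
  then have "vw (2 * n) \<noteq> 0" by simp
  then have "E (vw (2 * n)) = of_real ((1 - a * a) * inverse a)"
    by (simp only: sym_factor_def if_False exp_simps a val_vw of_real_mult of_real_diff of_real_1)
  also have "(1 - a * a) * inverse a = inverse a - a" using a(1) by (simp add: field_simps)
  finally show "E (vw (2 * n)) = of_real (v powi (- n) - v powi n)"
    by (simp only: a a_def[symmetric])
qed

end

section \<open>Strings, blocks and their telescoping products\<close>

text \<open>For \<open>\<kappa> = k\<close> and \<open>\<epsilon> = e\<close> these strings make up the entries of \<open>r\<^sub>e(m)\<close> and their inverses, as
  \<open>mset_segs\<close> shows. Their lengths \<open>2a + 1\<close> are the Jordan blocks of the corresponding unipotent class
  of an orthogonal group.\<close>

primrec segments :: "nat \<Rightarrow> nat \<Rightarrow> int list" where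
  "segments e 0 = []"
| "segments e (Suc k) = [- int (2 * k + e)..int (2 * k + e)] @ segments e k"

text \<open>The exponents of \<open>q\<close> in \<open>r\<^sub>e(m)\<close> for \<open>m = k + (2e - 1)/4\<close>. The clause for \<open>Suc k\<close> is also right for
  \<open>m = 3/4\<close>, where the recursion for \<open>r\<^sub>e\<close> stops: the interval is then empty.\<close>

primrec r_exponents :: "nat \<Rightarrow> nat \<Rightarrow> nat list" where
  "r_exponents e 0 = []"
| "r_exponents e (Suc k) = [Suc k mod 2..<Suc (2 * k + e)] @ r_exponents e k"

lemma upto_sym_Suc: "[- (int a + 1)..int a + 1] = (- int a - 1) # [- int a..int a] @ [int a + 1]"
proof -
  have "[- (int a + 1)..int a + 1] = (- int a - 1) # [- int a..int a + 1]"
    by (subst upto_rec1) auto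
  also have "[- int a..int a + 1] = [- int a..int a] @ [int a + 1]"
    by (subst upto_rec2) auto
  finally show ?thesis .
qed

lemma mset_sym_segment:
  "mset (concat (map (\<lambda>n. [int n, - int n]) [1..<Suc a])) + {#0#} = mset [- int a..int a]"
proof (induction a)
  case (Suc a)
  have "[- int (Suc a)..int (Suc a)] = (- int a - 1) # [- int a..int a] @ [int a + 1]"
    using upto_sym_Suc[of a] by (simp add: add.commute)
  then show ?case using Suc by (simp add: add.commute)
qed simp

text \<open>Passing from \<open>k\<close> to \<open>k + 1\<close> adds the exponents from \<open>\<delta>\<close> to \<open>a\<close> with both signs, and \<open>\<delta>\<close>
  changes parity. If \<open>\<delta>\<close> becomes \<open>1\<close>, the added zero completes the new string; if it becomes \<open>0\<close>,
  the exponent \<open>0\<close> is added twice, once for the new string and once in place of the zero that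
  completed the previous list.\<close>

lemma mset_segs:
  "mset (concat (map (\<lambda>n. [int n, - int n]) (r_exponents e k)) @ replicate (k mod 2) 0) = mset (segments e k)"
proof (induction k)
  case (Suc k)
  let ?d = "\<lambda>ns. concat (map (\<lambda>n. [int n, - int n]) ns)"
  note seg = mset_sym_segment[of "2 * k + e", symmetric]
  show ?case
  proof (cases "even k")
    case True
    then have m: "Suc k mod 2 = 1" "k mod 2 = 0" by presburger+
    show ?thesis using Suc
      by (simp only: segments.simps r_exponents.simps mset_append seg m map_append concat_append) simp
  next
    case False
    then have m: "Suc k mod 2 = 0" "k mod 2 = 1" by presburger+
    have u: "[0..<Suc (2 * k + e)] = 0 # [1..<Suc (2 * k + e)]"
      by (subst upt_conv_Cons) (simp_all del: upt_Suc)
    show ?thesis using Suc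
      by (simp only: segments.simps r_exponents.simps mset_append seg m map_append concat_append u
          list.map concat.simps) (simp del: upt_Suc)
  qed
qed simp

lemma prod_list_reflect:
  "(\<Prod>k\<leftarrow>[- int b..int b]. F (- k)) = (\<Prod>k\<leftarrow>[- int b..int b]. F k :: 'b::comm_monoid_mult)"
proof -
  have "image_mset uminus (mset [- int b..int b]) = mset [- int b..int b]"
  proof (induction b)
    case (Suc b)
    have "[- int (Suc b)..int (Suc b)] = (- int b - 1) # [- int b..int b] @ [int b + 1]"
      using upto_sym_Suc[of b] by (simp add: add.commute)
    then show ?case using Suc by simp
  qed simp
  then have "image_mset (\<lambda>k. F (- k)) (mset [- int b..int b]) = image_mset F (mset [- int b..int b])"
    using multiset.map_comp[of F uminus "mset [- int b..int b]"] by (simp add: o_def)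
  then show ?thesis by (simp only: mset_map[symmetric] prod_mset_prod_list[symmetric])
qed

context generic_point
begin

abbreviation "pairK \<equiv> pairprod (\<lambda>x y. K (x + y))"
abbreviation "crossK \<equiv> crossprod (\<lambda>x y. K (x + y))"

text \<open>If \<open>x\<close> is the weight of \<open>t\<^sub>i\<close>, these are the two coordinates of \<open>\<xi>(t)\<close> that involve \<open>t\<^sub>i\<close>, and their
  inverses.\<close>

definition block :: "wt \<Rightarrow> wt list" where
  "block x = [x - vw 1, x + vw 1, - (x - vw 1), - (x + vw 1)]"

definition seg_weights :: "int list \<Rightarrow> wt list" where "seg_weights ks = map (\<lambda>k. vw (2 * k)) ks"
definition neg_seg_weights :: "int list \<Rightarrow> wt list" where "neg_seg_weights ks = map (\<lambda>k. sg + vw (2 * k)) ks"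

text \<open>The product telescopes since \<open>K\<close> is the quotient of two consecutive values of \<open>E\<close> along the string.\<close>

lemma seg_prod:
  assumes "texp x \<in> small_exps r"
  shows "(\<Prod>k\<leftarrow>[- int a..int a]. K (x + vw (2 * k))) =
           E (x + vw (2 * int a)) / E (x + vw (- 2 * int a - 2))"
proof -
  have *: "K (x + vw (2 * k)) = E (x + vw (2 * k)) / E (x + vw (2 * (k - 1)))" for k
    by (simp add: K_def vw_add right_diff_distrib flip: add_diff_eq)
  have "(\<Prod>k\<leftarrow>[- int a..int a]. E (x + vw (2 * k)) / E (x + vw (2 * (k - 1)))) =
     E (x + vw (2 * int a)) / E (x + vw (2 * (- int a - 1)))"
    using assms by (intro prod_list_telescope E_nz) auto
  then show ?thesis by (simp add: * right_diff_distrib)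
qed

lemma crossK_seg_weights: "crossK (seg_weights ks) ys = (\<Prod>y\<leftarrow>ys. \<Prod>k\<leftarrow>ks. K (y + vw (2 * k)))"
  by (subst crossprod_commute) (simp add: crossprod_def seg_weights_def o_def add.commute)

lemma small_exps_uminus: "b \<in> small_exps r \<Longrightarrow> - b \<in> small_exps r"
  by (simp add: small_exps_def lattice_of_rank_def)

text \<open>After telescoping along the string, the four weights of the block give two values of \<open>Theta\<close> over two
  others, one of which cancels by evenness.\<close>

lemma cross_seg_block:
  assumes "texp x \<in> small_exps r" "texp x \<noteq> 0"
  shows "crossK (seg_weights [- int a..int a]) (block x) = Theta x (2 * int a - 1) / Theta x (2 * int a + 3)"
proof -
  have b: "texp x \<in> small_exps r" "- texp x \<in> small_exps r" using assms small_exps_uminus by auto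
  have s: "(\<Prod>k\<leftarrow>[- int a..int a]. K (y + vw (2 * k))) = E z / E z'"
    if "texp y \<in> small_exps r" "y + vw (2 * int a) = z" "y + vw (- 2 * int a - 2) = z'" for y z z'
    using seg_prod[of y a] that by simp
  have s1: "(\<Prod>k\<leftarrow>[- int a..int a]. K (x - vw 1 + vw (2 * k))) =
      E (x - vw (1 - 2 * int a)) / E (x - vw (2 * int a + 3))"
    using b by (intro s) (simp_all add: wt_eq_iff)
  have s2: "(\<Prod>k\<leftarrow>[- int a..int a]. K (x + vw 1 + vw (2 * k))) =
      E (x - vw (- 1 - 2 * int a)) / E (x - vw (2 * int a + 1))"
    using b by (intro s) (simp_all add: wt_eq_iff)
  have s3: "(\<Prod>k\<leftarrow>[- int a..int a]. K (- (x - vw 1) + vw (2 * k))) =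
      E (- x - vw (- 1 - 2 * int a)) / E (- x - vw (2 * int a + 1))"
    using b by (intro s) (simp_all add: wt_eq_iff)
  have s4: "(\<Prod>k\<leftarrow>[- int a..int a]. K (- (x + vw 1) + vw (2 * k))) =
      E (- x - vw (1 - 2 * int a)) / E (- x - vw (2 * int a + 3))"
    using b by (intro s) (simp_all add: wt_eq_iff)
  have "crossK (seg_weights [- int a..int a]) (block x) =
     (E (x - vw (1 - 2 * int a)) * E (x - vw (- 1 - 2 * int a)) *
      E (- x - vw (- 1 - 2 * int a)) * E (- x - vw (1 - 2 * int a))) /
     (E (x - vw (2 * int a + 3)) * E (x - vw (2 * int a + 1)) *
      E (- x - vw (2 * int a + 1)) * E (- x - vw (2 * int a + 3)))"
    unfolding crossK_seg_weights block_def by (simp only: list.map prod_list.Cons prod_list.Nil s1 s2 s3 s4) (simp add: mult.assoc)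
  also have "\<dots> = (Theta x (- (2 * int a - 1)) * Theta x (- (2 * int a + 1))) /
     (Theta x (2 * int a + 3) * Theta x (2 * int a + 1))"
  proof -
    have "- (2 * int a - 1) = 1 - 2 * int a" "- (2 * int a + 1) = - 1 - 2 * int a" by simp_all
    then show ?thesis by (simp only: Theta_def mult.assoc mult.commute mult.left_commute)
  qed
  also have "\<dots> = Theta x (2 * int a - 1) / Theta x (2 * int a + 3)"
    using Theta_nz[OF b(1), of "2 * int a + 1"]
    by (simp only: Theta_even[OF assms(2)]) simp
  finally show ?thesis .
qed

text \<open>The values \<open>Theta x (2a - 1) / Theta x (2a + 3)\<close> for \<open>a = e + 2j\<close> telescope, because
  \<open>2(a + 2) - 1 = 2a + 3\<close>. The final argument is \<open>4m\<close>.\<close>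

lemma cross_segs_block:
  assumes "texp x \<in> small_exps r" "texp x \<noteq> 0"
  shows "crossK (seg_weights (segments e k)) (block x) =
           Theta x (2 * int e - 1) / Theta x (4 * int k + 2 * int e - 1)"
proof (induction k)
  case 0
  show ?case using Theta_nz[OF assms(1)] by (simp add: seg_weights_def)
next
  case (Suc k)
  have "crossK (seg_weights (segments e (Suc k))) (block x) =
      crossK (seg_weights [- int (2 * k + e)..int (2 * k + e)]) (block x) * crossK (seg_weights (segments e k)) (block x)"
    by (simp add: seg_weights_def crossprod_append_left)
  also have "\<dots> = Theta x (2 * int e - 1) / Theta x (2 * int (2 * k + e) + 3)"
    unfolding cross_seg_block[OF assms] Suc
    using Theta_nz[OF assms(1), of "2 * int (2 * k + e) - 1"] by (simp add: algebra_simps)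
  finally show ?case by (simp add: algebra_simps)
qed

text \<open>For \<open>e = 0\<close> the initial argument is \<open>-1\<close>, for \<open>e = 1\<close> it is \<open>1\<close>.\<close>

lemma cross_segs_block_one:
  assumes "texp x \<in> small_exps r" "texp x \<noteq> 0" "e \<in> {0, 1}"
  shows "crossK (seg_weights (segments e k)) (block x) = Theta x 1 / Theta x (4 * int k + 2 * int e - 1)"
  using assms(3) Theta_even[OF assms(2), of 1] by (auto simp: cross_segs_block[OF assms(1,2)])

lemma cross_neg_segs_block_one:
  assumes "texp x \<in> small_exps r" "texp x \<noteq> 0" "e \<in> {0, 1}"
  shows "crossK (neg_seg_weights (segments e k)) (block x) =
           Theta (sg + x) 1 / Theta (sg + x) (4 * int k + 2 * int e - 1)"
proof -
  have "crossK (neg_seg_weights (segments e k)) (block x) = crossK (seg_weights (segments e k)) (block (sg + x))"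
  proof -
    have "block (sg + x) = map ((+) sg) (block x)"
      by (simp add: block_def wt_eq_iff)
    moreover have "sg + vw k + y = vw k + (sg + y)" for k y by (simp add: ac_simps)
    ultimately show ?thesis by (simp only: crossprod_def neg_seg_weights_def seg_weights_def map_map o_def)
  qed
  then show ?thesis using cross_segs_block_one[of "sg + x" e k] assms by simp
qed

text \<open>The six pairs of the block have products \<open>x\<^sup>2\<close>, \<open>x\<^bsup>-2\<^esup>\<close>, \<open>q\<close>, \<open>q\<^bsup>-1\<^esup>\<close> and twice \<open>1\<close>. The last four give one
  factor \<open>u\<close> and the number \<open>v\<^sup>2 - v\<^bsup>-2\<^esup>\<close> of the source normalisation; the first two split by
  \<open>E_double\<close> into short root factors for both signs.\<close>

lemma pairK_block:
  assumes "texp x \<noteq> 0"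
  shows "pairK (block x) = - u / of_real (v powi 2 - v powi (- 2)) *
     (Theta x 0 * Theta (sg + x) 0 / (Theta x 1 * Theta (sg + x) 1))"
proof -
  have e: "x - vw 1 + (x + vw 1) = x + x" "x - vw 1 + - (x - vw 1) = 0"
    "x - vw 1 + - (x + vw 1) = vw (- 2)" "x + vw 1 + - (x - vw 1) = vw 2"
    "x + vw 1 + - (x + vw 1) = 0" "- (x - vw 1) + - (x + vw 1) = - x + - x"
    by (simp_all add: wt_eq_iff)
  have K: "K (y + y) = E y * E (sg + y) / (E (y - vw 1) * E (sg + (y - vw 1)))"
    if "texp y \<noteq> 0" for y
  proof -
    have "y + y - vw 2 = (y - vw 1) + (y - vw 1)" by (simp add: wt_eq_iff)
    moreover have "E ((y - vw 1) + (y - vw 1)) = E (y - vw 1) * E (sg + (y - vw 1))"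
      using that by (intro E_double) simp
    ultimately show ?thesis unfolding K_def by (simp only: E_double[OF that])
  qed
  have K0: "K 0 * K 0 * K (vw 2) * K (vw (- 2)) = - u / of_real (v powi 2 - v powi (- 2))"
  proof -
    have n: "E (vw (2 * (- 1))) \<noteq> 0" "E (vw (2 * (- 2))) \<noteq> 0" by (auto intro!: E_nz zero_small_exps simp del: mult_minus_right)
    have "E (vw (2 * 1)) = - E (vw (2 * (- 1)))" by (subst (1 2) E_const) auto
    moreover have "E (vw (2 * (- 2))) = of_real (v powi 2 - v powi (- 2))" by (subst E_const) auto
    ultimately show ?thesis using n u v1 by (simp add: K_def vw_add vw_0 divide_simps)
  qed
  have "pairK (block x) = (K 0 * K 0 * K (vw 2) * K (vw (- 2))) * (K (x + x) * K (- x + - x))"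
    by (simp add: block_def e del: minus_diff_eq minus_add_distrib add_uminus_conv_diff)
  also have "K (x + x) * K (- x + - x) =
      Theta x 0 * Theta (sg + x) 0 / (Theta x 1 * Theta (sg + x) 1)"
  proof -
    have m: "sg + (x - vw 1) = sg + x - vw 1" "sg + - x = - (sg + x)"
      "sg + (- x - vw 1) = - (sg + x) - vw 1" by (simp_all add: wt_eq_iff)
    have mx: "texp (- x) \<noteq> 0" using assms(1) by simp
    then show ?thesis
      by (simp only: K[OF assms] K[OF mx] m Theta_def vw_0 diff_0_right times_divide_times_eq
          mult.assoc mult.commute mult.left_commute)
  qed
  finally show ?thesis unfolding K0 .
qed

text \<open>For each \<open>g = \<plusminus> x \<plusminus> y\<close> the sixteen pairs contain \<open>g q\<close>, \<open>g\<close> twice and \<open>g q\<^bsup>-1\<^esup>\<close>. Their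
  \<open>K\<close>-product reduces to \<open>E(gq) E(g) / (E(gq\<^bsup>-1\<^esup>) E(gq\<^bsup>-2\<^esup>))\<close>, and \<open>E(gq)\<close> and \<open>E(gq\<^bsup>-1\<^esup>)\<close> cancel
  against those of \<open>-g\<close>. What is left has \<open>q\<^sup>2\<close> in place of \<open>q\<close>: the base doubles.\<close>

lemma crossK_block_block:
  assumes "texp (x + y) \<noteq> 0" "texp (x - y) \<noteq> 0" "texp (x + y) \<in> small_exps r" "texp (x - y) \<in> small_exps r"
  shows "crossK (block x) (block y) =
    (Theta (x + y) 0 / Theta (x + y) 4) * (Theta (x - y) 0 / Theta (x - y) 4)"
proof -
  have *: "K (g - vw 2) * K g * K g * K (g + vw 2) * (K (- g - vw 2) * K (- g) * K (- g) * K (- g + vw 2))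
      = Theta g 0 / Theta g 4" if g: "texp g \<noteq> 0" "texp g \<in> small_exps r" for g
  proof -
    have n: "- texp g \<in> small_exps r" using g small_exps_uminus by auto
    have e: "y - vw 2 - vw 2 = y - vw 4" "y + vw 2 - vw 2 = y" for y by (simp_all add: wt_eq_iff)
    have "K (g - vw 2) * K g * K g * K (g + vw 2) * (K (- g - vw 2) * K (- g) * K (- g) * K (- g + vw 2))
      = (E g * E (- g) * (E (g + vw 2) * E (- g + vw 2))) /
        (E (g - vw 4) * E (- g - vw 4) * (E (g - vw 2) * E (- g - vw 2)))"
      unfolding K_def e using g n by (simp add: E_nz divide_simps)
    also have "\<dots> = Theta g 0 * Theta g (- 2) / (Theta g 4 * Theta g 2)"
      by (simp add: Theta_def vw_0 vw_add(3)[symmetric])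
    also have "\<dots> = Theta g 0 / Theta g 4"
      using Theta_nz[OF g(2), of 2] by (simp only: Theta_even[OF g(1)]) simp
    finally show ?thesis .
  qed
  have h: "vw 2 = vw 1 + vw 1" by (simp add: vw_add)
  have e: "x - vw 1 + (y - vw 1) = (x + y) - vw 2" "x - vw 1 + (y + vw 1) = x + y"
    "x - vw 1 + - (y - vw 1) = x - y" "x - vw 1 + - (y + vw 1) = (x - y) - vw 2"
    "x + vw 1 + (y - vw 1) = (x + y)" "x + vw 1 + (y + vw 1) = x + y + vw 2"
    "x + vw 1 + - (y - vw 1) = x - y + vw 2" "x + vw 1 + - (y + vw 1) = (x - y)"
    "- (x - vw 1) + (y - vw 1) = - (x - y)" "- (x - vw 1) + (y + vw 1) = - (x - y) + vw 2"
    "- (x - vw 1) + - (y - vw 1) = - (x + y) + vw 2" "- (x - vw 1) + - (y + vw 1) = - (x + y)"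
    "- (x + vw 1) + (y - vw 1) = - (x - y) - vw 2" "- (x + vw 1) + (y + vw 1) = - (x - y)"
    "- (x + vw 1) + - (y - vw 1) = - (x + y)" "- (x + vw 1) + - (y + vw 1) = - (x + y) - vw 2"
    by (simp_all add: h algebra_simps)
  have "crossK (block x) (block y) = 
    (Theta (x + y) 0 / Theta (x + y) 4) * (Theta (x - y) 0 / Theta (x - y) 4)"
    unfolding *[OF assms(1,3), symmetric] *[OF assms(2,4), symmetric]
    by (simp only: block_def crossprod_def list.map prod_list.Cons prod_list.Nil mult_1_right e)
       (simp only: mult.assoc mult.commute mult.left_commute)
  then show ?thesis .
qed

end

section \<open>The constant attached to pairs of strings\<close>

definition qsum :: "real \<Rightarrow> int \<Rightarrow> real" where "qsum v n = v powi n + v powi (- n)"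
definition qdiff :: "real \<Rightarrow> int \<Rightarrow> real" where "qdiff v n = v powi n - v powi (- n)"

lemma qdiff_nz: "v > 1 \<Longrightarrow> n \<noteq> 0 \<Longrightarrow> qdiff v n \<noteq> 0"
  unfolding qdiff_def using power_int_strict_increasing[of "-n" n v]
    power_int_strict_increasing[of n "-n" v] by (cases "n > 0") auto

lemma qsum_pos: "v > 1 \<Longrightarrow> qsum v n > 0"
  unfolding qsum_def by (intro add_pos_pos) auto

lemma qsum_minus: "qsum v (- n) = qsum v n" by (simp add: qsum_def)
lemma qdiff_minus: "qdiff v (- n) = - qdiff v n" by (simp add: qdiff_def)

lemma qdiff_double: "v > 1 \<Longrightarrow> qdiff v (2 * n) = qdiff v n * qsum v n"
proof -
  assume "v > 1"
  then have "v powi (2 * n) = v powi n * v powi n" "v powi (- (2 * n)) = v powi (- n) * v powi (- n)"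
    unfolding mult_2 minus_add_distrib by (intro power_int_add; simp)+
  then show ?thesis by (simp add: qdiff_def qsum_def algebra_simps)
qed

text \<open>The left hand side collects, for a new string of half-length \<open>a = 2k + e\<close>, its pairs with itself and
  with the shorter strings. In the induction step both sides change by the same quotient of four
  numbers \<open>v\<^sup>n - v\<^bsup>-n\<^esup>\<close>; the condition on \<open>e\<close> is needed to match
  \<open>{2k + 2, 2k + 2e + 1}\<close> with \<open>{a + 1, a + 2}\<close>.\<close>

lemma quantum_quotient:
  assumes "v > 1" "e \<in> {0, 1::nat}"
  shows "(\<Prod>i = 1..2 * k + e. qdiff v (2 * int i - 1) / qdiff v (2 * int i)) *
         (\<Prod>j<k. qdiff v (2 * int (k - j)) / qdiff v (2 * int k + 2 * int e + 2 * int j + 1)) =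
         (\<Prod>i = 1..2 * k + e. 1 / qsum v (int i))"
proof (induction k)
  case 0
  show ?case using assms qdiff_double[of v 1] qdiff_nz[of v 1] by auto
next
  case (Suc k)
  define B where "B n = qdiff v (int n)" for n
  have B: "B n \<noteq> 0" if "n > 0" for n using that assms(1) qdiff_nz by (simp add: B_def)
  have pn: "qsum v (int n) = B (2 * n) / B n" if "n > 0" for n
    using qdiff_double[OF assms(1), of "int n"] B[OF that] by (simp add: B_def)
  let ?a = "2 * k + e"
  let ?f = "\<lambda>i. qdiff v (2 * int i - 1) / qdiff v (2 * int i)"
  let ?g = "\<lambda>j. qdiff v (2 * int k + 2 * int e + 2 * int j + 1)"
  have a: "{1..2 * Suc k + e} = insert (?a + 2) (insert (?a + 1) {1..?a})" by auto
  have P: "(\<Prod>i = 1..2 * Suc k + e. F i) = F (?a + 2) * F (?a + 1) * (\<Prod>i = 1..?a. F i)"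
    for F :: "nat \<Rightarrow> real" unfolding a by (simp add: mult.assoc)
  have num: "(\<Prod>j<Suc k. qdiff v (2 * int (Suc k - j))) = B (2 * k + 2) * (\<Prod>j<k. qdiff v (2 * int (k - j)))"
    by (subst prod.lessThan_Suc_shift) (simp add: B_def algebra_simps)
  have "(\<Prod>j<Suc (Suc k). ?g j) = ?g 0 * (\<Prod>j<Suc k. qdiff v (2 * int (Suc k) + 2 * int e + 2 * int j + 1))"
    by (subst prod.lessThan_Suc_shift) (simp add: algebra_simps)
  moreover have "(\<Prod>j<Suc (Suc k). ?g j) = (\<Prod>j<k. ?g j) * ?g k * ?g (k + 1)"
    by simp
  moreover have g: "?g 0 = B (?a + e + 1)" "?g k = B (2 * ?a + 1)" "?g (k + 1) = B (2 * ?a + 3)"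
    by (simp_all add: B_def algebra_simps)
  ultimately have "B (?a + e + 1) * (\<Prod>j<Suc k. qdiff v (2 * int (Suc k) + 2 * int e + 2 * int j + 1)) =
     (\<Prod>j<k. ?g j) * B (2 * ?a + 1) * B (2 * ?a + 3)" by (simp only: g)
  then have den: "(\<Prod>j<Suc k. qdiff v (2 * int (Suc k) + 2 * int e + 2 * int j + 1)) =
     (\<Prod>j<k. ?g j) * B (2 * ?a + 1) * B (2 * ?a + 3) / B (?a + e + 1)"
    using B[of "?a + e + 1"] by (metis add_gr_0 less_one nonzero_mult_div_cancel_left)
  have f: "?f (?a + 2) = B (2 * ?a + 3) / B (2 * (?a + 2))" "?f (?a + 1) = B (2 * ?a + 1) / B (2 * (?a + 1))"
    by (simp_all add: B_def algebra_simps)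
  \<comment> \<open>Here \<open>e\<close> being \<open>0\<close> or \<open>1\<close> decides which factor corresponds to which.\<close>
  have s: "B (2 * k + 2) * B (?a + e + 1) = B (?a + 1) * B (?a + 2)"
    using assms(2) by auto
  have "(\<Prod>i = 1..2 * Suc k + e. ?f i) *
      (\<Prod>j<Suc k. qdiff v (2 * int (Suc k - j)) / qdiff v (2 * int (Suc k) + 2 * int e + 2 * int j + 1)) =
      B (2 * k + 2) * B (?a + e + 1) / (B (2 * (?a + 2)) * B (2 * (?a + 1))) *
      ((\<Prod>i = 1..?a. ?f i) * (\<Prod>j<k. qdiff v (2 * int (k - j)) / ?g j))"
    unfolding P[of ?f] f unfolding prod_dividef num den using B[of "2 * ?a + 1"] B[of "2 * ?a + 3"] B[of "?a + e + 1"]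
    by (simp add: ac_simps)
  also have "\<dots> = B (?a + 1) * B (?a + 2) / (B (2 * (?a + 2)) * B (2 * (?a + 1))) *
      (\<Prod>i = 1..?a. 1 / qsum v (int i))" unfolding s Suc ..
  also have "\<dots> = (\<Prod>i = 1..2 * Suc k + e. 1 / qsum v (int i))"
    unfolding P by (subst (1 2) pn) (simp_all add: ac_simps)
  finally show ?case .
qed

lemma of_real_prod_list: "of_real (\<Prod>x\<leftarrow>xs. f x) = (\<Prod>x\<leftarrow>xs. of_real (f x))"
  by (induction xs) auto

text \<open>Reversing the string turns \<open>l + a\<close> into \<open>a - l\<close>, after which the product telescopes. The sign arises
  because the string has odd length and the numbers are odd in \<open>n\<close>.\<close>

lemma segment_qdiff:
  assumes "v > 1" "b < a"
  shows "(\<Prod>l\<leftarrow>[- int b..int b]. qdiff v (l + int a) / qdiff v (l - int a - 1)) =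
           - (qdiff v (int a - int b) / qdiff v (int a + int b + 1))"
proof -
  let ?L = "[- int b..int b]"
  have "length ?L = Suc (2 * b)" by (simp add: nat_eq_iff)
  then have len: "odd (length ?L)" by simp
  have c: "(\<Prod>l\<leftarrow>ks. c) = c ^ length ks" for ks :: "int list" and c :: real
    by (induction ks) auto
  have "(\<Prod>l\<leftarrow>?L. qdiff v (l + int a)) = (\<Prod>l\<leftarrow>?L. qdiff v (- l + int a))"
    by (rule prod_list_reflect[symmetric])
  also have "\<dots> = (\<Prod>l\<leftarrow>?L. (- 1) * qdiff v (l - int a))"
    using qdiff_minus[of v "_ - int a"] by simp
  also have "\<dots> = - (\<Prod>l\<leftarrow>?L. qdiff v (l - int a))"
    unfolding prod_list_mult_map c using len by (simp del: length_upto)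
  finally have "(\<Prod>l\<leftarrow>?L. qdiff v (l + int a) / qdiff v (l - int a - 1)) =
      - (\<Prod>l\<leftarrow>?L. qdiff v (l - int a) / qdiff v (l - 1 - int a))"
    unfolding prod_list_divide_map by (simp add: algebra_simps)
  also have "(\<Prod>l\<leftarrow>?L. qdiff v (l - int a) / qdiff v (l - 1 - int a)) =
      qdiff v (int b - int a) / qdiff v (- int b - 1 - int a)"
    using assms by (intro prod_list_telescope[of _ _ "\<lambda>l. qdiff v (l - int a)"] qdiff_nz) auto
  also have "\<dots> = qdiff v (int a - int b) / qdiff v (int a + int b + 1)"
  proof -
    have "int b - int a = - (int a - int b)" "- int b - 1 - int a = - (int a + int b + 1)"
      by simp_all
    then show ?thesis by (simp only: qdiff_minus)
  qed
  finally show ?thesis .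
qed

text \<open>The numbers are even in \<open>n\<close> and never vanish, so reversing the string leaves no sign and the product
  telescopes for strings of any two lengths.\<close>

lemma segment_qsum:
  assumes "v > 1"
  shows "(\<Prod>l\<leftarrow>[- int b..int b]. qsum v (l + int a) / qsum v (l - int a - 1)) =
           qsum v (int a - int b) / qsum v (int a + int b + 1)"
proof -
  let ?L = "[- int b..int b]"
  have "(\<Prod>l\<leftarrow>?L. qsum v (l + int a)) = (\<Prod>l\<leftarrow>?L. qsum v (- l + int a))"
    by (rule prod_list_reflect[symmetric])
  also have "\<dots> = (\<Prod>l\<leftarrow>?L. qsum v (l - int a))"
    using qsum_minus[of v "_ - int a"] by simp
  finally have "(\<Prod>l\<leftarrow>?L. qsum v (l + int a) / qsum v (l - int a - 1)) =
      (\<Prod>l\<leftarrow>?L. qsum v (l - int a) / qsum v (l - 1 - int a))"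
    unfolding prod_list_divide_map by (simp add: algebra_simps)
  also have "\<dots> = qsum v (int b - int a) / qsum v (- int b - 1 - int a)"
    using qsum_pos[OF assms] by (intro prod_list_telescope[of _ _ "\<lambda>l. qsum v (l - int a)"]) (auto simp: less_le)
  also have "\<dots> = qsum v (int a - int b) / qsum v (int a + int b + 1)"
  proof -
    have "int b - int a = - (int a - int b)" "- int b - 1 - int a = - (int a + int b + 1)"
      by simp_all
    then show ?thesis by (simp only: qsum_minus)
  qed
  finally show ?thesis .
qed

context generic_point
begin

lemma E_qdiff: "n \<noteq> 0 \<Longrightarrow> E (vw (2 * n)) = - of_real (qdiff v n)"
  by (subst E_const) (simp_all add: qdiff_def)

lemma E_qsum: "E (sg + vw (2 * n)) = of_real (qsum v n)"
  by (subst E_const) (simp_all add: qsum_def add.commute)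

lemma seg_prod_vw:
  "(\<Prod>k\<leftarrow>[- int a..int a]. K (vw (2 * l) + vw (2 * k))) =
     E (vw (2 * (l + int a))) / E (vw (2 * (l - int a - 1)))"
  using seg_prod[of "vw (2 * l)" a] zero_small_exps by (simp add: vw_add algebra_simps)

text \<open>Adding the two ends \<open>\<plusminus>(a + 1)\<close> to a string contributes \<open>K(1)\<close> and two telescoping products, in
  which \<open>u\<close> cancels.\<close>

lemma pairK_seg:
  "pairK (seg_weights [- int a..int a]) =
     of_real ((- 1) ^ a * (\<Prod>i = 1..a. qdiff v (2 * int i - 1) / qdiff v (2 * int i)))"
proof (induction a)
  case 0
  show ?case by (simp add: seg_weights_def)
next
  case (Suc a)
  let ?L = "[- int a..int a]" and ?n = "int a + 1"
  have "mset [- int (Suc a)..int (Suc a)] = mset ([- ?n, ?n] @ ?L)"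
    using upto_sym_Suc[of a] by (simp add: add.commute)
  then have "mset (seg_weights [- int (Suc a)..int (Suc a)]) = mset (seg_weights ([- ?n, ?n] @ ?L))"
    unfolding seg_weights_def mset_map by (rule arg_cong)
  then have "pairK (seg_weights [- int (Suc a)..int (Suc a)]) = pairK (seg_weights ([- ?n, ?n] @ ?L))"
    by (intro pairprod_mset) (simp_all add: add.commute)
  also have "\<dots> = K (vw (2 * - ?n) + vw (2 * ?n)) * pairK (seg_weights ?L) *
      ((\<Prod>k\<leftarrow>?L. K (vw (2 * - ?n) + vw (2 * k))) * (\<Prod>k\<leftarrow>?L. K (vw (2 * ?n) + vw (2 * k))))"
    by (simp add: seg_weights_def pairprod_append crossprod_def o_def)
  also have "K (vw (2 * - ?n) + vw (2 * ?n)) = u / E (vw (2 * (- 1)))"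
    by (simp add: K_def vw_add vw_0)
  also have "\<dots> = u / of_real (qdiff v 1)"
    by (subst E_qdiff) (simp_all add: qdiff_minus)
  also have "(\<Prod>k\<leftarrow>?L. K (vw (2 * - ?n) + vw (2 * k))) =
      E (vw (2 * (- 1))) / E (vw (2 * - (2 * ?n)))"
    unfolding seg_prod_vw by (simp add: algebra_simps)
  also have "\<dots> = of_real (qdiff v 1) / of_real (qdiff v (2 * ?n))"
  proof -
    have nz: "- (2 * ?n) \<noteq> 0" "(- 1 :: int) \<noteq> 0" by simp_all
    show ?thesis unfolding nz[THEN E_qdiff] qdiff_minus by simp
  qed
  also have "(\<Prod>k\<leftarrow>?L. K (vw (2 * ?n) + vw (2 * k))) =
      E (vw (2 * (2 * ?n - 1))) / E (vw 0)"
    unfolding seg_prod_vw by (simp add: algebra_simps)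
  also have "\<dots> = - of_real (qdiff v (2 * ?n - 1)) / u"
  proof -
    have nz: "2 * ?n - 1 \<noteq> 0" by simp
    show ?thesis unfolding nz[THEN E_qdiff] vw_0 by simp
  qed
  also have "u / of_real (qdiff v 1) * pairK (seg_weights ?L) *
      (of_real (qdiff v 1) / of_real (qdiff v (2 * ?n)) * (- of_real (qdiff v (2 * ?n - 1)) / u)) =
      - (pairK (seg_weights ?L) * (of_real (qdiff v (2 * ?n - 1)) / of_real (qdiff v (2 * ?n))))"
    using u qdiff_nz[OF v1, of 1] by simp
  also have "\<dots> = of_real ((- 1) ^ Suc a * (\<Prod>i = 1..Suc a. qdiff v (2 * int i - 1) / qdiff v (2 * int i)))"
    unfolding Suc by (simp add: algebra_simps)
  finally show ?case .
qed

lemma crossK_seg_seg: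
  assumes "b < a"
  shows "crossK (seg_weights [- int a..int a]) (seg_weights [- int b..int b]) =
           of_real (- (qdiff v (int a - int b) / qdiff v (int a + int b + 1)))"
proof -
  have "crossK (seg_weights [- int a..int a]) (seg_weights [- int b..int b]) =
     (\<Prod>l\<leftarrow>[- int b..int b]. E (vw (2 * (l + int a))) / E (vw (2 * (l - int a - 1))))"
    unfolding crossK_seg_weights by (simp only: seg_weights_def map_map o_def seg_prod_vw)
  also have "\<dots> = (\<Prod>l\<leftarrow>[- int b..int b]. of_real (qdiff v (l + int a) / qdiff v (l - int a - 1)))"
  proof (intro arg_cong[where f = prod_list] map_cong refl)
    fix l assume "l \<in> set [- int b..int b]"
    then have nz: "l + int a \<noteq> 0" "l - int a - 1 \<noteq> 0" using assms by auto
    show "E (vw (2 * (l + int a))) / E (vw (2 * (l - int a - 1))) =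
        of_real (qdiff v (l + int a) / qdiff v (l - int a - 1))"
      unfolding nz[THEN E_qdiff] by simp
  qed
  also have "\<dots> = of_real (- (qdiff v (int a - int b) / qdiff v (int a + int b + 1)))"
    by (simp only: of_real_prod_list[symmetric] segment_qdiff[OF v1 assms])
  finally show ?thesis .
qed

lemma crossK_seg_neg_seg:
  "crossK (seg_weights [- int a..int a]) (neg_seg_weights [- int b..int b]) =
     of_real (qsum v (int a - int b) / qsum v (int a + int b + 1))"
proof -
  have *: "(\<Prod>k\<leftarrow>[- int a..int a]. K (sg + vw (2 * l) + vw (2 * k))) =
     of_real (qsum v (l + int a) / qsum v (l - int a - 1))" for l
  proof -
    have "(\<Prod>k\<leftarrow>[- int a..int a]. K (sg + vw (2 * l) + vw (2 * k))) =
      E (sg + vw (2 * l) + vw (2 * int a)) / E (sg + vw (2 * l) + vw (- 2 * int a - 2))"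
      using zero_small_exps by (intro seg_prod) simp
    also have "\<dots> = E (sg + vw (2 * (l + int a))) / E (sg + vw (2 * (l - int a - 1)))"
      by (simp add: add.assoc vw_add algebra_simps)
    finally show ?thesis by (simp only: E_qsum of_real_divide)
  qed
  have "crossK (seg_weights [- int a..int a]) (neg_seg_weights [- int b..int b]) =
     (\<Prod>l\<leftarrow>[- int b..int b]. of_real (qsum v (l + int a) / qsum v (l - int a - 1)))"
    unfolding crossK_seg_weights by (simp only: neg_seg_weights_def map_map o_def *)
  then show ?thesis
    by (simp only: of_real_prod_list[symmetric] segment_qsum[OF v1])
qed

lemma seg_weights_append: "seg_weights (xs @ ys) = seg_weights xs @ seg_weights ys" by (simp add: seg_weights_def)
lemma neg_seg_weights_append: "neg_seg_weights (xs @ ys) = neg_seg_weights xs @ neg_seg_weights ys" by (simp add: neg_seg_weights_def)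

lemma crossK_seg_segs:
  assumes "k' \<le> k"
  shows "crossK (seg_weights [- int (2 * k + e)..int (2 * k + e)]) (seg_weights (segments e k')) =
     of_real ((- 1) ^ k' *
       (\<Prod>j<k'. qdiff v (2 * int (k - j)) / qdiff v (2 * int k + 2 * int e + 2 * int j + 1)))"
  using assms
proof (induction k')
  case 0
  show ?case by (simp add: seg_weights_def)
next
  case (Suc j)
  then have "2 * j + e < 2 * k + e" by simp
  note seg = crossK_seg_seg[OF this]
  have "int (2 * k + e) - int (2 * j + e) = 2 * int (k - j)"
    "int (2 * k + e) + int (2 * j + e) + 1 = 2 * int k + 2 * int e + 2 * int j + 1"
    using Suc by simp_all
  with seg Suc show ?case
    by (simp only: segments.simps seg_weights_append crossprod_append_right) simp
qed

text \<open>Strings are added one at a time; all differences disappear by \<open>quantum_quotient\<close>.\<close>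

lemma pairK_segs:
  assumes "e \<in> {0, 1}"
  shows "pairK (seg_weights (segments e k)) =
     of_real (\<Prod>j<k. (- 1) ^ (j + e) * (\<Prod>i = 1..2 * j + e. 1 / qsum v (int i)))"
proof (induction k)
  case 0
  show ?case by (simp add: seg_weights_def)
next
  case (Suc k)
  have "pairK (seg_weights (segments e (Suc k))) = pairK (seg_weights [- int (2 * k + e)..int (2 * k + e)]) *
     pairK (seg_weights (segments e k)) * crossK (seg_weights [- int (2 * k + e)..int (2 * k + e)]) (seg_weights (segments e k))"
    by (simp only: segments.simps seg_weights_append pairprod_append)
  also have "\<dots> = pairK (seg_weights (segments e k)) * of_real ((- 1) ^ (2 * k + e) * (- 1) ^ k *
     ((\<Prod>i = 1..2 * k + e. qdiff v (2 * int i - 1) / qdiff v (2 * int i)) *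
      (\<Prod>j<k. qdiff v (2 * int (k - j)) / qdiff v (2 * int k + 2 * int e + 2 * int j + 1))))"
    unfolding pairK_seg crossK_seg_segs[OF order.refl] by (simp only: of_real_mult ac_simps)
  also have "\<dots> = of_real (\<Prod>j<Suc k. (- 1) ^ (j + e) * (\<Prod>i = 1..2 * j + e. 1 / qsum v (int i)))"
  proof -
    have sign: "(- 1) ^ (2 * k + e) * (- 1) ^ k = ((- 1) ^ (k + e) :: real)"
      by (simp add: power_add power_mult)
    show ?thesis unfolding quantum_quotient[OF v1 assms] Suc sign
      by (simp only: prod.lessThan_Suc of_real_mult)
  qed
  finally show ?case .
qed

lemma crossK_seg_neg_segs:
  "crossK (seg_weights [- int a..int a]) (neg_seg_weights (segments e k)) =
     of_real (\<Prod>i<k. qsum v (int a - int (2 * i + e)) / qsum v (int a + int (2 * i + e) + 1))"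
proof (induction k)
  case 0
  show ?case by (simp add: neg_seg_weights_def)
next
  case (Suc k)
  then show ?case
    by (simp only: segments.simps neg_seg_weights_append crossprod_append_right crossK_seg_neg_seg prod.lessThan_Suc
        of_real_mult mult.commute)
qed

lemma crossK_segs_neg_segs:
  "crossK (seg_weights (segments e k)) (neg_seg_weights (segments e' k')) =
     of_real (\<Prod>j<k. \<Prod>i<k'. qsum v (int (2 * j + e) - int (2 * i + e')) /
       qsum v (int (2 * j + e) + int (2 * i + e') + 1))"
proof (induction k)
  case 0
  show ?case by (simp add: seg_weights_def)
next
  case (Suc k)
  then show ?case
    by (simp only: segments.simps seg_weights_append crossprod_append_left crossK_seg_neg_segs prod.lessThan_Suc
        of_real_mult mult.commute)
qed

text \<open>The two signs in a product of two negative weights cancel.\<close>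

lemma pairK_neg_seg_weights: "pairK (neg_seg_weights ks) = pairK (seg_weights ks)"
proof -
  have "sg + vw a + (sg + vw b) = vw a + vw b" for a b by (simp add: ac_simps)
  then show ?thesis by (simp only: neg_seg_weights_def seg_weights_def pairprod_map)
qed

end

section \<open>Comparison with the normalisation of the source\<close>

text \<open>The constant of a spectral transfer morphism must not depend on \<open>v\<close>, so proportionality is a relation
  between functions of \<open>v\<close>.\<close>

definition rat_prop :: "(real \<Rightarrow> real) \<Rightarrow> (real \<Rightarrow> real) \<Rightarrow> bool" where
  "rat_prop f g \<longleftrightarrow> (\<exists>c :: rat. c \<noteq> 0 \<and> (\<forall>v>1. f v = of_rat c * g v))"

lemma rat_propI: "c \<noteq> 0 \<Longrightarrow> (\<And>v. v > 1 \<Longrightarrow> f v = of_rat c * g v) \<Longrightarrow> rat_prop f g"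
  unfolding rat_prop_def by blast

lemma rat_prop_eq: "(\<And>v. v > 1 \<Longrightarrow> f v = g v) \<Longrightarrow> rat_prop f g"
  by (rule rat_propI[of 1]) auto

lemma rat_prop_trans [trans]: "rat_prop f g \<Longrightarrow> rat_prop g h \<Longrightarrow> rat_prop f h"
  unfolding rat_prop_def by (metis (no_types, opaque_lifting) mult.assoc mult_eq_0_iff of_rat_mult)

lemma rat_prop_sym: "rat_prop f g \<Longrightarrow> rat_prop g f"
proof -
  assume "rat_prop f g"
  then obtain c :: rat where "c \<noteq> 0" "\<forall>v>1. f v = of_rat c * g v"
    unfolding rat_prop_def by blast
  then show ?thesis by (intro rat_propI[of "1 / c"]) (simp_all add: of_rat_divide)
qed

lemma rat_prop_refl: "rat_prop f f" by (rule rat_prop_eq) simp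

lemma rat_prop_mult: "rat_prop f g \<Longrightarrow> rat_prop f' g' \<Longrightarrow> rat_prop (\<lambda>v. f v * f' v) (\<lambda>v. g v * g' v)"
proof -
  assume "rat_prop f g" "rat_prop f' g'"
  then obtain c c' :: rat where "c \<noteq> 0" "c' \<noteq> 0" "\<forall>v>1. f v = of_rat c * g v" "\<forall>v>1. f' v = of_rat c' * g' v"
    unfolding rat_prop_def by blast
  then show ?thesis by (intro rat_propI[of "c * c'"]) (simp_all add: of_rat_mult)
qed

lemma rat_prop_inverse: "rat_prop f g \<Longrightarrow> rat_prop (\<lambda>v. 1 / f v) (\<lambda>v. 1 / g v)"
proof -
  assume "rat_prop f g"
  then obtain c :: rat where "c \<noteq> 0" "\<forall>v>1. f v = of_rat c * g v"
    unfolding rat_prop_def by blast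
  then show ?thesis by (intro rat_propI[of "1 / c"]) (simp_all add: of_rat_divide)
qed

text \<open>The analogue of the double factorial for the numbers \<open>v\<^sup>i + v\<^bsup>-i\<^esup>\<close>.\<close>

definition chain_nat :: "nat \<Rightarrow> real \<Rightarrow> real" where
  "chain_nat n v = (\<Prod>k\<le>n div 2. qsum v (int n - 2 * int k))"

text \<open>The extension to negative arguments for which \<open>chain (n + 2)\<close> and \<open>(v\<^bsup>n+2\<^esup> + v\<^bsup>-n-2\<^esup>) chain n\<close> remain
  rationally proportional, and for which \<open>norm_int_add2\<close> holds without a case distinction. It deals
  with the absolute value \<open>|m\<^sub>- - m\<^sub>+|\<close> in the source normalisation.\<close>

definition chain :: "int \<Rightarrow> real \<Rightarrow> real" where
  "chain n v = (if n \<ge> 0 then chain_nat (nat n) v else if n = -1 then 1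
     else 1 / chain_nat (nat (- n - 2)) v)"

text \<open>The shape of both products in the source normalisation, for \<open>n = 2 |m\<^sub>- - m\<^sub>+|\<close> and
  \<open>n = 2 (m\<^sub>- + m\<^sub>+)\<close>.\<close>

definition norm_nat :: "nat \<Rightarrow> real \<Rightarrow> real" where
  "norm_nat n v = (\<Prod>i = 1..n div 2. (1 / qsum v (int n - 2 * int i)) ^ i)"

abbreviation norm_int :: "int \<Rightarrow> real \<Rightarrow> real" where
  "norm_int n \<equiv> norm_nat (nat \<bar>n\<bar>)"

abbreviation norm_pair :: "nat \<Rightarrow> nat \<Rightarrow> real \<Rightarrow> real" where
  "norm_pair a b v \<equiv> norm_int (int a - int b) v * norm_int (int a + int b - 1) v"

lemma chain_nat_nz: "v > 1 \<Longrightarrow> chain_nat n v \<noteq> 0"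
  using qsum_pos by (auto simp: chain_nat_def less_le)

lemma chain_nat_add2: "chain_nat (n + 2) v = qsum v (int n + 2) * chain_nat n v"
  unfolding chain_nat_def by (simp add: prod.atMost_Suc_shift add.commute del: prod.atMost_Suc)

text \<open>Raising \<open>n\<close> by \<open>2\<close> raises every exponent by one and adds the factor for \<open>n\<close>.\<close>

lemma norm_nat_add2:
  assumes "v > 1"
  shows "norm_nat (n + 2) v = norm_nat n v / chain_nat n v"
proof -
  let ?f = "\<lambda>i. 1 / qsum v (int n - 2 * int i)"
  have "norm_nat (n + 2) v = (\<Prod>i = 1..Suc (n div 2). (1 / qsum v (int (n + 2) - 2 * int i)) ^ i)"
    by (simp add: norm_nat_def)
  also have "\<dots> = (\<Prod>i\<le>n div 2. ?f i ^ Suc i)"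
    by (simp only: One_nat_def prod.atLeast1_atMost_eq lessThan_Suc_atMost)
       (simp add: algebra_simps)
  also have "\<dots> = (\<Prod>i\<le>n div 2. ?f i) * (\<Prod>i\<le>n div 2. ?f i ^ i)"
    by (simp only: power_Suc prod.distrib)
  also have "(\<Prod>i\<le>n div 2. ?f i ^ i) = norm_nat n v"
    unfolding norm_nat_def atMost_atLeast0
    by (subst prod.atLeast_Suc_atMost) auto
  also have "(\<Prod>i\<le>n div 2. ?f i) = 1 / chain_nat n v"
    by (simp add: chain_nat_def prod_dividef)
  finally show ?thesis by simp
qed

lemma norm_int_add2:
  assumes "v > 1"
  shows "norm_int (n + 2) v = norm_int n v / chain n v"
proof -
  consider "n \<ge> 0" | "n = -1" | "n \<le> -2" by linarith
  then show ?thesis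
  proof cases
    case 1
    then have "nat \<bar>n + 2\<bar> = nat n + 2" "nat \<bar>n\<bar> = nat n" by simp_all
    then show ?thesis using norm_nat_add2[OF assms, of "nat n"] 1 by (simp add: chain_def)
  next
    case 2
    then show ?thesis by (simp add: chain_def)
  next
    case 3
    then have "nat \<bar>n\<bar> = nat (- n - 2) + 2" "nat \<bar>n + 2\<bar> = nat (- n - 2)" by simp_all
    then show ?thesis using norm_nat_add2[OF assms, of "nat (- n - 2)"] 3 chain_nat_nz[OF assms]
      by (simp add: chain_def)
  qed
qed

text \<open>Equality holds except for \<open>n = -2\<close>, where \<open>v\<^sup>0 + v\<^sup>0 = 2\<close> enters twice and the ratio is \<open>2\<close>.\<close>

lemma chain_add2: "rat_prop (chain (n + 2)) (\<lambda>v. qsum v (n + 2) * chain n v)"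
proof -
  consider "n \<ge> 0" | "n = -1" | "n = -2" | "n = -3" | "n \<le> -4" by linarith
  then show ?thesis
  proof cases
    case 1
    then have "nat (n + 2) = nat n + 2" "int (nat n) = n" by simp_all
    then show ?thesis using chain_nat_add2[of "nat n"] 1
      by (intro rat_prop_eq) (simp add: chain_def)
  next
    case 2
    then show ?thesis by (intro rat_prop_eq) (simp add: chain_def chain_nat_def)
  next
    case 3
    then show ?thesis by (intro rat_propI[of 2]) (simp_all add: chain_def chain_nat_def qsum_def)
  next
    case 4
    have "qsum v 1 \<noteq> 0" if "v > 1" for v using qsum_pos[OF that, of 1] by simp
    with 4 show ?thesis
      by (intro rat_prop_eq) (simp add: chain_def chain_nat_def qsum_minus)
  next
    case 5
    have e: "nat (- n - 2) = nat (- n - 4) + 2" "nat (- (n + 2) - 2) = nat (- n - 4)"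
      "int (nat (- n - 4)) + 2 = - (n + 2)" using 5 by simp_all
    have "qsum v (n + 2) \<noteq> 0" if "v > 1" for v using qsum_pos[OF that, of "n + 2"] by simp
    moreover have "chain_nat (nat (- n - 2)) v = qsum v (n + 2) * chain_nat (nat (- n - 4)) v" for v
      unfolding e(1) chain_nat_add2 e(3) qsum_minus ..
    moreover have "chain (n + 2) v = 1 / chain_nat (nat (- n - 4)) v" for v
      using 5 by (simp only: chain_def e(2)) auto
    ultimately show ?thesis
      using 5 by (intro rat_prop_eq) (simp add: chain_def)
  qed
qed

text \<open>The numbers \<open>1, \<dots>, a\<close> split by parity into two chains, with tops \<open>a\<close> and \<open>a - 1\<close>; the
  entry \<open>0\<close> of one of them adds the factor \<open>2\<close>.\<close>

lemma chain_base:
  assumes "e \<in> {0, 1}"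
  shows "rat_prop (\<lambda>v. \<Prod>i = 1..a. qsum v (int i)) (\<lambda>v. chain (int a + int e - 1) v * chain (int a - int e) v)"
proof -
  have "rat_prop (\<lambda>v. \<Prod>i = 1..a. qsum v (int i)) (\<lambda>v. chain (int a - 1) v * chain (int a) v)"
  proof (induction a)
    case 0
    show ?case
      by (rule rat_propI[of "1/2"]) (simp_all add: chain_def chain_nat_def qsum_def of_rat_divide)
  next
    case (Suc a)
    have c: "rat_prop (\<lambda>v. qsum v (int a + 1) * chain (int a - 1) v) (chain (int a + 1))"
      using rat_prop_sym[OF chain_add2[of "int a - 1"]] by (simp add: add.commute)
    have "rat_prop (\<lambda>v. \<Prod>i = 1..Suc a. qsum v (int i))
        (\<lambda>v. (\<Prod>i = 1..a. qsum v (int i)) * qsum v (int a + 1))"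
      by (rule rat_prop_eq) (simp add: add.commute)
    also have "rat_prop \<dots> (\<lambda>v. chain (int a - 1) v * chain (int a) v * qsum v (int a + 1))"
      by (intro rat_prop_mult Suc rat_prop_refl)
    also have "rat_prop \<dots> (\<lambda>v. chain (int a) v * (qsum v (int a + 1) * chain (int a - 1) v))"
      by (rule rat_prop_eq) (simp add: ac_simps)
    also have "rat_prop \<dots> (\<lambda>v. chain (int a) v * chain (int a + 1) v)"
      by (intro rat_prop_mult c rat_prop_refl)
    also have "(\<lambda>v. chain (int a) v * chain (int a + 1) v) =
        (\<lambda>v. chain (int (Suc a) - 1) v * chain (int (Suc a)) v)"
      by (simp add: add.commute)
    finally show ?case .
  qed
  then show ?thesis using assms by (auto simp: mult.commute)
qed

text \<open>The first chain is prolonged upwards and the second one shortened from the top, by two in each step;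
  the second may run into negative arguments.\<close>

lemma chain_step:
  assumes "e \<in> {0, 1}"
  shows "rat_prop (\<lambda>v. (\<Prod>i = 1..a. qsum v (int i)) *
      (\<Prod>i<k. qsum v (int a + int (2 * i + e) + 1) / qsum v (int a - int (2 * i + e))))
    (\<lambda>v. chain (int a + int (2 * k + e) - 1) v * chain (int a - int (2 * k + e)) v)"
proof (induction k)
  case 0
  show ?case using chain_base[OF assms, of a] by simp
next
  case (Suc k)
  let ?b = "int (2 * k + e)"
  have 1: "rat_prop (\<lambda>v. qsum v (int a + ?b + 1) * chain (int a + ?b - 1) v) (chain (int a + ?b + 1))"
    using rat_prop_sym[OF chain_add2[of "int a + ?b - 1"]] by (simp add: add.commute)
  have 2: "rat_prop (\<lambda>v. 1 / qsum v (int a - ?b) * chain (int a - ?b) v) (chain (int a - ?b - 2))"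
  proof -
    have "rat_prop (\<lambda>v. 1 / qsum v (int a - ?b) * chain (int a - ?b) v)
        (\<lambda>v. 1 / qsum v (int a - ?b) * (qsum v (int a - ?b) * chain (int a - ?b - 2) v))"
      using chain_add2[of "int a - ?b - 2"] by (intro rat_prop_mult rat_prop_refl) simp
    also have "rat_prop \<dots> (chain (int a - ?b - 2))"
    proof (rule rat_prop_eq)
      fix v :: real assume "v > 1"
      from qsum_pos[OF this, of "int a - ?b"]
      show "1 / qsum v (int a - ?b) * (qsum v (int a - ?b) * chain (int a - ?b - 2) v) = chain (int a - ?b - 2) v"
        by simp
    qed
    finally show ?thesis .
  qed
  have "rat_prop (\<lambda>v. (\<Prod>i = 1..a. qsum v (int i)) *
      (\<Prod>i<Suc k. qsum v (int a + int (2 * i + e) + 1) / qsum v (int a - int (2 * i + e))))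
     (\<lambda>v. (chain (int a + ?b - 1) v * chain (int a - ?b) v) * (qsum v (int a + ?b + 1) * (1 / qsum v (int a - ?b))))"
    using rat_prop_mult[OF Suc rat_prop_refl[of "\<lambda>v. qsum v (int a + ?b + 1) * (1 / qsum v (int a - ?b))"]]
    by (simp only: prod.lessThan_Suc times_divide_eq_right mult_1_right mult.assoc)
  also have "rat_prop \<dots> (\<lambda>v. (qsum v (int a + ?b + 1) * chain (int a + ?b - 1) v) *
       (1 / qsum v (int a - ?b) * chain (int a - ?b) v))"
    by (rule rat_prop_eq) (simp add: ac_simps)
  also have "rat_prop \<dots> (\<lambda>v. chain (int a + ?b + 1) v * chain (int a - ?b - 2) v)"
    by (rule rat_prop_mult[OF 1 2])
  also have "(\<lambda>v. chain (int a + ?b + 1) v * chain (int a - ?b - 2) v) =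
     (\<lambda>v. chain (int a + int (2 * Suc k + e) - 1) v * chain (int a - int (2 * Suc k + e)) v)"
    by (simp add: algebra_simps)
  finally show ?case .
qed

text \<open>The contribution of all pairs of strings, up to sign: pairs of the same sign in the first two products,
  pairs of opposite sign in the third.\<close>

definition res_const :: "nat \<Rightarrow> nat \<Rightarrow> nat \<Rightarrow> nat \<Rightarrow> real \<Rightarrow> real" where
  "res_const e k e' k' v = (\<Prod>j<k. \<Prod>i = 1..2 * j + e. 1 / qsum v (int i)) *
     (\<Prod>j<k'. \<Prod>i = 1..2 * j + e'. 1 / qsum v (int i)) *
     (\<Prod>j<k. \<Prod>i<k'. qsum v (int (2 * j + e) - int (2 * i + e')) /
       qsum v (int (2 * j + e) + int (2 * i + e') + 1))"

lemma inverse_step: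
  "(\<Prod>i = 1..a. 1 / qsum v (int i)) * (\<Prod>i<k. qsum v (int a - int (2 * i + e)) / qsum v (int a + int (2 * i + e) + 1))
   = 1 / ((\<Prod>i = 1..a. qsum v (int i)) *
      (\<Prod>i<k. qsum v (int a + int (2 * i + e) + 1) / qsum v (int a - int (2 * i + e))))"
  by (simp add: prod_dividef)

lemma norm_chain_step:
  assumes "e' \<in> {0, 1}" "v > 1"
  shows "norm_pair a b v *
      (1 / (chain (int a + int b - 1) v * chain (int a - int b) v)) =
      norm_pair (a + 2) b v"
  using norm_int_add2[OF assms(2), of "int a - int b"] norm_int_add2[OF assms(2), of "int a + int b - 1"]
  by (simp add: algebra_simps)

text \<open>Both sides are changed by the same quotient of chains when a string is added, by \<open>chain_step\<close> on the
  left and \<open>norm_chain_step\<close> on the right. The induction on \<open>k\<close> starts with no string of the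
  first kind, a case that is itself proved by adding strings of the second kind.\<close>

lemma res_const_rat_prop:
  assumes e: "e \<in> {0, 1}" and e': "e' \<in> {0, 1}"
  shows "rat_prop (res_const e k e' k')
    (\<lambda>v. norm_pair (2 * k + e) (2 * k' + e') v)"
proof (induction k)
  case 0
  show ?case
  proof (induction k')
    case 0
    show ?case using assms by (intro rat_prop_eq) (auto simp: res_const_def norm_nat_def)
  next
    case (Suc k')
    let ?a = "2 * k' + e'"
    have "rat_prop (res_const e 0 e' (Suc k')) (\<lambda>v. res_const e 0 e' k' v * (1 / (\<Prod>i = 1..?a. qsum v (int i))))"
      by (rule rat_prop_eq) (simp add: res_const_def prod_dividef)
    also have "rat_prop \<dots> (\<lambda>v. norm_pair (2 * 0 + e) ?a v *
        (1 / (chain (int ?a + int e - 1) v * chain (int ?a - int e) v)))"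
      by (intro rat_prop_mult Suc rat_prop_inverse chain_base e)
    also have "rat_prop \<dots> (\<lambda>v. norm_pair (?a + 2) e v)"
    proof (rule rat_prop_eq, goal_cases)
      case (1 v)
      have "\<bar>int (2 * 0 + e) - int ?a\<bar> = \<bar>int ?a - int e\<bar>" "int (2 * 0 + e) + int ?a - 1 = int ?a + int e - 1" by auto
      then show ?case by (simp only: norm_chain_step[OF e 1])
    qed
    also have "(\<lambda>v. norm_pair (?a + 2) e v) =
      (\<lambda>v. norm_pair (2 * 0 + e) (2 * Suc k' + e') v)"
    proof -
      have "\<bar>int (2 * 0 + e) - int (2 * Suc k' + e')\<bar> = \<bar>int (?a + 2) - int e\<bar>"
        "int (2 * 0 + e) + int (2 * Suc k' + e') - 1 = int (?a + 2) + int e - 1" by auto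
      then show ?thesis by (simp only:)
    qed
    finally show ?case .
  qed
next
  case (Suc k)
  let ?a = "2 * k + e" and ?b = "2 * k' + e'"
  have "rat_prop (res_const e (Suc k) e' k') (\<lambda>v. res_const e k e' k' v *
     (1 / ((\<Prod>i = 1..?a. qsum v (int i)) *
      (\<Prod>i<k'. qsum v (int ?a + int (2 * i + e') + 1) / qsum v (int ?a - int (2 * i + e'))))))"
    by (rule rat_prop_eq, unfold inverse_step[symmetric])
       (simp only: res_const_def prod.lessThan_Suc mult.assoc mult.commute mult.left_commute)
  also have "rat_prop \<dots> (\<lambda>v. norm_pair ?a ?b v *
      (1 / (chain (int ?a + int ?b - 1) v * chain (int ?a - int ?b) v)))"
    by (intro rat_prop_mult Suc rat_prop_inverse chain_step e')
  also have "rat_prop \<dots> (\<lambda>v. norm_pair (?a + 2) ?b v)"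
    by (rule rat_prop_eq) (simp only: norm_chain_step[OF e])
  also have "?a + 2 = 2 * Suc k + e" by simp
  finally show ?case .
qed

text \<open>Each factor is \<open>y / (1 + y\<^sup>2) = 1 / (y + y\<^bsup>-1\<^esup>)\<close> for \<open>y = v\<^bsup>2x-2i\<^esup>\<close>.\<close>

lemma norm_product_eq:
  assumes "v > 1" "2 * x = real n"
  shows "(\<Prod>i = 1..nat \<lfloor>x\<rfloor>. (v powr (2 * x - 2 * real i) / (1 + (v\<^sup>2) powr (2 * x - 2 * real i))) ^ i)
     = norm_nat n v"
proof -
  have x: "x = real n / 2" using assms(2) by simp
  have "nat \<lfloor>x\<rfloor> = n div 2" unfolding x using floor_divide_of_nat_eq[of n 2, where ?'a = real] by simp
  moreover have "v powr (2 * x - 2 * real i) / (1 + (v\<^sup>2) powr (2 * x - 2 * real i)) = 1 / qsum v (int n - 2 * int i)" for i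
  proof -
    have "2 * x - 2 * real i = real_of_int (int n - 2 * int i)" using assms(2) by simp
    then have p: "v powr (2 * x - 2 * real i) = v powi (int n - 2 * int i)"
      using assms(1) by (simp only:) (subst powr_real_of_int', auto)
    have "(v\<^sup>2) powr (2 * x - 2 * real i) = (v powr (2 * x - 2 * real i))\<^sup>2"
      using assms(1) by (simp add: power2_eq_square powr_mult)
    moreover have "y / (1 + y\<^sup>2) = 1 / (y + inverse y)" if "y > 0" for y :: real
    proof -
      have "y + inverse y = (1 + y\<^sup>2) / y" using that by (simp add: field_simps power2_eq_square)
      then show ?thesis by simp
    qed
    moreover have "v powi (int n - 2 * int i) > 0" using assms(1) by simp
    ultimately show ?thesis by (simp only: p qsum_def power_int_minus)
  qed
  ultimately show ?thesis by (simp add: norm_nat_def)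
qed

lemma source_norm_eq:
  assumes "v > 1" "mm = real k' + (2 * real e' - 1) / 4" "mp = real k + (2 * real e - 1) / 4" "mm > 0" "mp > 0"
  shows "source_norm r mm mp v = (v powi 2 - v powi (- 2)) powi (- int r) *
    (norm_pair (2 * k + e) (2 * k' + e') v)"
proof -
  have "2 * (mp - mm) = real_of_int (int (2 * k + e) - int (2 * k' + e'))"
    using assms(2,3) by (simp add: field_simps)
  then have "\<bar>2 * (mp - mm)\<bar> = real (nat \<bar>int (2 * k + e) - int (2 * k' + e')\<bar>)"
    by (simp only: of_int_abs[symmetric])
  then have d: "2 * \<bar>mm - mp\<bar> = real (nat \<bar>int (2 * k + e) - int (2 * k' + e')\<bar>)"
    by (simp only: abs_mult abs_minus_commute[of mm])
  have a: "2 * (mm + mp) = real (nat \<bar>int (2 * k + e) + int (2 * k' + e') - 1\<bar>)"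
  proof -
    define z where "z = int (2 * k + e) + int (2 * k' + e') - 1"
    have z: "2 * (mm + mp) = real_of_int z"
      unfolding z_def using assms(2,3) by (simp add: field_simps)
    have "2 * (mm + mp) > 0" using assms(4,5) by simp
    then have "real_of_int z > 0" by (simp only: z)
    then show ?thesis unfolding z z_def[symmetric] by simp
  qed
  show ?thesis
    unfolding source_norm_def norm_product_eq[OF assms(1) d] norm_product_eq[OF assms(1) a]
    by (simp only: mult.assoc)
qed

section \<open>Signs of roots\<close>

text \<open>The labels distinguish short and long roots, so each case records which of the two sets contains the root.\<close>

lemma roots_cases:
  assumes "\<alpha> \<in> roots N"
  obtains (short) i s where "\<alpha> = sroot i s" "i < N" "s \<in> {1, -1}" "\<alpha> \<in> short_roots N" "\<alpha> \<notin> long_roots N"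
  | (long) i j s s' where "\<alpha> = lroot i j s s'" "i < j" "j < N" "s \<in> {1, -1}" "s' \<in> {1, -1}" "\<alpha> \<in> long_roots N"
proof -
  from assms consider "\<alpha> \<in> short_roots N" | "\<alpha> \<in> long_roots N" by (auto simp: roots_def)
  then show ?thesis
  proof cases
    case 1
    then have "\<alpha> \<notin> long_roots N" using short_long_disjoint by blast
    moreover obtain i s where "\<alpha> = sroot i s" "i < N" "s \<in> {1, -1}"
      using 1 unfolding short_roots_def sroot_def by blast
    ultimately show ?thesis using short 1 by blast
  next
    case 2
    moreover obtain i j s s' where "\<alpha> = lroot i j s s'" "i < j" "j < N" "s \<in> {1, -1}" "s' \<in> {1, -1}"
      using 2 unfolding long_roots_def lroot_def by blast
    ultimately show ?thesis using long by blast
  qed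
qed

lemma root_coeff: "\<alpha> \<in> roots N \<Longrightarrow> \<alpha> i \<in> {-1, 0, 1}"
  by (erule roots_cases) (auto simp: sroot_def lroot_def)

lemma sroot_in: "i < N \<Longrightarrow> s \<in> {1, -1} \<Longrightarrow> sroot i s \<in> short_roots N"
  unfolding short_roots_def sroot_def by blast

lemma lroot_in: "i < j \<Longrightarrow> j < N \<Longrightarrow> s \<in> {1, -1} \<Longrightarrow> s' \<in> {1, -1} \<Longrightarrow> lroot i j s s' \<in> long_roots N"
  unfolding long_roots_def lroot_def by blast

lemma short_not_long: "\<alpha> \<in> short_roots N \<Longrightarrow> \<alpha> \<notin> long_roots N"
  using short_long_disjoint by blast

lemma minus_sroot: "- sroot i s = sroot i (- s)" by (auto simp: sroot_def)
lemma minus_lroot: "- lroot i j s s' = lroot i j (- s) (- s')" by (auto simp: lroot_def)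

lemma minus_long: "\<alpha> \<in> long_roots N \<Longrightarrow> - \<alpha> \<in> long_roots N"
proof -
  assume "\<alpha> \<in> long_roots N"
  then obtain i j s s' where "\<alpha> = lroot i j s s'" "i < j" "j < N" "s \<in> {1, -1}" "s' \<in> {1, -1}"
    unfolding long_roots_def lroot_def by blast
  then show ?thesis by (auto simp: minus_lroot intro!: lroot_in)
qed

lemma minus_short: "\<alpha> \<in> short_roots N \<Longrightarrow> - \<alpha> \<in> short_roots N"
proof -
  assume "\<alpha> \<in> short_roots N"
  then obtain i s where "\<alpha> = sroot i s" "i < N" "s \<in> {1, -1}"
    unfolding short_roots_def sroot_def by blast
  then show ?thesis by (auto simp: minus_sroot intro!: sroot_in)
qed

lemma minus_long_iff: "- \<alpha> \<in> long_roots N \<longleftrightarrow> \<alpha> \<in> long_roots N"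
  using minus_long[of \<alpha> N] minus_long[of "- \<alpha>" N] by auto

lemma minus_roots: "\<alpha> \<in> roots N \<Longrightarrow> - \<alpha> \<in> roots N"
  using minus_long minus_short by (auto simp: roots_def)

lemma pos_sroot: "sroot i s \<in> pos_roots N \<longleftrightarrow> s = 1" if "i < N" "s \<in> {1, -1}"
  using that sroot_in[OF that] by (auto simp: pos_roots_def roots_def) (auto simp: sroot_def split: if_splits)

text \<open>The first nonzero coordinate of a long root sits at the smaller of its two indices.\<close>

lemma pos_lroot:
  assumes "i < j" "j < N" "s \<in> {1, -1}" "s' \<in> {1, -1}"
  shows "lroot i j s s' \<in> pos_roots N \<longleftrightarrow> s = 1"
proof
  assume "lroot i j s s' \<in> pos_roots N"
  then obtain k where k: "lroot i j s s' k > 0" "\<And>k'. k' < k \<Longrightarrow> lroot i j s s' k' = 0"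
    by (auto simp: pos_roots_def)
  have "\<not> i < k" using k(2)[of i] assms by (auto simp: lroot_def)
  then have "k = i" using k(1) assms by (auto simp: lroot_def split: if_splits)
  then show "s = 1" using k(1) assms by (auto simp: lroot_def)
next
  assume "s = 1"
  then have "lroot i j s s' i > 0" "\<forall>k<i. lroot i j s s' k = 0" "i < N" using assms by (auto simp: lroot_def)
  then show "lroot i j s s' \<in> pos_roots N"
    using lroot_in[OF assms] by (auto simp: pos_roots_def roots_def)
qed

lemma pos_or_neg: "\<alpha> \<in> roots N \<Longrightarrow> - \<alpha> \<in> pos_roots N \<longleftrightarrow> \<alpha> \<notin> pos_roots N"
  by (erule roots_cases) (auto simp: minus_sroot minus_lroot pos_sroot pos_lroot)

text \<open>The constant of \<open>\<mu>\<close> sums labels over the positive roots, whereas its product runs over all roots.\<close>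

lemma sum_roots_pos:
  fixes f :: "(nat \<Rightarrow> int) \<Rightarrow> real"
  assumes "\<And>\<alpha>. \<alpha> \<in> roots N \<Longrightarrow> f (- \<alpha>) = f \<alpha>"
  shows "sum f (roots N) = 2 * sum f (pos_roots N)"
proof -
  have sub: "pos_roots N \<subseteq> roots N" by (auto simp: pos_roots_def)
  have "roots N - pos_roots N = uminus ` pos_roots N"
  proof (intro equalityI subsetI)
    fix \<alpha> assume "\<alpha> \<in> roots N - pos_roots N"
    then have "- \<alpha> \<in> pos_roots N" using pos_or_neg by blast
    then show "\<alpha> \<in> uminus ` pos_roots N" by (intro image_eqI[of _ _ "- \<alpha>"]) simp_all
  next
    fix \<alpha> assume "\<alpha> \<in> uminus ` pos_roots N"
    then show "\<alpha> \<in> roots N - pos_roots N" using sub pos_or_neg minus_roots by fastforce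
  qed
  moreover have "sum f (uminus ` pos_roots N) = sum f (pos_roots N)"
    using assms sub by (subst sum.reindex) (auto intro!: sum.cong)
  ultimately show ?thesis
    using sum.subset_diff[OF sub, of f] by simp
qed

section \<open>The mu-function as a product over weights\<close>

text \<open>Coefficients of roots are \<open>-1\<close>, \<open>0\<close> or \<open>1\<close>, and only on these is this the scalar multiple.\<close>

definition smul :: "int \<Rightarrow> wt \<Rightarrow> wt" where
  "smul n w = (if n = 0 then 0 else if n > 0 then w else - w)"

definition root_weight :: "wt list \<Rightarrow> (nat \<Rightarrow> int) \<Rightarrow> wt" where
  "root_weight xs \<alpha> = (\<Sum>i<length xs. smul (\<alpha> i) (xs ! i))"

lemma val_smul: "n \<in> {-1, 0, 1} \<Longrightarrow> val v r t (smul n w) = val v r t w powi n"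
  by (auto simp: smul_def val_minus power_int_minus)

lemma val_sum:
  assumes "t \<in> torus r" "v > 0"
  shows "val v r t (\<Sum>i\<in>A. f i) = (\<Prod>i\<in>A. val v r t (f i))"
  by (induction A rule: infinite_finite_induct) (simp_all add: val_add[OF assms])

lemma chr_map_val:
  assumes "t \<in> torus r" "v > 0" "\<alpha> \<in> roots (length xs)"
  shows "chr (length xs) \<alpha> (map (val v r t) xs) = val v r t (root_weight xs \<alpha>)"
  using root_coeff[OF assms(3)]
  by (simp add: chr_def root_weight_def val_sum[OF assms(1,2)] val_smul)

lemma root_weight_sroot: "i < length xs \<Longrightarrow> root_weight xs (sroot i s) = smul s (xs ! i)"
proof -
  assume i: "i < length xs"
  have "root_weight xs (sroot i s) = (\<Sum>k<length xs. if k = i then smul s (xs ! i) else 0)"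
    unfolding root_weight_def sroot_def by (intro sum.cong) (auto simp: smul_def)
  then show ?thesis using i by simp
qed

lemma root_weight_lroot:
  assumes "i < j" "j < length xs"
  shows "root_weight xs (lroot i j s s') = smul s (xs ! i) + smul s' (xs ! j)"
proof -
  have "root_weight xs (lroot i j s s') =
      (\<Sum>k<length xs. (if k = i then smul s (xs ! i) else 0) + (if k = j then smul s' (xs ! j) else 0))"
    unfolding root_weight_def lroot_def using assms by (intro sum.cong) (auto simp: smul_def)
  then show ?thesis using assms by (simp add: sum.distrib)
qed

lemma prod_list_pairprod_roots:
  fixes F G :: "wt \<Rightarrow> complex"
  shows "(\<Prod>\<alpha>\<in>roots (length xs). if \<alpha> \<in> long_roots (length xs) then G (root_weight xs \<alpha>) else F (root_weight xs \<alpha>)) =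
    (\<Prod>x\<leftarrow>xs. F x * F (- x)) *
    pairprod (\<lambda>x y. G (x + y) * G (x - y) * (G (- x + y) * G (- x - y))) xs"
proof -
  let ?N = "length xs"
  let ?f = "\<lambda>\<alpha>. if \<alpha> \<in> long_roots ?N then G (root_weight xs \<alpha>) else F (root_weight xs \<alpha>)"
  have "prod ?f (short_roots ?N) = (\<Prod>i<?N. F (xs ! i) * F (- (xs ! i)))"
    unfolding prod_short_roots
    using short_not_long[OF sroot_in] by (intro prod.cong) (simp_all add: root_weight_sroot smul_def)
  moreover have "prod ?f (long_roots ?N) = pairprod (\<lambda>x y. G (x + y) * G (x - y) * (G (- x + y) * G (- x - y))) xs"
    unfolding prod_long_roots pairprod_nth
    using lroot_in by (intro prod.cong) (simp_all add: root_weight_lroot smul_def)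
  ultimately show ?thesis unfolding prod_roots prod_list_nth by simp
qed

definition slim :: "nat \<Rightarrow> wt \<Rightarrow> bool" where
  "slim r w \<longleftrightarrow> texp w \<in> lattice_of_rank r \<and> (\<forall>i. \<bar>texp w i\<bar> \<le> 1)"

lemma slim_small_exps:
  assumes "slim r x" "slim r y"
  shows "texp x \<in> small_exps r" "texp (x + y) \<in> small_exps r" "texp (x - y) \<in> small_exps r"
  using assms unfolding slim_def small_exps_def lattice_of_rank_def
  by (auto intro: order_trans[OF abs_triangle_ineq] order_trans[OF abs_triangle_ineq4])
     (smt (verit, best))+

text \<open>The factor without scaling, which is the one occurring in \<open>\<mu>\<close>.\<close>

definition reg_factor :: "real \<Rightarrow> nat \<Rightarrow> complex list \<Rightarrow> complex \<Rightarrow> wt \<Rightarrow> complex" where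
  "reg_factor v r t u w = (if w = 0 then u else 1 - val v r t w)"

context generic_point
begin

abbreviation "RF \<equiv> reg_factor v r t u"

lemma E_eq_RF: "E w = RF w * of_real (v powr (- real_of_int (vexp w) / 2))"
  using v1 by (simp add: sym_factor_def reg_factor_def)

text \<open>The value of \<open>\<mu>\<close> up to its normalisation factor: short roots paired as \<open>\<plusminus> x\<close>, long roots as
  \<open>\<plusminus>(x + y)\<close> and \<open>\<plusminus>(x - y)\<close>. The arguments \<open>lm\<close>, \<open>lp\<close>, \<open>ll\<close> are twice the labels
  \<open>m\<^sub>-\<close> and \<open>m\<^sub>+\<close> of short roots and \<open>m\<^sub>+\<close> of long roots.\<close>

definition mu_product :: "wt list \<Rightarrow> int \<Rightarrow> int \<Rightarrow> int \<Rightarrow> complex" where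
  "mu_product xs lm lp ll =
     (\<Prod>x\<leftarrow>xs. short_ratio x lm lp) *
     pairprod (\<lambda>x y. Theta (x + y) 0 / Theta (x + y) ll * (Theta (x - y) 0 / Theta (x - y) ll)) xs"

lemma small_exps_texp: "texp x \<in> small_exps r \<Longrightarrow> - texp x \<in> small_exps r"
  by (rule small_exps_uminus)

lemma root_weight_small_exps:
  assumes "\<forall>x\<in>set xs. slim r x" "\<alpha> \<in> roots (length xs)"
  shows "texp (root_weight xs \<alpha>) \<in> small_exps r"
  using assms(2)
proof (cases rule: roots_cases)
  case (short i s)
  then have "slim r (xs ! i)" using assms(1) by auto
  then have "texp (xs ! i) \<in> small_exps r" using slim_small_exps(1) by blast
  with short show ?thesis using small_exps_texp[of "xs ! i"] by (auto simp: root_weight_sroot smul_def)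
next
  case (long i j s s')
  have "slim r (xs ! i)" "slim r (xs ! j)" using long assms(1) by auto
  note s = slim_small_exps[OF this]
  have n: "texp (- xs ! i + xs ! j) \<in> small_exps r" "texp (- xs ! i - xs ! j) \<in> small_exps r"
    using small_exps_texp[OF s(2)] small_exps_texp[OF s(3)] by (simp_all add: algebra_simps)
  have "- texp (xs ! j) - texp (xs ! i) = - texp (xs ! i) - texp (xs ! j)"
    by (simp add: fun_eq_iff)
  then have "- texp (xs ! j) - texp (xs ! i) \<in> small_exps r" using n(2) by (simp only: exp_simps)
  with s n long show ?thesis by (auto simp: root_weight_lroot smul_def)
qed

text \<open>For each root the scalings leave exactly half the sum of the two doubled labels, whatever the
  weight. This is why the constant \<open>v\<^bsup>-2\<Sigma>(m\<^sub>+ + m\<^sub>-)\<^esup>\<close> disappears in \<open>mu_value\<close>.\<close>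

lemma root_ratio:
  "RF (sg - w) * RF (- w) / (RF (sg - vw a - w) * RF (- vw b - w)) =
   E (sg - w) * E (- w) / (E (sg - vw a - w) * E (- vw b - w)) * of_real (v powr (real_of_int (a + b) / 2))"
proof -
  define k where "k = real_of_int (vexp w)"
  define R where "R = complex_of_real (v powr (real_of_int (a + b) / 2))"
  define P where "P = complex_of_real (v powr (k / 2) * v powr (k / 2))"
  have "v powr (real_of_int (a + b) / 2) * (v powr (k / 2) * v powr (k / 2)) =
    v powr ((real_of_int a + k) / 2) * v powr ((real_of_int b + k) / 2)"
    unfolding powr_add[symmetric] by (rule arg_cong[where f = "\<lambda>x. v powr x"]) (simp add: field_simps)
  then have RP: "complex_of_real (v powr ((real_of_int a + k) / 2) * v powr ((real_of_int b + k) / 2)) = R * P"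
    unfolding R_def P_def by (simp only: of_real_mult[symmetric])
  have 1: "E (sg - w) * E (- w) = RF (sg - w) * RF (- w) * P"
    by (simp add: E_eq_RF k_def P_def)
  have "E (sg - vw a - w) * E (- vw b - w) = RF (sg - vw a - w) * RF (- vw b - w) *
      complex_of_real (v powr ((real_of_int a + k) / 2) * v powr ((real_of_int b + k) / 2))"
    by (simp add: E_eq_RF k_def add.commute)
  then have 2: "E (sg - vw a - w) * E (- vw b - w) = RF (sg - vw a - w) * RF (- vw b - w) * (R * P)"
    by (simp only: RP)
  have "P \<noteq> 0" "R \<noteq> 0" using v1 by (simp_all add: P_def R_def)
  then show ?thesis unfolding 1 2 R_def[symmetric] by simp
qed

text \<open>The long roots have \<open>m\<^sub>- = 0\<close>, so that their factors \<open>1 + \<alpha>\<^bsup>-1\<^esup>\<close> cancel. The symmetric shape of the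
  remaining product allows each root to be paired with its negative.\<close>

lemma mu_value:
  fixes H :: hecke_data
  assumes len: "length xs = hecke_data.rank H"
    and lab: "2 * real (base H) = of_int ll" "2 * real (base H) * par_plus H = of_int lp"
      "2 * real (base H) * par_minus H = of_int lm"
    and slim: "\<forall>x\<in>set xs. slim r x"
  defines "a \<equiv> \<lambda>\<alpha>. if \<alpha> \<in> long_roots (hecke_data.rank H) then 0 else lm"
    and "b \<equiv> \<lambda>\<alpha>. if \<alpha> \<in> long_roots (hecke_data.rank H) then ll else lp"
  shows "of_real (mu_const H v) *
      (\<Prod>\<alpha>\<in>roots (hecke_data.rank H). RF (sg - root_weight xs \<alpha>) * RF (- root_weight xs \<alpha>)) /
      (\<Prod>\<alpha>\<in>roots (hecke_data.rank H). RF (sg - vw (a \<alpha>) - root_weight xs \<alpha>) * RF (- vw (b \<alpha>) - root_weight xs \<alpha>)) =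
     of_real (norm_factor H v) * mu_product xs lm lp ll"
proof -
  let ?R = "roots (hecke_data.rank H)"
  let ?w = "root_weight xs"
  define F where "F w = E (sg - w) * E (- w) / (E (sg - vw lm - w) * E (- vw lp - w))" for w
  define G where "G w = E (- w) / E (- vw ll - w)" for w
  have lab2: "real_of_int (a \<alpha> + b \<alpha>) / 2 = lab_plus H \<alpha> + lab_minus H \<alpha>" for \<alpha>
    using lab by (simp add: a_def b_def lab_plus_def lab_minus_def field_simps)
  have lab_sym: "lab_plus H (- \<alpha>) + lab_minus H (- \<alpha>) = lab_plus H \<alpha> + lab_minus H \<alpha>" for \<alpha>
    by (simp add: lab_plus_def lab_minus_def minus_long_iff)
  have "(\<Prod>\<alpha>\<in>?R. RF (sg - ?w \<alpha>) * RF (- ?w \<alpha>)) /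
      (\<Prod>\<alpha>\<in>?R. RF (sg - vw (a \<alpha>) - ?w \<alpha>) * RF (- vw (b \<alpha>) - ?w \<alpha>)) =
     (\<Prod>\<alpha>\<in>?R. (if \<alpha> \<in> long_roots (hecke_data.rank H) then G (?w \<alpha>) else F (?w \<alpha>)) *
        of_real (v powr (real_of_int (a \<alpha> + b \<alpha>) / 2)))"
    unfolding prod_dividef[symmetric]
  proof (intro prod.cong refl)
    fix \<alpha> assume "\<alpha> \<in> ?R"
    then have "texp (?w \<alpha>) \<in> small_exps r" using root_weight_small_exps[OF slim] len by simp
    then have "E (sg - ?w \<alpha>) \<noteq> 0" using small_exps_texp by (intro E_nz) simp
    then show "RF (sg - ?w \<alpha>) * RF (- ?w \<alpha>) / (RF (sg - vw (a \<alpha>) - ?w \<alpha>) * RF (- vw (b \<alpha>) - ?w \<alpha>)) =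
       (if \<alpha> \<in> long_roots (hecke_data.rank H) then G (?w \<alpha>) else F (?w \<alpha>)) *
        of_real (v powr (real_of_int (a \<alpha> + b \<alpha>) / 2))"
      unfolding root_ratio by (simp add: a_def b_def F_def G_def vw_0)
  qed
  also have "\<dots> = (\<Prod>\<alpha>\<in>?R. (if \<alpha> \<in> long_roots (hecke_data.rank H) then G (?w \<alpha>) else F (?w \<alpha>))) *
      of_real (v powr (\<Sum>\<alpha>\<in>?R. lab_plus H \<alpha> + lab_minus H \<alpha>))"
    unfolding prod.distrib lab2 using v1 by (simp add: powr_sum)
  also have "(\<Sum>\<alpha>\<in>?R. lab_plus H \<alpha> + lab_minus H \<alpha>) = 2 * (\<Sum>\<alpha>\<in>pos_roots (hecke_data.rank H). lab_plus H \<alpha> + lab_minus H \<alpha>)"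
    by (intro sum_roots_pos lab_sym)
  finally have 1: "of_real (mu_const H v) * (\<Prod>\<alpha>\<in>?R. RF (sg - ?w \<alpha>) * RF (- ?w \<alpha>)) /
      (\<Prod>\<alpha>\<in>?R. RF (sg - vw (a \<alpha>) - ?w \<alpha>) * RF (- vw (b \<alpha>) - ?w \<alpha>)) =
      of_real (norm_factor H v) * (\<Prod>\<alpha>\<in>?R. (if \<alpha> \<in> long_roots (hecke_data.rank H) then G (?w \<alpha>) else F (?w \<alpha>))) *
      of_real (v powr (- 2 * (\<Sum>\<alpha>\<in>pos_roots (hecke_data.rank H). lab_plus H \<alpha> + lab_minus H \<alpha>)) *
         v powr (2 * (\<Sum>\<alpha>\<in>pos_roots (hecke_data.rank H). lab_plus H \<alpha> + lab_minus H \<alpha>)))"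
    by (simp add: mu_const_def ac_simps flip: times_divide_eq_right)
  have F: "F x * F (- x) = short_ratio x lm lp" for x
  proof -
    have w: "sg - (- x) = sg + x" "- (sg + x) = sg - x" "- (- x) = x" "sg - vw lm - x = - (sg + x) - vw lm"
      "- vw lp - x = - x - vw lp" "sg - vw lm - (- x) = sg + x - vw lm" "- vw lp - (- x) = x - vw lp"
      by (simp_all add: algebra_simps)
    have n: "- (sg + x) = sg - x" by (simp add: algebra_simps)
    show ?thesis unfolding F_def Theta_def vw_0 diff_0_right w unfolding n
      by (simp only: times_divide_times_eq mult.assoc mult.commute mult.left_commute)
  qed
  have G: "G (x + y) * G (x - y) * (G (- x + y) * G (- x - y)) =
    Theta (x + y) 0 / Theta (x + y) ll * (Theta (x - y) 0 / Theta (x - y) ll)" for x y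
  proof -
    have w: "- x + y = - (x - y)" "- x - y = - (x + y)" "- vw ll - z = - z - vw ll" for z
      by (simp_all add: algebra_simps)
    show ?thesis unfolding G_def Theta_def vw_0 diff_0_right w minus_minus
      by (simp only: times_divide_times_eq mult.assoc mult.commute mult.left_commute)
  qed
  have "(\<Prod>\<alpha>\<in>?R. (if \<alpha> \<in> long_roots (hecke_data.rank H) then G (?w \<alpha>) else F (?w \<alpha>))) = mu_product xs lm lp ll"
    unfolding len[symmetric] prod_list_pairprod_roots F G mu_product_def ..
  moreover have "v powr (- 2 * s) * v powr (2 * s) = 1" for s
    using v1 by (simp add: powr_add[symmetric])
  ultimately show ?thesis unfolding 1 by simp
qed

end

section \<open>Evaluation of the product at the target\<close>

definition doubled :: "wt list \<Rightarrow> wt list" where "doubled xs = concat (map (\<lambda>x. [x, - x]) xs)"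

text \<open>The coordinates of \<open>\<xi>\<close> as weights.\<close>

definition target_weights :: "nat \<Rightarrow> nat \<Rightarrow> nat \<Rightarrow> nat \<Rightarrow> nat \<Rightarrow> wt list" where
  "target_weights r e k e' k' =
     map (\<lambda>n. sg + vw (2 * int n)) (r_exponents e' k') @
     concat (map (\<lambda>i. [tw i - vw 1, tw i + vw 1]) [0..<r]) @
     map (\<lambda>n. vw (2 * int n)) (r_exponents e k)"

definition sgn_const :: "nat \<Rightarrow> nat \<Rightarrow> real" where
  "sgn_const e k = (\<Prod>j<k. (- 1) ^ (j + e))"

context generic_point
begin

lemma K_0: "K 0 = u / of_real (v - inverse v)"
proof -
  have "E (vw (2 * (- 1))) = of_real (v - inverse v)"
    by (subst E_const) (simp_all add: power_int_minus)
  then show ?thesis by (simp add: K_def vw_add(3)[symmetric])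
qed

lemma K_sg: "K sg = 2 / of_real (v + inverse v)"
proof -
  have a: "E (sg + vw (2 * (- 1))) = of_real (v + inverse v)"
    by (subst E_const) (simp add: power_int_minus)
  have b: "E sg = 2"
    using E_const(2)[of 0] by (simp add: vw_0)
  have c: "sg - vw 2 = sg + vw (2 * (- 1))" by (simp add: wt_eq_iff)
  show ?thesis unfolding K_def c a b ..
qed

lemma K_consts_nz: "K 0 \<noteq> 0" "K sg \<noteq> 0"
proof -
  have "inverse v < v" using v1 by (simp add: field_simps) (simp add: less_1_mult)
  then show "K 0 \<noteq> 0" using u unfolding K_0 by (simp del: of_real_diff)
  have "v + inverse v \<noteq> 0" using v1 by (smt (verit) inverse_positive_iff_positive)
  then show "K sg \<noteq> 0" unfolding K_sg by (simp del: of_real_add)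
qed

lemma crossK_doubled_replicate:
  "crossK (doubled xs) (replicate n y) = (\<Prod>x\<leftarrow>xs. (K (x + y) * K (- x + y)) ^ n)"
proof -
  have "(\<Prod>z\<leftarrow>replicate n y. K (x + z)) = K (x + y) ^ n" for x by (induction n) auto
  then show ?thesis
    by (induction xs) (auto simp: doubled_def crossprod_Cons power_mult_distrib mult.assoc)
qed

text \<open>The pairs \<open>{x, x\<^bsup>-1\<^esup>}\<close> contribute \<open>K(1)\<close> each, the other pairs are the long roots.\<close>

lemma pairK_doubled:
  "pairK (doubled xs) = K 0 ^ length xs *
     pairprod (\<lambda>x y. (K (x + y) * K (- (x + y))) * (K (x - y) * K (- (x - y)))) xs"
proof -
  have e: "- x + - y = - (x + y)" "- x + y = - (x - y)" "x + - y = x - y"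
    "- x - y = - (x + y)" for x y :: wt
    by (simp_all add: algebra_simps)
  have "pairK (doubled xs) = (\<Prod>x\<leftarrow>xs. pairK [x, - x]) * pairprod (\<lambda>x y. crossK [x, - x] [y, - y]) xs"
    unfolding doubled_def pairprod_concat pairprod_map map_map o_def ..
  also have "(\<Prod>x\<leftarrow>xs. pairK [x, - x]) = K 0 ^ length xs"
    by (induction xs) auto
  also have "(\<lambda>x y. crossK [x, - x] [y, - y]) =
      (\<lambda>x y. (K (x + y) * K (- (x + y))) * (K (x - y) * K (- (x - y))))"
    by (intro ext) (simp only: crossprod_def list.map prod_list.Cons prod_list.Nil mult_1_right mult_1_left e
        mult.assoc mult.commute mult.left_commute)
  finally show ?thesis .
qed

lemma Theta_K: "Theta x 0 / Theta x 2 = K x * K (- x)"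
  by (simp add: Theta_def K_def vw_0)

text \<open>For \<open>\<delta> = 0\<close> the short root factors cancel, and for \<open>\<delta> = 1\<close> they are \<open>K(\<plusminus> x\<^bsup>\<plusminus>1\<^esup>)\<close>, the pairs of a
  coordinate with an additional weight \<open>\<plusminus> 1\<close>. The pair of the two additional weights is the only one
  that does not come from a root, apart from the pairs \<open>{x, x\<^bsup>-1\<^esup>}\<close>.\<close>

lemma mu_product_target:
  assumes slim: "\<forall>x\<in>set xs. slim r x" and d: "dm \<in> {0, 1}" "dp \<in> {0, 1}"
  shows "mu_product xs (2 * int dm) (2 * int dp) 2 =
    pairK (doubled xs @ replicate dp 0 @ replicate dm sg) / (K 0 ^ length xs * K sg ^ (dm * dp))"
proof -
  have T: "Theta x 0 / Theta x (2 * int d) = (K x * K (- x)) ^ d" if "slim r x" "d \<in> {0, 1}" for x d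
    using that(2) Theta_nz[OF slim_small_exps(1)[OF that(1) that(1)], of 0] Theta_K[of x] by auto
  have slim_sg: "slim r x \<Longrightarrow> slim r (sg + x)" for x by (simp add: slim_def)
  have n: "- (sg + x) = - x + sg" "sg + x = x + sg" for x by (simp_all add: algebra_simps)
  have "(\<Prod>x\<leftarrow>xs. short_ratio x (2 * int dm) (2 * int dp)) =
     (\<Prod>x\<leftarrow>xs. (K (x + 0) * K (- x + 0)) ^ dp * (K (x + sg) * K (- x + sg)) ^ dm)"
  proof (intro arg_cong[where f = prod_list] map_cong refl)
    fix x assume "x \<in> set xs"
    then have s: "slim r x" "slim r (sg + x)" using slim slim_sg by auto
    have "short_ratio x (2 * int dm) (2 * int dp) =
      (Theta x 0 / Theta x (2 * int dp)) * (Theta (sg + x) 0 / Theta (sg + x) (2 * int dm))"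
      by (simp add: mult.commute)
    also have "\<dots> = (K (x + 0) * K (- x + 0)) ^ dp * (K (x + sg) * K (- x + sg)) ^ dm"
      unfolding T[OF s(1) d(2)] T[OF s(2) d(1)] n(1) by (simp only: add.commute[of sg x] add_0_right)
    finally show "short_ratio x (2 * int dm) (2 * int dp) =
      (K (x + 0) * K (- x + 0)) ^ dp * (K (x + sg) * K (- x + sg)) ^ dm" .
  qed
  also have "\<dots> = crossK (doubled xs) (replicate dp 0) * crossK (doubled xs) (replicate dm sg)"
    unfolding prod_list_mult_map crossK_doubled_replicate ..
  finally have 1: "mu_product xs (2 * int dm) (2 * int dp) 2 =
     crossK (doubled xs) (replicate dp 0) * crossK (doubled xs) (replicate dm sg) *
     (pairK (doubled xs) / K 0 ^ length xs)"
    using K_consts_nz unfolding mu_product_def pairK_doubled Theta_K by simp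
  have 2: "pairK (replicate dp 0) = 1" "pairK (replicate dm sg) = 1"
    using d by auto
  have 3: "crossK (replicate dp 0) (replicate dm sg) = K sg ^ (dm * dp)"
    using d by (auto simp: crossprod_def)
  show ?thesis unfolding 1 pairprod_append crossprod_append_right 2 3
    using K_consts_nz by simp
qed

lemma mset_doubled_append: "mset (doubled (xs @ ys)) = mset (doubled xs) + mset (doubled ys)"
  by (simp add: doubled_def)

lemma mset_doubled_vw: "mset (doubled (map (\<lambda>n. vw (2 * int n)) (r_exponents e k)) @ replicate (k mod 2) 0) =
    mset (seg_weights (segments e k))"
proof -
  have "mset (seg_weights (segments e k)) = image_mset (\<lambda>n. vw (2 * n)) (mset (concat (map (\<lambda>n. [int n, - int n]) (r_exponents e k)) @ replicate (k mod 2) 0))"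
    unfolding mset_segs by (simp add: seg_weights_def)
  also have "\<dots> = mset (doubled (map (\<lambda>n. vw (2 * int n)) (r_exponents e k)) @ replicate (k mod 2) 0)"
    by (simp add: doubled_def map_concat o_def vw_add vw_0 mset_map[symmetric] del: mset_map)
  finally show ?thesis ..
qed

lemma mset_doubled_sg: "mset (doubled (map (\<lambda>n. sg + vw (2 * int n)) (r_exponents e k)) @ replicate (k mod 2) sg) =
    mset (neg_seg_weights (segments e k))"
proof -
  have "mset (neg_seg_weights (segments e k)) = image_mset (\<lambda>n. sg + vw (2 * n)) (mset (concat (map (\<lambda>n. [int n, - int n]) (r_exponents e k)) @ replicate (k mod 2) 0))"
    unfolding mset_segs by (simp add: neg_seg_weights_def)
  also have "\<dots> = mset (doubled (map (\<lambda>n. sg + vw (2 * int n)) (r_exponents e k)) @ replicate (k mod 2) sg)"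
  proof -
    have "- (sg + vw a) = sg + vw (- a)" for a by (simp add: wt_eq_iff)
    then show ?thesis
      by (simp add: doubled_def map_concat o_def vw_0 mset_map[symmetric] del: mset_map minus_add_distrib)
  qed
  finally show ?thesis ..
qed

lemma mset_target_weights:
  "mset (doubled (target_weights r e k e' k') @ replicate (k mod 2) 0 @ replicate (k' mod 2) sg) =
   mset (seg_weights (segments e k) @ neg_seg_weights (segments e' k') @ concat (map (\<lambda>i. block (tw i)) [0..<r]))"
proof -
  have "mset (doubled (concat (map (\<lambda>i. [tw i - vw 1, tw i + vw 1]) ns))) = mset (concat (map (\<lambda>i. block (tw i)) ns))" for ns
    by (induction ns) (simp_all add: doubled_def block_def)
  then show ?thesis
    using mset_doubled_vw[of e k] mset_doubled_sg[of e' k']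
    unfolding target_weights_def mset_append mset_doubled_append by (simp add: ac_simps)
qed

lemma slim_tw: "i < r \<Longrightarrow> slim r (tw i)"
  by (simp add: slim_def lattice_of_rank_def sroot_def)

lemma slim_target_weights: "\<forall>x\<in>set (target_weights r e k e' k'). slim r x"
  using slim_tw by (auto simp: target_weights_def slim_def lattice_of_rank_def)

lemma texp_tw_nz: "texp (tw i) \<noteq> 0"
  by (simp add: sroot_def fun_eq_iff)

lemma texp_tw_pm_nz: "i \<noteq> j \<Longrightarrow> texp (tw i + tw j) \<noteq> 0" "i \<noteq> j \<Longrightarrow> texp (tw i - tw j) \<noteq> 0"
  by (auto simp: sroot_def fun_eq_iff)

text \<open>The pairs of the rearranged multiset are sorted by kind: strings with strings give the constant, strings
  with blocks the denominators of the short roots of the source, and blocks with blocks everything else.\<close>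

lemma mu_product_compare:
  fixes e k e' k' :: nat
  assumes ee: "e \<in> {0, 1}" "e' \<in> {0, 1}"
  defines "xs \<equiv> target_weights r e k e' k'"
  shows "mu_product xs (2 * int (k' mod 2)) (2 * int (k mod 2)) 2 =
     of_real (sgn_const e k * sgn_const e' k' * res_const e k e' k' v) *
     (- u / of_real (v powi 2 - v powi (- 2))) ^ r *
     mu_product (map tw [0..<r]) (4 * int k' + 2 * int e' - 1) (4 * int k + 2 * int e - 1) 4 /
     (K 0 ^ length xs * K sg ^ ((k' mod 2) * (k mod 2)))"
proof -
  let ?M = "concat (map (\<lambda>i. block (tw i)) [0..<r])"
  let ?lm = "4 * int k' + 2 * int e' - 1" and ?lp = "4 * int k + 2 * int e - 1"
  let ?c = "- u / of_real (v powi 2 - v powi (- 2))"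
  have sb: "texp (tw i) \<in> small_exps r" "texp (sg + tw i) \<in> small_exps r" if "i < r" for i
    using slim_small_exps(1)[OF slim_tw slim_tw, OF that that] by simp_all
  have "mu_product xs (2 * int (k' mod 2)) (2 * int (k mod 2)) 2 =
      pairK (doubled xs @ replicate (k mod 2) 0 @ replicate (k' mod 2) sg) / 
      (K 0 ^ length xs * K sg ^ ((k' mod 2) * (k mod 2)))"
    unfolding xs_def by (intro mu_product_target slim_target_weights) auto
  also have "pairK (doubled xs @ replicate (k mod 2) 0 @ replicate (k' mod 2) sg) =
      pairK (seg_weights (segments e k) @ neg_seg_weights (segments e' k') @ ?M)"
    unfolding xs_def by (intro pairprod_mset mset_target_weights) (simp add: add.commute)
  also have "\<dots> = (pairK (seg_weights (segments e k)) * pairK (seg_weights (segments e' k')) * crossK (seg_weights (segments e k)) (neg_seg_weights (segments e' k'))) *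
      (pairK ?M * (crossK (seg_weights (segments e k)) ?M * crossK (neg_seg_weights (segments e' k')) ?M))"
    by (simp only: pairprod_append crossprod_append_right pairK_neg_seg_weights
        mult.assoc mult.commute mult.left_commute)
  also have "pairK (seg_weights (segments e k)) * pairK (seg_weights (segments e' k')) * crossK (seg_weights (segments e k)) (neg_seg_weights (segments e' k')) =
      of_real (sgn_const e k * sgn_const e' k' * res_const e k e' k' v)"
    unfolding pairK_segs[OF ee(1)] pairK_segs[OF ee(2)] crossK_segs_neg_segs prod.distrib
    by (simp only: sgn_const_def res_const_def of_real_mult[symmetric]
        mult.assoc mult.commute mult.left_commute)
  also have "pairK ?M * (crossK (seg_weights (segments e k)) ?M * crossK (neg_seg_weights (segments e' k')) ?M) =
      ?c ^ r * mu_product (map tw [0..<r]) ?lm ?lp 4"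
  proof -
    have PPM: "pairK ?M = (\<Prod>i\<leftarrow>[0..<r]. pairK (block (tw i))) * pairprod (\<lambda>i j. crossK (block (tw i)) (block (tw j))) [0..<r]"
      unfolding pairprod_concat pairprod_map map_map o_def ..
    have CCM: "crossK ys ?M = (\<Prod>i\<leftarrow>[0..<r]. crossK ys (block (tw i)))" for ys
      unfolding crossprod_concat_right map_map o_def ..
    have "pairK ?M * (crossK (seg_weights (segments e k)) ?M * crossK (neg_seg_weights (segments e' k')) ?M) =
      (\<Prod>i\<leftarrow>[0..<r]. pairK (block (tw i)) * (crossK (seg_weights (segments e k)) (block (tw i)) * crossK (neg_seg_weights (segments e' k')) (block (tw i)))) *
      pairprod (\<lambda>i j. crossK (block (tw i)) (block (tw j))) [0..<r]"
      unfolding PPM CCM prod_list_mult_map by (simp only: mult.assoc mult.commute mult.left_commute)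
    also have "(\<Prod>i\<leftarrow>[0..<r]. pairK (block (tw i)) * (crossK (seg_weights (segments e k)) (block (tw i)) * crossK (neg_seg_weights (segments e' k')) (block (tw i)))) =
      (\<Prod>i\<leftarrow>[0..<r]. ?c * (short_ratio (tw i) ?lm ?lp))"
    proof (intro arg_cong[where f = prod_list] map_cong refl)
      fix i assume "i \<in> set [0..<r]"
      then have i: "i < r" by simp
      note x = sb(1)[OF i] texp_tw_nz[of i]
      have nz: "Theta (tw i) 1 \<noteq> 0" "Theta (sg + tw i) 1 \<noteq> 0" using sb[OF i] Theta_nz by auto
      show "pairK (block (tw i)) * (crossK (seg_weights (segments e k)) (block (tw i)) * crossK (neg_seg_weights (segments e' k')) (block (tw i))) =
        ?c * (short_ratio (tw i) ?lm ?lp)"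
        unfolding pairK_block[OF x(2)] cross_segs_block_one[OF x ee(1)] cross_neg_segs_block_one[OF x ee(2)]
        using nz by (simp add: mult.commute)
    qed
    also have "\<dots> = ?c ^ r * (\<Prod>i\<leftarrow>[0..<r]. short_ratio (tw i) ?lm ?lp)"
    proof -
      have "(\<Prod>i\<leftarrow>ns. ?c) = ?c ^ length ns" for ns :: "nat list" by (induction ns) auto
      then show ?thesis unfolding prod_list_mult_map by simp
    qed
    also have "pairprod (\<lambda>i j. crossK (block (tw i)) (block (tw j))) [0..<r] =
       pairprod (\<lambda>i j. Theta (tw i + tw j) 0 / Theta (tw i + tw j) 4 * (Theta (tw i - tw j) 0 / Theta (tw i - tw j) 4)) [0..<r]"
      using slim_small_exps[OF slim_tw slim_tw] texp_tw_pm_nz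
      by (intro pairprod_distinct_cong crossK_block_block) auto
    finally show ?thesis by (simp only: mu_product_def map_map o_def pairprod_map mult.assoc)
  qed
  finally show ?thesis by (simp add: mult.assoc)
qed

end

section \<open>Genericity and regularisation\<close>

text \<open>Small exponents are the digits of a balanced expansion in base \<open>5\<close>, so along this curve every
  nonzero small exponent pairs to a nonzero power of \<open>s\<close>.\<close>

definition curve :: "complex list \<Rightarrow> complex \<Rightarrow> complex list" where
  "curve t s = map (\<lambda>i. t ! i * s ^ (5 ^ i)) [0..<length t]"

definition pairing :: "nat \<Rightarrow> (nat \<Rightarrow> int) \<Rightarrow> int" where
  "pairing r b = (\<Sum>i<r. b i * 5 ^ i)"

lemma torus_iff: "t \<in> torus r \<longleftrightarrow> length t = r \<and> (\<forall>i<r. t ! i \<noteq> 0)"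
  by (auto simp: torus_def in_set_conv_nth)

lemma curve_torus: "t \<in> torus r \<Longrightarrow> s \<noteq> 0 \<Longrightarrow> curve t s \<in> torus r"
  by (auto simp: torus_iff curve_def)

lemma curve_1: "curve t 1 = t"
  by (simp add: curve_def map_nth)

lemma power_int_sum:
  fixes s :: complex
  assumes "s \<noteq> 0"
  shows "s powi (\<Sum>i\<in>A. f i) = (\<Prod>i\<in>A. s powi f i)"
  using assms by (induction A rule: infinite_finite_induct) (auto simp: power_int_add)

lemma chr_curve:
  assumes "t \<in> torus r" "s \<noteq> 0"
  shows "chr r b (curve t s) = chr r b t * s powi (pairing r b)"
proof -
  have "(s ^ (5 ^ i)) powi b i = s powi (b i * 5 ^ i)" for i
    by (metis of_nat_numeral of_nat_power power_int_mult power_int_of_nat mult.commute)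
  then have "chr r b (curve t s) = (\<Prod>i<r. t ! i powi b i * s powi (b i * 5 ^ i))"
    using assms(1) by (simp add: chr_def curve_def torus_def power_int_mult_distrib)
  then show ?thesis
    using assms(2) by (simp add: prod.distrib chr_def pairing_def power_int_sum)
qed

text \<open>Modulo \<open>5\<^bsup>m+1\<^esup>\<close> only the lowest nonzero digit, at place \<open>m\<close>, is seen.\<close>

lemma pairing_nz:
  assumes "b \<in> small_exps r" "b \<noteq> 0"
  shows "pairing r b \<noteq> 0"
proof
  assume 0: "pairing r b = 0"
  obtain j where "b j \<noteq> 0" using assms(2) by (auto simp: fun_eq_iff)
  define m where "m = (LEAST i. b i \<noteq> 0)"
  have m: "b m \<noteq> 0" "\<And>i. i < m \<Longrightarrow> b i = 0"
    using LeastI[of "\<lambda>i. b i \<noteq> 0", OF \<open>b j \<noteq> 0\<close>] not_less_Least unfolding m_def by blast+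
  then have "m < r" using assms(1) by (auto simp: small_exps_def lattice_of_rank_def intro: ccontr)
  have "(5::int) ^ Suc m dvd (\<Sum>i\<in>{..<r} - {m}. b i * 5 ^ i)"
  proof (rule dvd_sum)
    fix i assume "i \<in> {..<r} - {m}"
    then consider "i < m" | "Suc m \<le> i" by fastforce
    then show "(5::int) ^ Suc m dvd b i * 5 ^ i"
    proof cases
      case 1
      show ?thesis unfolding m(2)[OF 1] by simp
    next
      case 2
      then have "(5::int) ^ Suc m dvd 5 ^ i" by (rule le_imp_power_dvd)
      then show ?thesis by (rule dvd_mult)
    qed
  qed
  moreover have "pairing r b = b m * 5 ^ m + (\<Sum>i\<in>{..<r} - {m}. b i * 5 ^ i)"
    unfolding pairing_def using \<open>m < r\<close> by (subst sum.remove[of _ m]) auto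
  then have "b m * 5 ^ m = - (\<Sum>i\<in>{..<r} - {m}. b i * 5 ^ i)" using 0 by simp
  ultimately have "(5::int) ^ Suc m dvd b m * 5 ^ m" by (simp only: dvd_minus_iff)
  then have "5 dvd b m" by simp
  moreover have "\<bar>b m\<bar> \<le> 2" using assms(1) by (simp add: small_exps_def)
  ultimately show False using m(1) by presburger
qed

lemma finite_powi_roots:
  assumes "n \<noteq> 0"
  shows "finite {s :: complex. s \<noteq> 0 \<and> s powi n = c}"
proof (cases "n > 0")
  case True
  then have "{s :: complex. s \<noteq> 0 \<and> s powi n = c} \<subseteq> {s. s ^ nat n = c}"
    by (auto simp: power_int_def)
  moreover have "finite {s :: complex. s ^ nat n = c}" using True by (intro finite_nth_roots) simp
  ultimately show ?thesis by (rule finite_subset)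
next
  case False
  then have "{s :: complex. s \<noteq> 0 \<and> s powi n = c} \<subseteq> {s. s ^ nat (- n) = inverse c}"
    using assms by (auto simp: power_int_def power_inverse)
  moreover have "finite {s :: complex. s ^ nat (- n) = inverse c}"
    using False assms by (intro finite_nth_roots) simp
  ultimately show ?thesis by (rule finite_subset)
qed

lemma finite_small_exps: "finite (small_exps r)"
proof -
  have "small_exps r \<subseteq> {f. \<forall>i. (i \<in> {..<r} \<longrightarrow> f i \<in> {-2..2}) \<and> (i \<notin> {..<r} \<longrightarrow> f i = 0)}"
    by (auto simp: small_exps_def lattice_of_rank_def abs_le_iff) (metis minus_le_iff)
  moreover have "finite {f. \<forall>i. (i \<in> {..<r} \<longrightarrow> f i \<in> {-2..2::int}) \<and> (i \<notin> {..<r} \<longrightarrow> f i = 0)}"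
    by (intro finite_set_of_finite_funs) auto
  ultimately show ?thesis by (rule finite_subset)
qed

text \<open>There are countably many conditions, and each excludes finitely many \<open>s\<close>.\<close>

lemma countable_not_generic:
  assumes "t \<in> torus r"
  shows "countable {s. s \<noteq> 0 \<and> \<not> generic v r (curve t s)}"
proof -
  let ?B = "\<lambda>b c. {s. s \<noteq> 0 \<and> s powi (pairing r b) = c / chr r b t}"
  let ?U = "\<Union>b\<in>small_exps r - {0}. \<Union>k::int. ?B b (of_real (v powi k)) \<union> ?B b (- of_real (v powi k))"
  have "{s. s \<noteq> 0 \<and> \<not> generic v r (curve t s)} \<subseteq>
    ?U"
  proof
    fix s assume "s \<in> {s. s \<noteq> 0 \<and> \<not> generic v r (curve t s)}"
    then have s: "s \<noteq> 0" "\<not> generic v r (curve t s)" by auto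
    then obtain b k where b: "b \<in> small_exps r - {0}"
      "chr r b (curve t s) = of_real (v powi k) \<or> chr r b (curve t s) = - of_real (v powi k)"
      using curve_torus[OF assms s(1)] unfolding generic_def by blast
    then have "s \<in> ?B b (of_real (v powi k)) \<union> ?B b (- of_real (v powi k))"
      using s(1) chr_nz[OF assms, of b] by (auto simp: chr_curve[OF assms s(1)] field_simps)
    then show "s \<in> ?U"
      using b(1) by blast
  qed
  moreover have "countable ?U"
    by (intro countable_UN countable_Un countable_finite finite_powi_roots pairing_nz finite_Diff finite_small_exps
        countableI_type) auto
  ultimately show ?thesis by (rule countable_subset)
qed

text \<open>The nonvanishing set on the curve would be open and contain \<open>s = 1\<close>, hence be uncountable, yet it
  consists of nongeneric parameters.\<close>

lemma zero_off_generic: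
  assumes gen: "\<And>t. generic v r t \<Longrightarrow> F t = 0"
    and cont: "continuous_on (- {0}) (\<lambda>s. F (curve t s) :: complex)"
    and t: "t \<in> torus r"
  shows "F t = 0"
proof (rule ccontr)
  assume F: "F t \<noteq> 0"
  let ?U = "{s \<in> - {0}. F (curve t s) \<in> - {0}}"
  have "open ?U"
    using continuous_open_preimage[OF cont, of "- {0}"] by (simp add: vimage_def Int_def open_Compl)
  moreover have "1 \<in> ?U" using F by (simp add: curve_1)
  ultimately obtain d where "d > 0" "ball 1 d \<subseteq> ?U" by (metis open_contains_ball)
  then have "ball 1 d \<subseteq> {s. s \<noteq> 0 \<and> \<not> generic v r (curve t s)}" using gen by blast
  then have "countable (ball (1::complex) d)"
    using countable_not_generic[OF t] by (rule countable_subset)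
  then show False using uncountable_ball[OF \<open>d > 0\<close>, of "1::complex"] by simp
qed

text \<open>Otherwise the constant function \<open>1\<close> would vanish by \<open>zero_off_generic\<close>.\<close>

lemma generic_exists: "\<exists>t. generic v r t"
proof (rule ccontr)
  assume "\<not> (\<exists>t. generic v r t)"
  then have "(1::complex) = 0"
    using zero_off_generic[of v r "\<lambda>_. 1" "replicate r 1"] by (auto simp: torus_def)
  then show False by simp
qed

text \<open>Evaluate at \<open>(1, \<dots>, 1)\<close>, and then with one coordinate replaced by \<open>2\<close>.\<close>

lemma val_eq_1_iff:
  assumes "v > 1" "texp w \<in> lattice_of_rank r"
  shows "(\<forall>t\<in>torus r. val v r t w = 1) \<longleftrightarrow> w = 0"
proof
  assume a: "\<forall>t\<in>torus r. val v r t w = 1"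
  have one: "replicate r 1 \<in> torus r" by (simp add: torus_def)
  have "chr r (texp w) (replicate r 1) = 1" by (simp add: chr_def)
  then have c: "(if fst w = 0 then 1 else -1) * complex_of_real (v powi vexp w) = 1"
    using a one by (auto simp: val_def)
  have pos: "v powi vexp w > 0" using assms(1) by simp
  have "fst w = 0"
  proof (rule ccontr)
    assume "fst w \<noteq> 0"
    then have "- complex_of_real (v powi vexp w) = 1" using c by simp
    from arg_cong[OF this, of Re] have "- (v powi vexp w) = 1" by (simp del: of_real_power_int)
    with pos show False by linarith
  qed
  moreover from this c have "complex_of_real (v powi vexp w) = of_real 1" by simp
  then have "v powi vexp w = 1" by (simp only: of_real_eq_iff)
  then have "vexp w = 0" using powi_eq_1_iff[OF assms(1)] by simp
  moreover have "texp w = 0"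
  proof
    fix i show "texp w i = 0 i"
    proof (cases "i < r")
      case True
      let ?t = "(replicate r (1::complex))[i := 2]"
      have "?t \<in> torus r" using True by (auto simp: torus_iff nth_list_update)
      then have "chr r (texp w) ?t = 1" using a calculation \<open>vexp w = 0\<close> by (auto simp: val_def)
      moreover have "chr r (texp w) ?t = (\<Prod>j<r. if j = i then 2 powi texp w i else 1)"
        unfolding chr_def using True by (intro prod.cong) (auto simp: nth_list_update)
      ultimately have "complex_of_real (2 powi texp w i) = of_real 1" using True by simp
      then have "(2::real) powi texp w i = 1" by (simp only: of_real_eq_iff)
      then show ?thesis using powi_eq_1_iff[of 2] by simp
    next
      case False
      then show ?thesis using assms(2) by (simp add: lattice_of_rank_def)
    qed
  qed
  ultimately show "w = 0" using \<open>vexp w = 0\<close> by (simp add: wt_eq_iff)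
qed simp

text \<open>Each omitted factor is replaced by \<open>u\<close>, so the cardinality of the omitted set reappears as an exponent.\<close>

lemma reg_product:
  assumes "finite A" "Z \<subseteq> A" "\<And>\<alpha>. \<alpha> \<in> A \<Longrightarrow> \<alpha> \<in> Z \<longleftrightarrow> w \<alpha> = 0"
    "\<And>\<alpha>. \<alpha> \<in> A \<Longrightarrow> f \<alpha> = 1 - val v r t (w \<alpha>)"
  shows "(\<Prod>\<alpha>\<in>A - Z. f \<alpha>) * u ^ card Z = (\<Prod>\<alpha>\<in>A. reg_factor v r t u (w \<alpha>))"
proof -
  have "(\<Prod>\<alpha>\<in>A. reg_factor v r t u (w \<alpha>)) = (\<Prod>\<alpha>\<in>A - Z. reg_factor v r t u (w \<alpha>)) * (\<Prod>\<alpha>\<in>Z. reg_factor v r t u (w \<alpha>))"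
    using assms by (intro prod.subset_diff) auto
  also have "(\<Prod>\<alpha>\<in>A - Z. reg_factor v r t u (w \<alpha>)) = (\<Prod>\<alpha>\<in>A - Z. f \<alpha>)"
    using assms by (intro prod.cong) (auto simp: reg_factor_def)
  also have "(\<Prod>\<alpha>\<in>Z. reg_factor v r t u (w \<alpha>)) = (\<Prod>\<alpha>\<in>Z. u)"
    using assms by (intro prod.cong) (auto simp: reg_factor_def)
  finally show ?thesis by simp
qed

lemma texp_root_weight:
  assumes "\<forall>x\<in>set xs. texp x \<in> lattice_of_rank r"
  shows "texp (root_weight xs \<alpha>) \<in> lattice_of_rank r"
proof -
  have 1: "texp (\<Sum>i\<in>A. f i) \<in> lattice_of_rank r" if "\<And>i. i \<in> A \<Longrightarrow> texp (f i) \<in> lattice_of_rank r"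
    for A :: "nat set" and f
    using that by (induction A rule: infinite_finite_induct) (auto simp: lattice_of_rank_def)
  have 2: "texp (smul n x) \<in> lattice_of_rank r" if "x \<in> set xs" for n x
    using that assms by (auto simp: smul_def lattice_of_rank_def)
  show ?thesis unfolding root_weight_def by (intro 1 2 nth_mem) simp
qed

definition num_part :: "hecke_data \<Rightarrow> wt list \<Rightarrow> real \<Rightarrow> nat \<Rightarrow> complex list \<Rightarrow> complex \<Rightarrow> complex" where
  "num_part H xs v r t u = of_real (mu_const H v) *
     (\<Prod>\<alpha>\<in>roots (hecke_data.rank H). reg_factor v r t u (sg - root_weight xs \<alpha>) * reg_factor v r t u (- root_weight xs \<alpha>))"

definition den_part ::
  "hecke_data \<Rightarrow> wt list \<Rightarrow> int \<Rightarrow> int \<Rightarrow> int \<Rightarrow> real \<Rightarrow> nat \<Rightarrow> complex list \<Rightarrow> complex \<Rightarrow> complex" where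
  "den_part H xs lm lp ll v r t u = (\<Prod>\<alpha>\<in>roots (hecke_data.rank H).
     reg_factor v r t u (sg - vw (if \<alpha> \<in> long_roots (hecke_data.rank H) then 0 else lm) - root_weight xs \<alpha>) *
     reg_factor v r t u (- vw (if \<alpha> \<in> long_roots (hecke_data.rank H) then ll else lp) - root_weight xs \<alpha>))"

text \<open>Common to source and target: a \<open>\<mu>\<close>-function of type \<open>B\<close> whose coordinates are given by weights.\<close>

locale weight_datum =
  fixes H :: hecke_data and xs :: "wt list" and lm lp ll :: int and v :: real and r :: nat
  assumes v1: "v > 1" and len: "length xs = hecke_data.rank H"
    and lab: "2 * real (base H) = of_int ll" "2 * real (base H) * par_plus H = of_int lp"
      "2 * real (base H) * par_minus H = of_int lm"
    and slim: "\<forall>x\<in>set xs. slim r x"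
begin

abbreviation "pt t \<equiv> map (val v r t) xs"
abbreviation "L \<equiv> pt ` torus r"
abbreviation "N \<equiv> hecke_data.rank H"
definition "a \<alpha> = (if \<alpha> \<in> long_roots N then 0 else lm)"
definition "b \<alpha> = (if \<alpha> \<in> long_roots N then ll else lp)"

lemma lat: "texp (root_weight xs \<alpha>) \<in> lattice_of_rank r"
  using slim by (intro texp_root_weight) (auto simp: slim_def)

lemma chr_pt: "t \<in> torus r \<Longrightarrow> \<alpha> \<in> roots N \<Longrightarrow> chr N \<alpha> (pt t) = val v r t (root_weight xs \<alpha>)"
  using chr_map_val[of t r v \<alpha> xs] v1 len by simp

lemma powr_lab:
  "of_real (v powr (- 2 * lab_plus H \<alpha>)) = val v r t (- vw (b \<alpha>))"
  "of_real (v powr (- 2 * lab_minus H \<alpha>)) = val v r t (- vw (a \<alpha>))"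
proof -
  have lab': "2 * (real (base H) * par_plus H) = of_int lp"
    "2 * (real (base H) * par_minus H) = of_int lm"
    using lab(2,3) by (simp_all only: mult.assoc)
  have "- 2 * lab_plus H \<alpha> = real_of_int (- b \<alpha>)" "- 2 * lab_minus H \<alpha> = real_of_int (- a \<alpha>)"
    using lab(1) lab' by (auto simp: lab_plus_def lab_minus_def a_def b_def)
  then show "of_real (v powr (- 2 * lab_plus H \<alpha>)) = val v r t (- vw (b \<alpha>))"
    "of_real (v powr (- 2 * lab_minus H \<alpha>)) = val v r t (- vw (a \<alpha>))"
    using v1 by (simp_all only: vw_add val_vw) (subst powr_real_of_int'; simp)+
qed

lemma powr_lab':
  "complex_of_real (v powr (- (2 * lab_plus H \<alpha>))) = val v r t (- vw (b \<alpha>))"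
  "complex_of_real (v powr (- (2 * lab_minus H \<alpha>))) = val v r t (- vw (a \<alpha>))"
  using powr_lab[of \<alpha> t] by simp_all

lemma const_iff:
  assumes "\<alpha> \<in> roots N" "texp x \<in> lattice_of_rank r"
    and c: "\<And>t. t \<in> torus r \<Longrightarrow> c = val v r t x"
  shows "(\<forall>t\<in>L. chr N \<alpha> t = c) \<longleftrightarrow> x - root_weight xs \<alpha> = 0"
proof -
  have v0: "v > 0" using v1 by simp
  have "(\<forall>t\<in>L. chr N \<alpha> t = c) \<longleftrightarrow> (\<forall>t\<in>torus r. val v r t (x - root_weight xs \<alpha>) = 1)"
    using c chr_pt[OF _ assms(1)] val_nz[OF _ v0] val_diff[OF _ v0] by auto
  also have "\<dots> \<longleftrightarrow> x - root_weight xs \<alpha> = 0"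
    using assms(2) lat[of \<alpha>] by (intro val_eq_1_iff v1) (auto simp: lattice_of_rank_def)
  finally show ?thesis .
qed

text \<open>The membership conditions say that the weight in the corresponding factor of \<open>mu_reg\<close> is trivial.\<close>

lemma sets_iff:
  assumes "\<alpha> \<in> roots N"
  shows "\<alpha> \<in> z_plus H L \<longleftrightarrow> - root_weight xs \<alpha> = 0"
    "\<alpha> \<in> z_minus H L \<longleftrightarrow> sg - root_weight xs \<alpha> = 0"
    "\<alpha> \<in> p_plus H v L \<longleftrightarrow> - vw (b \<alpha>) - root_weight xs \<alpha> = 0"
    "\<alpha> \<in> p_minus H v L \<longleftrightarrow> sg - vw (a \<alpha>) - root_weight xs \<alpha> = 0"
proof -
  have v0: "v > 0" using v1 by simp
  have l: "0 \<in> lattice_of_rank r" by (simp add: lattice_of_rank_def)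
  have m: "- x = c \<longleftrightarrow> x = - c" for x c :: complex by auto
  show "\<alpha> \<in> z_plus H L \<longleftrightarrow> - root_weight xs \<alpha> = 0"
    using assms const_iff[OF assms, of 0 1] l by (simp add: z_plus_def)
  show "\<alpha> \<in> z_minus H L \<longleftrightarrow> sg - root_weight xs \<alpha> = 0"
    using assms const_iff[OF assms, of sg "-1"] l unfolding z_minus_def m by (simp add: val_sg)
  show "\<alpha> \<in> p_plus H v L \<longleftrightarrow> - vw (b \<alpha>) - root_weight xs \<alpha> = 0"
    using assms const_iff[OF assms, of "- vw (b \<alpha>)", OF _ powr_lab(1)] l unfolding p_plus_def by simp
  have "- of_real (v powr (- 2 * lab_minus H \<alpha>)) = val v r t (sg - vw (a \<alpha>))" if "t \<in> torus r" for t
    using val_add[OF that v0, of sg "- vw (a \<alpha>)"] by (simp add: powr_lab'(2)[of \<alpha> t] val_sg)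
  from const_iff[OF assms _ this]
  show "\<alpha> \<in> p_minus H v L \<longleftrightarrow> sg - vw (a \<alpha>) - root_weight xs \<alpha> = 0"
    using assms l unfolding p_minus_def m by simp
qed

lemma mu_reg_num:
  assumes "t \<in> torus r"
  shows "fst (mu_reg H v L) (pt t) * u ^ (card (z_plus H L) + card (z_minus H L)) =
    num_part H xs v r t u"
proof -
  have v0: "v > 0" using v1 by simp
  have p: "(\<Prod>\<alpha>\<in>roots N - z_plus H L. 1 - inverse (chr N \<alpha> (pt t))) * u ^ card (z_plus H L) =
     (\<Prod>\<alpha>\<in>roots N. reg_factor v r t u (- root_weight xs \<alpha>))"
    by (intro reg_product sets_iff)
       (auto simp: chr_pt[OF assms] val_minus z_plus_def)
  have m: "(\<Prod>\<alpha>\<in>roots N - z_minus H L. 1 + inverse (chr N \<alpha> (pt t))) * u ^ card (z_minus H L) =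
     (\<Prod>\<alpha>\<in>roots N. reg_factor v r t u (sg - root_weight xs \<alpha>))"
    by (intro reg_product sets_iff)
       (auto simp: chr_pt[OF assms] val_diff[OF assms v0] val_sg z_minus_def divide_inverse)
  show ?thesis
    unfolding num_part_def prod.distrib m[symmetric] p[symmetric]
    by (simp add: mu_reg_def power_add mult_ac)
qed

lemma mu_reg_den:
  assumes "t \<in> torus r"
  shows "snd (mu_reg H v L) (pt t) * u ^ (card (p_plus H v L) + card (p_minus H v L)) =
    den_part H xs lm lp ll v r t u"
proof -
  have v0: "v > 0" using v1 by simp
  have p: "(\<Prod>\<alpha>\<in>roots N - p_plus H v L. 1 - of_real (v powr (- 2 * lab_plus H \<alpha>)) * inverse (chr N \<alpha> (pt t)))
      * u ^ card (p_plus H v L) = (\<Prod>\<alpha>\<in>roots N. reg_factor v r t u (- vw (b \<alpha>) - root_weight xs \<alpha>))"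
    by (intro reg_product sets_iff)
       (auto simp: chr_pt[OF assms] val_diff[OF assms v0] powr_lab'(1)[of _ t] p_plus_def divide_inverse)
  have m: "(\<Prod>\<alpha>\<in>roots N - p_minus H v L. 1 + of_real (v powr (- 2 * lab_minus H \<alpha>)) * inverse (chr N \<alpha> (pt t)))
      * u ^ card (p_minus H v L) = (\<Prod>\<alpha>\<in>roots N. reg_factor v r t u (sg - vw (a \<alpha>) - root_weight xs \<alpha>))"
  proof (intro reg_product sets_iff)
    have "val v r t (sg - vw (a \<alpha>)) = - val v r t (- vw (a \<alpha>))" for \<alpha>
      using val_add[OF assms v0, of sg "- vw (a \<alpha>)"] by (simp add: val_sg)
    then show "1 + of_real (v powr (- 2 * lab_minus H \<alpha>)) * inverse (chr N \<alpha> (pt t)) =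
        1 - val v r t (sg - vw (a \<alpha>) - root_weight xs \<alpha>)" if "\<alpha> \<in> roots N" for \<alpha>
      using that by (simp add: chr_pt[OF assms] val_diff[OF assms v0] powr_lab'(2)[of _ t] divide_inverse)
  qed (auto simp: p_minus_def)
  show ?thesis
    unfolding den_part_def a_def[symmetric] b_def[symmetric] prod.distrib m[symmetric] p[symmetric]
    by (simp add: mu_reg_def power_add mult_ac)
qed

text \<open>If no root is constant, nothing has to be regularised.\<close>

lemma mu_num_den:
  assumes t: "t \<in> torus r" and nc: "\<And>\<alpha>. \<alpha> \<in> roots N \<Longrightarrow> texp (root_weight xs \<alpha>) \<noteq> 0"
  shows "fst (mu H v) (pt t) = num_part H xs v r t u"
    "snd (mu H v) (pt t) = den_part H xs lm lp ll v r t u"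
proof -
  have v0: "v > 0" using v1 by simp
  have reg_factor: "reg_factor v r t u (x - root_weight xs \<alpha>) = 1 - val v r t x / val v r t (root_weight xs \<alpha>)"
    if "\<alpha> \<in> roots N" "texp x = 0" for x \<alpha>
    using nc[OF that(1)] that(2) by (auto simp: reg_factor_def val_diff[OF t v0] wt_eq_iff)
  have 0: "- root_weight xs \<alpha> = 0 - root_weight xs \<alpha>" for \<alpha> by simp
  have "1 - chr N \<alpha> (pt t) powi (- 2) = reg_factor v r t u (sg - root_weight xs \<alpha>) * reg_factor v r t u (0 - root_weight xs \<alpha>)"
    if "\<alpha> \<in> roots N" for \<alpha>
    using that val_nz[OF t v0, of "root_weight xs \<alpha>"]
    by (simp add: reg_factor chr_pt[OF t] val_sg power_int_minus field_simps power2_eq_square del: diff_0)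
  then show "fst (mu H v) (pt t) = num_part H xs v r t u"
    unfolding mu_def num_part_def 0 by simp
  have "val v r t (sg - vw (a \<alpha>)) = - val v r t (- vw (a \<alpha>))" for \<alpha>
    using val_add[OF t v0, of sg "- vw (a \<alpha>)"] by (simp add: val_sg)
  then have "(1 - of_real (v powr (- 2 * lab_plus H \<alpha>)) * inverse (chr N \<alpha> (pt t))) *
     (1 + of_real (v powr (- 2 * lab_minus H \<alpha>)) * inverse (chr N \<alpha> (pt t))) =
     reg_factor v r t u (sg - vw (a \<alpha>) - root_weight xs \<alpha>) * reg_factor v r t u (- vw (b \<alpha>) - root_weight xs \<alpha>)"
    if "\<alpha> \<in> roots N" for \<alpha>
    using that by (simp add: reg_factor chr_pt[OF t] powr_lab'[of _ t] divide_inverse)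
  then show "snd (mu H v) (pt t) = den_part H xs lm lp ll v r t u"
    unfolding mu_def den_part_def a_def[symmetric] b_def[symmetric] by simp
qed

lemma cont_rf:
  assumes "t \<in> torus r"
  shows "continuous_on (- {0}) (\<lambda>s. reg_factor v r (curve t s) u w)"
proof -
  have "continuous_on (- {0}) (\<lambda>s. if w = 0 then u else 1 - (if fst w = 0 then 1 else -1) *
      of_real (v powi vexp w) * (chr r (texp w) t * s powi (pairing r (texp w))))"
    by (cases "w = 0") (auto intro!: continuous_intros)
  then show ?thesis
    by (rule continuous_on_eq) (auto simp: reg_factor_def val_def chr_curve[OF assms])
qed

lemma cont_num: "t \<in> torus r \<Longrightarrow> continuous_on (- {0}) (\<lambda>s. num_part H xs v r (curve t s) u)"
  unfolding num_part_def by (intro continuous_intros cont_rf)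

lemma cont_den: "t \<in> torus r \<Longrightarrow> continuous_on (- {0}) (\<lambda>s. den_part H xs lm lp ll v r (curve t s) u)"
  unfolding den_part_def by (intro continuous_intros cont_rf)

lemma parts_nz:
  assumes "generic v r t" "u \<noteq> 0"
  shows "norm_factor H v \<noteq> 0 \<Longrightarrow> num_part H xs v r t u \<noteq> 0" "den_part H xs lm lp ll v r t u \<noteq> 0"
proof -
  interpret generic_point v r t u using assms v1 by unfold_locales
  have nz: "reg_factor v r t u (x - root_weight xs \<alpha>) \<noteq> 0" if "\<alpha> \<in> roots N" "texp x = 0" for x \<alpha>
  proof -
    have "texp (x - root_weight xs \<alpha>) \<in> small_exps r"
      using root_weight_small_exps[OF slim, of \<alpha>] that len small_exps_texp by simp
    then have "E (x - root_weight xs \<alpha>) \<noteq> 0" by (rule E_nz)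
    then show ?thesis by (simp add: E_eq_RF)
  qed
  have nz0: "reg_factor v r t u (- root_weight xs \<alpha>) \<noteq> 0" if "\<alpha> \<in> roots N" for \<alpha>
    using nz[of \<alpha> 0] that by simp
  show "norm_factor H v \<noteq> 0 \<Longrightarrow> num_part H xs v r t u \<noteq> 0"
    using nz nz0 v1 by (auto simp: num_part_def mu_const_def)
  show "den_part H xs lm lp ll v r t u \<noteq> 0"
    using nz by (auto simp: den_part_def)
qed

lemma parts_value:
  assumes "generic_point v r t u"
  shows "num_part H xs v r t u / den_part H xs lm lp ll v r t u =
    of_real (norm_factor H v) * generic_point.mu_product v r t u xs lm lp ll"
  using generic_point.mu_value[OF assms len lab slim] unfolding num_part_def den_part_def .

end

section \<open>Residuality and the pullback of the mu-function\<close>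

lemma length_r_exponents:
  assumes "e \<in> {0, 1}"
  shows "2 * length (r_exponents e k) + k mod 2 + k = 2 * k * (k + e)"
proof -
  have "length (segments e k) + k = 2 * k * (k + e)"
    by (induction k) (auto simp: nat_eq_iff algebra_simps)
  moreover have "length (concat (map (\<lambda>n. [int n, - int n]) ns)) = 2 * length ns" for ns
    by (induction ns) auto
  ultimately show ?thesis
    using arg_cong[OF mset_segs[of e k], of size] by simp
qed

lemma sigma_index:
  assumes "e \<in> {0, 1}" "m = real k + (2 * real e - 1) / 4"
  shows "kappa m = k" "delta m = k mod 2" "eps m = e"
  using kappa_eq[OF assms] eps_eq[OF assms] delta_eq[of m] by auto

lemma floor_l_par:
  assumes "e \<in> {0, 1}" "m = real k + (2 * real e - 1) / 4"
  shows "nat \<lfloor>l_par m\<rfloor> = length (r_exponents e k)"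
proof -
  have "real (2 * length (r_exponents e k) + k mod 2 + k) = real (2 * k * (k + e))"
    using length_r_exponents[OF assms(1), of k] by simp
  then have "l_par m = real (length (r_exponents e k)) + real (k mod 2) / 2"
    unfolding l_par_def sigma_index[OF assms] by (simp add: field_simps)
  moreover have "real (k mod 2) / 2 < 1" "real (k mod 2) / 2 \<ge> 0" by simp_all
  ultimately have "\<lfloor>l_par m\<rfloor> = int (length (r_exponents e k))" by linarith
  then show ?thesis by simp
qed

lemma r_e_eq:
  assumes "e \<in> {0, 1}" "m = real k + (2 * real e - 1) / 4"
  shows "r_e v m = map (\<lambda>n. of_real ((v\<^sup>2) ^ n)) (r_exponents e k)"
  using assms(2)
proof (induction k arbitrary: m)
  case 0
  then have "\<not> m > 1" using assms(1) by auto
  then show ?case by (simp add: r_e.simps)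
next
  case (Suc k)
  note ind = sigma_index[OF assms(1) Suc.prems]
  show ?case
  proof (cases "m > 1")
    case True
    have "2 * m - 3/2 = real (2 * k + e)" using Suc.prems by (simp add: field_simps)
    then have "nat \<lfloor>2 * m - 3/2\<rfloor> = 2 * k + e" by (simp only: floor_of_nat nat_int)
    then have "sigma_e v m = map (\<lambda>n. of_real ((v\<^sup>2) ^ n)) [Suc k mod 2..<Suc (2 * k + e)]"
      unfolding sigma_e_def ind by simp
    moreover have "r_e v (m - 1) = map (\<lambda>n. of_real ((v\<^sup>2) ^ n)) (r_exponents e k)"
      using Suc.prems by (intro Suc.IH) (simp add: field_simps)
    ultimately show ?thesis using True by (subst r_e.simps) simp
  next
    case False
    then have "k = 0 \<and> e = 0" using Suc.prems assms(1) by auto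
    then show ?thesis using False by (subst r_e.simps) simp
  qed
qed

lemma val_tw: "i < r \<Longrightarrow> val v r t (tw i) = t ! i"
proof -
  assume "i < r"
  moreover have "chr r (sroot i 1) t = (\<Prod>j<r. if j = i then t ! i else 1)"
    unfolding chr_def sroot_def by (intro prod.cong) auto
  ultimately show ?thesis by (simp add: val_def)
qed

lemma of_real_of_rat: "of_real (of_rat x) = (of_rat x :: complex)"
  by (cases x) (simp add: of_rat_rat)

text \<open>Primed parameters belong to \<open>m\<^sub>-\<close>, the others to \<open>m\<^sub>+\<close>.\<close>

locale params =
  fixes r e k e' k' :: nat and mm mp :: real
  assumes e: "e \<in> {0, 1}" and e': "e' \<in> {0, 1}"
    and mm: "mm = real k' + (2 * real e' - 1) / 4" and mp: "mp = real k + (2 * real e - 1) / 4"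
    and pos: "mm > 0" "mp > 0"
begin

abbreviation "xs \<equiv> target_weights r e k e' k'"
abbreviation "ys \<equiv> map tw [0..<r]"
abbreviation "S \<equiv> source_hecke r mm mp"
abbreviation "T \<equiv> target_hecke (target_rank r mm mp) (delta mm) (delta mp)"

lemma length_xs: "length xs = target_rank r mm mp"
proof -
  have "length (concat (map (\<lambda>i. [tw i - vw 1, tw i + vw 1]) ns)) = 2 * length ns" for ns
    by (induction ns) auto
  then show ?thesis
    by (simp add: target_weights_def target_rank_def floor_l_par[OF e mp] floor_l_par[OF e' mm])
qed

lemma xi_eq:
  assumes "v > 1" "t \<in> torus r"
  shows "xi mm mp v t = map (val v r t) xs"
proof -
  have v0: "v > 0" using assms by simp
  have len: "length t = r" using assms(2) by (simp add: torus_def)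
  have p: "complex_of_real ((v\<^sup>2) ^ n) = val v r t (vw (2 * int n))" for n
    by (simp add: val_vw power_mult power_int_mult flip: of_real_power of_real_power_int)
  have c: "concat (map (\<lambda>t. [of_real (inverse v) * t, of_real v * t]) (map (\<lambda>i. t ! i) ns)) =
    map (val v r t) (concat (map (\<lambda>i. [tw i - vw 1, tw i + vw 1]) ns))" if "set ns \<subseteq> {..<r}" for ns
    using that by (induction ns)
      (auto simp: val_diff[OF assms(2) v0] val_add[OF assms(2) v0] val_tw val_vw divide_inverse mult.commute)
  have "map (\<lambda>i. t ! i) [0..<r] = t" unfolding len[symmetric] by (rule map_nth)
  then have "concat (map (\<lambda>t. [of_real (inverse v) * t, of_real v * t]) t) =
    map (val v r t) (concat (map (\<lambda>i. [tw i - vw 1, tw i + vw 1]) [0..<r]))"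
    using c[of "[0..<r]"] by (simp add: lessThan_atLeast0)
  then show ?thesis
    unfolding xi_def target_weights_def r_e_eq[OF e mp] r_e_eq[OF e' mm] p
    by (simp add: val_add[OF assms(2) v0] val_sg o_def)
qed

lemma target_datum:
  assumes "v > 1"
  shows "weight_datum T xs (2 * int (k' mod 2)) (2 * int (k mod 2)) 2 v r"
proof
  show "\<forall>x\<in>set xs. slim r x"
    by (auto simp: target_weights_def slim_def lattice_of_rank_def sroot_def)
qed (use assms in \<open>simp_all add: target_hecke_def length_xs sigma_index[OF e mp] sigma_index[OF e' mm]\<close>)

lemma source_datum:
  assumes "v > 1"
  shows "weight_datum S ys (4 * int k' + 2 * int e' - 1) (4 * int k + 2 * int e - 1) 4 v r"
proof
  show "\<forall>x\<in>set ys. slim r x"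
    by (auto simp: slim_def lattice_of_rank_def sroot_def)
qed (use assms in \<open>simp_all add: source_hecke_def mm mp field_simps\<close>)

lemma source_point: "t \<in> torus r \<Longrightarrow> map (val v r t) ys = t"
  by (auto simp: list_eq_iff_nth_eq torus_def val_tw)

lemma source_nonconst:
  assumes "\<alpha> \<in> roots r"
  shows "texp (root_weight ys \<alpha>) \<noteq> 0"
  using assms
proof (cases rule: roots_cases)
  case (short i s)
  have "sroot i 1 i = 1" by (simp add: sroot_def)
  then have "texp (root_weight ys \<alpha>) i = s" using short by (auto simp: root_weight_sroot smul_def)
  then show ?thesis using short by auto
next
  case (long i j s s')
  have "texp (root_weight ys \<alpha>) i = s" using long by (auto simp: root_weight_lroot smul_def sroot_def)
  then show ?thesis using long by auto
qed

abbreviation "numT \<equiv> num_part T xs"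
abbreviation "denT \<equiv> den_part T xs (2 * int (k' mod 2)) (2 * int (k mod 2)) 2"
abbreviation "numS \<equiv> num_part S ys"
abbreviation "denS \<equiv> den_part S ys (4 * int k' + 2 * int e' - 1) (4 * int k + 2 * int e - 1) 4"

text \<open>The target normalisation cancels \<open>K(1)\<^sup>l K(-1)\<^bsup>\<delta>\<^sub>-\<delta>\<^sub>+\<^esup>\<close> up to \<open>u\<^sup>l 2\<^bsup>\<delta>\<^sub>-\<delta>\<^sub>+\<^esup>\<close>, and each of the \<open>r\<close> blocks
  leaves a factor \<open>-u\<close>. The constant \<open>c\<close> is rational since only signs, a power of \<open>2\<close> and the constant of
  \<open>res_const_rat_prop\<close> enter.\<close>

lemma compare_parts:
  "\<exists>c :: rat. c \<noteq> 0 \<and> (\<forall>v>1. \<forall>t u. generic v r t \<longrightarrow> u \<noteq> 0 \<longrightarrow>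
     u ^ length xs * (numT v r t u / denT v r t u) =
     of_rat c * u ^ r * (numS v r t u / denS v r t u))"
proof -
  obtain c0 :: rat where c0: "c0 \<noteq> 0" "\<And>v. v > 1 \<Longrightarrow> res_const e k e' k' v = of_rat c0 *
     (norm_pair (2 * k + e) (2 * k' + e') v)"
    using res_const_rat_prop[OF e e', of k k'] unfolding rat_prop_def by blast
  let ?d = "(k' mod 2) * (k mod 2)"
  define sg0 :: rat where "sg0 = (\<Prod>j<k. (- 1) ^ (j + e)) * (\<Prod>j<k'. (- 1) ^ (j + e'))"
  have sg0: "sgn_const e k * sgn_const e' k' = of_rat sg0"
    by (simp add: sg0_def sgn_const_def of_rat_mult of_rat_prod of_rat_power)
  define c where "c = sg0 * c0 * (- 1) ^ r / 2 ^ ?d"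
  have "c \<noteq> 0" using c0(1) by (simp add: c_def sg0_def)
  moreover have "u ^ length xs * (numT v r t u / denT v r t u) =
     of_rat c * u ^ r * (numS v r t u / denS v r t u)"
    if v: "v > 1" and gen: "generic v r t" and u: "u \<noteq> 0" for v t u
  proof -
    interpret generic_point v r t u using v gen u by unfold_locales
    note gp = generic_point_axioms
    let ?N = "length xs"
    let ?m = "mu_product ys (4 * int k' + 2 * int e' - 1) (4 * int k + 2 * int e - 1) 4"
    let ?X = "norm_pair (2 * k + e) (2 * k' + e') v"
    define A where "A = complex_of_real (v - inverse v)"
    define B where "B = complex_of_real (v + inverse v)"
    define D where "D = complex_of_real (v powi 2 - v powi (- 2))"
    have "K 0 = u / A" "K sg = 2 / B" by (simp_all only: K_0 K_sg A_def B_def)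
    then have K: "K 0 ^ ?N = u ^ ?N / A ^ ?N" "K sg ^ ?d = 2 ^ ?d / B ^ ?d" "A \<noteq> 0" "B \<noteq> 0"
      using K_consts_nz by (auto simp: power_divide)
    have "v powi (- 2) < v powi 2" using v by (intro power_int_strict_increasing) auto
    then have D: "D \<noteq> 0" by (simp add: D_def del: of_real_diff)
    have nT: "complex_of_real (norm_factor T v) = 1 / (A ^ ?N * B ^ ?d)"
      by (simp add: target_hecke_def target_norm_def length_xs[symmetric] sigma_index[OF e mp]
          sigma_index[OF e' mm] A_def B_def power_int_minus divide_inverse power_int_of_nat
          flip: of_nat_mult of_nat_mod)
    have nS: "complex_of_real (norm_factor S v) = of_real ?X / D ^ r"
      using source_norm_eq[OF v mm mp pos, of r]
      by (simp add: source_hecke_def D_def power_int_minus divide_inverse mult.commute)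
    have "numT v r t u / denT v r t u = complex_of_real (norm_factor T v) *
        mu_product xs (2 * int (k' mod 2)) (2 * int (k mod 2)) 2"
      using weight_datum.parts_value[OF target_datum[OF v] gp] .
    also have "\<dots> = 1 / (A ^ ?N * B ^ ?d) * (of_rat (sg0 * c0) * of_real ?X * (- u / D) ^ r * ?m /
        (u ^ ?N / A ^ ?N * (2 ^ ?d / B ^ ?d)))"
      unfolding mu_product_compare[OF e e'] nT K(1,2) D_def[symmetric] sg0 c0(2)[OF v]
      by (simp add: of_rat_mult of_real_of_rat)
    also have "\<dots> = of_rat c * u ^ r * (of_real ?X / D ^ r * ?m) / u ^ ?N"
    proof -
      have "(- u / D) ^ r = (- 1) ^ r * u ^ r / D ^ r"
        unfolding power_divide power_minus[of u] ..
      then show ?thesis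
        using K(3,4) D u by (simp add: c_def of_rat_mult of_rat_divide of_rat_power field_simps)
    qed
    also have "of_real ?X / D ^ r * ?m = numS v r t u / denS v r t u"
      unfolding nS[symmetric] using weight_datum.parts_value[OF source_datum[OF v] gp] by simp
    finally show ?thesis using u by simp
  qed
  ultimately show ?thesis by blast
qed

lemma norm_S_nz: "v > 1 \<Longrightarrow> norm_factor S v \<noteq> 0"
proof -
  assume v: "v > 1"
  have "v powi (- 2) < v powi 2" using v by (intro power_int_strict_increasing) auto
  moreover have "norm_nat n v \<noteq> 0" for n
    using qsum_pos[OF v] by (auto simp: norm_nat_def less_le)
  ultimately show ?thesis
    using source_norm_eq[OF v mm mp pos, of r] by (simp add: source_hecke_def)
qed

lemma image_L: "v > 1 \<Longrightarrow> xi mm mp v ` torus r = (\<lambda>t. map (val v r t) xs) ` torus r"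
  by (intro image_cong) (auto simp: xi_eq)

lemma rank_S: "hecke_data.rank S = r" and rank_T: "hecke_data.rank T = length xs"
  by (simp_all add: source_hecke_def target_hecke_def length_xs)

text \<open>By \<open>reg_product\<close> the comparison at a generic point has the shape
  \<open>u\<^bsup>|z| + l\<^esup> X = u\<^bsup>|p| + r\<^esup> Y\<close> with \<open>Y \<noteq> 0\<close>. The values \<open>u = 1\<close> and \<open>u = 2\<close> determine the exponents.\<close>

lemma residual_count:
  assumes v: "v > 1"
  defines "L \<equiv> xi mm mp v ` torus r"
  shows "card (z_plus T L) + card (z_minus T L) + length xs = card (p_plus T v L) + card (p_minus T v L) + r"
proof -
  interpret W: weight_datum T xs "2 * int (k' mod 2)" "2 * int (k mod 2)" 2 v r
    by (rule target_datum[OF v])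
  interpret Z: weight_datum S ys "4 * int k' + 2 * int e' - 1" "4 * int k + 2 * int e - 1" 4 v r
    by (rule source_datum[OF v])
  obtain c :: rat where c: "c \<noteq> 0" "\<And>t u. generic v r t \<Longrightarrow> u \<noteq> 0 \<Longrightarrow>
     u ^ length xs * (numT v r t u / denT v r t u) = of_rat c * u ^ r * (numS v r t u / denS v r t u)"
    using compare_parts v by blast
  obtain t where t: "generic v r t" using generic_exists by blast
  then have tor: "t \<in> torus r" by (simp add: generic_def)
  let ?z = "card (z_plus T L) + card (z_minus T L)" and ?p = "card (p_plus T v L) + card (p_minus T v L)"
  define X where "X = fst (mu_reg T v L) (W.pt t) / snd (mu_reg T v L) (W.pt t)"
  define Y where "Y = of_rat c * (numS v r t 1 / denS v r t 1)"
  have Y: "of_rat c * (numS v r t u / denS v r t u) = Y" for u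
    unfolding Y_def using Z.mu_num_den[OF tor source_nonconst] rank_S by metis
  have "Y \<noteq> 0"
    unfolding Y_def using Z.parts_nz[OF t, of 1] norm_S_nz[OF v] c(1) by simp
  have main: "u ^ (?z + length xs) * X = u ^ (?p + r) * Y" if "u \<noteq> 0" for u
  proof -
    have "numT v r t u / denT v r t u = u ^ ?z * X / u ^ ?p"
      unfolding W.mu_reg_num[OF tor, symmetric] W.mu_reg_den[OF tor, symmetric]
      by (simp add: X_def L_def image_L[OF v] mult.commute)
    then have "u ^ length xs * (u ^ ?z * X / u ^ ?p) = of_rat c * u ^ r * (numS v r t u / denS v r t u)"
      using c(2)[OF t that] by (simp only:)
    also have "\<dots> = u ^ r * (of_rat c * (numS v r t u / denS v r t u))"
      by (simp only: mult.assoc mult.commute mult.left_commute)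
    finally have "u ^ length xs * (u ^ ?z * X / u ^ ?p) = u ^ r * Y" by (simp only: Y)
    then show ?thesis using that by (simp add: power_add field_simps)
  qed
  \<comment> \<open>At \<open>u = 1\<close> the exponents are invisible; at \<open>u = 2\<close> they can be compared.\<close>
  have "X = Y" using main[of 1] by simp
  then have "(2::complex) ^ (?z + length xs) = 2 ^ (?p + r)" using main[of 2] \<open>Y \<noteq> 0\<close> by simp
  then have "complex_of_nat (2 ^ (?z + length xs)) = of_nat (2 ^ (?p + r))" by simp
  then have "(2::nat) ^ (?z + length xs) = 2 ^ (?p + r)" by (simp only: of_nat_eq_iff)
  then show ?thesis by simp
qed

text \<open>For \<open>u = 1\<close> the comparison is the required identity at generic points, in a form without
  denominators to which \<open>zero_off_generic\<close> applies.\<close>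

lemma xi_pullback_mu:
  "\<exists>c :: rat. c \<noteq> 0 \<and>
     (\<forall>v>1. ratfun_eq (torus (hecke_data.rank S))
        (ratfun_pullback (xi mm mp v) (mu_reg T v (xi mm mp v ` torus (hecke_data.rank S))))
        (ratfun_scale (of_rat c) (mu S v)))"
proof -
  obtain c :: rat where c: "c \<noteq> 0" "\<And>v t u. v > 1 \<Longrightarrow> generic v r t \<Longrightarrow> u \<noteq> 0 \<Longrightarrow>
     u ^ length xs * (numT v r t u / denT v r t u) = of_rat c * u ^ r * (numS v r t u / denS v r t u)"
    using compare_parts by blast
  have "ratfun_eq (torus r) (ratfun_pullback (xi mm mp v) (mu_reg T v (xi mm mp v ` torus r)))
        (ratfun_scale (of_rat c) (mu S v))" if v: "v > 1" for v
  proof -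
    interpret W: weight_datum T xs "2 * int (k' mod 2)" "2 * int (k mod 2)" 2 v r
      by (rule target_datum[OF v])
    interpret Z: weight_datum S ys "4 * int k' + 2 * int e' - 1" "4 * int k + 2 * int e - 1" 4 v r
      by (rule source_datum[OF v])
    let ?L = "xi mm mp v ` torus r"
    have nT: "fst (mu_reg T v ?L) (xi mm mp v t) = numT v r t 1"
      and dT: "snd (mu_reg T v ?L) (xi mm mp v t) = denT v r t 1"
      and nS: "fst (mu S v) t = numS v r t 1" and dS: "snd (mu S v) t = denS v r t 1"
      if t: "t \<in> torus r" for t
      using W.mu_reg_num[OF t, of 1] W.mu_reg_den[OF t, of 1] image_L[OF v] xi_eq[OF v t]
        Z.mu_num_den[OF t source_nonconst, of 1] source_point[OF t, of v] rank_S by simp_all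
    obtain t0 where t0: "generic v r t0" using generic_exists by blast
    then have tor0: "t0 \<in> torus r" by (simp add: generic_def)
    define F where "F t = numT v r t 1 * denS v r t 1 - of_rat c * numS v r t 1 * denT v r t 1" for t
    have "F t = 0" if "t \<in> torus r" for t
    proof (rule zero_off_generic[OF _ _ that])
      fix t assume g: "generic v r t"
      show "F t = 0"
        using c(2)[OF v g, of 1] W.parts_nz(2)[OF g, of 1] Z.parts_nz(2)[OF g, of 1]
        by (simp add: F_def field_simps)
    next
      show "continuous_on (- {0}) (\<lambda>s. F (curve t s))"
        unfolding F_def
        by (intro continuous_intros W.cont_num W.cont_den Z.cont_num Z.cont_den that)
    qed
    moreover have "denT v r t0 1 \<noteq> 0" "denS v r t0 1 \<noteq> 0"
      using W.parts_nz(2)[OF t0, of 1] Z.parts_nz(2)[OF t0, of 1] by auto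
    ultimately show ?thesis
      using tor0 unfolding ratfun_eq_def ratfun_pullback_def ratfun_scale_def
      by (auto simp: nT dT nS dS F_def)
  qed
  then show ?thesis using c(1) unfolding rank_S by blast
qed

end

section \<open>The geometric conditions\<close>

lemma regular_monomial:
  assumes "\<beta> \<in> lattice_of_rank n" "\<And>t. t \<in> torus n \<Longrightarrow> f t = c * chr n \<beta> t"
  shows "regular_fun n f"
  unfolding regular_fun_def using assms
  by (intro exI[of _ "{\<beta>}"] exI[of _ "\<lambda>_. c"]) auto

lemma regular_add:
  assumes "regular_fun n f" "regular_fun n g"
  shows "regular_fun n (\<lambda>t. f t + g t)"
proof -
  obtain S c where S: "finite S" "S \<subseteq> lattice_of_rank n" "\<forall>t\<in>torus n. f t = (\<Sum>x\<in>S. c x * chr n x t)"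
    using assms(1) unfolding regular_fun_def by blast
  obtain S' c' where S': "finite S'" "S' \<subseteq> lattice_of_rank n" "\<forall>t\<in>torus n. g t = (\<Sum>x\<in>S'. c' x * chr n x t)"
    using assms(2) unfolding regular_fun_def by blast
  have ext: "(\<Sum>x\<in>A. d x * chr n x t) = (\<Sum>x\<in>S \<union> S'. (if x \<in> A then d x else 0) * chr n x t)"
    if "A \<subseteq> S \<union> S'" for A d t
    using that S(1) S'(1) by (intro sum.mono_neutral_cong_left) auto
  show ?thesis
    unfolding regular_fun_def
  proof (intro exI conjI ballI)
    show "f t + g t = (\<Sum>x\<in>S \<union> S'. ((if x \<in> S then c x else 0) + (if x \<in> S' then c' x else 0)) * chr n x t)"
      if "t \<in> torus n" for t
      using S(3) S'(3) that ext[of S c t] ext[of S' c' t] by (simp add: sum.distrib distrib_right)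
  qed (use S S' in auto)
qed

lemma regular_sum:
  assumes "finite A" "\<And>x. x \<in> A \<Longrightarrow> regular_fun n (f x)"
  shows "regular_fun n (\<lambda>t. \<Sum>x\<in>A. f x t)"
  using assms
proof (induction A rule: finite_induct)
  case empty
  show ?case
    by (rule regular_monomial[of 0 n _ 0]) (auto simp: lattice_of_rank_def)
next
  case (insert x A)
  then show ?case using regular_add[of n "f x" "\<lambda>t. \<Sum>x\<in>A. f x t"] by simp
qed

definition mono_map :: "nat \<Rightarrow> (nat \<Rightarrow> int) list \<Rightarrow> complex list \<Rightarrow> complex list" where
  "mono_map n bs t = map (\<lambda>\<beta>. chr n \<beta> t) bs"

lemma torus_one_in: "torus_one n \<in> torus n"
  by (simp add: torus_one_def torus_def)

lemma chr_one [simp]: "chr n \<beta> (torus_one n) = 1"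
  by (simp add: chr_def torus_one_def)

lemma tmul_torus: "s \<in> torus n \<Longrightarrow> t \<in> torus n \<Longrightarrow> tmul s t \<in> torus n"
  by (auto simp: torus_iff tmul_def)

lemma chr_tmul: "s \<in> torus n \<Longrightarrow> t \<in> torus n \<Longrightarrow> chr n \<beta> (tmul s t) = chr n \<beta> s * chr n \<beta> t"
  by (simp add: chr_def tmul_def torus_def power_int_mult_distrib prod.distrib[symmetric])

lemma chr_sroot: "i < n \<Longrightarrow> chr n (sroot i s) t = t ! i powi s"
proof -
  assume "i < n"
  moreover have "chr n (sroot i s) t = (\<Prod>j<n. if j = i then t ! i powi s else 1)"
    unfolding chr_def sroot_def by (intro prod.cong) auto
  ultimately show ?thesis by simp
qed

lemma torus_hom_mono_map:
  assumes "set bs \<subseteq> lattice_of_rank n"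
  shows "torus_hom n (length bs) (mono_map n bs)"
proof -
  have "mono_map n bs ` torus n \<subseteq> torus (length bs)"
    by (auto simp: torus_iff mono_map_def chr_nz)
  moreover have "regular_fun n (\<lambda>t. mono_map n bs t ! i)" if "i < length bs" for i
    using that assms by (intro regular_monomial[of "bs ! i" n _ 1]) (auto simp: mono_map_def)
  moreover have "mono_map n bs (tmul s t) = tmul (mono_map n bs s) (mono_map n bs t)"
    if "s \<in> torus n" "t \<in> torus n" for s t
    using that by (simp add: mono_map_def tmul_def list_eq_iff_nth_eq chr_tmul[unfolded tmul_def])
  ultimately show ?thesis by (simp add: torus_hom_def torus_morphism_def)
qed

text \<open>The coordinates of a point can be read off if they occur among the monomials.\<close>

lemma inj_mono_map:
  assumes "\<And>i. i < n \<Longrightarrow> sroot i 1 \<in> set bs"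
  shows "inj_on (mono_map n bs) (torus n)"
proof (rule inj_onI)
  fix s t assume st: "s \<in> torus n" "t \<in> torus n" "mono_map n bs s = mono_map n bs t"
  have "s ! i = t ! i" if "i < n" for i
  proof -
    have "chr n \<beta> s = chr n \<beta> t" if "\<beta> \<in> set bs" for \<beta>
      using st(3) that by (auto simp: mono_map_def)
    from this[OF assms[OF that]] show ?thesis using that by (simp add: chr_sroot)
  qed
  then show "s = t" using st(1,2) by (auto simp: torus_def list_eq_iff_nth_eq)
qed

lemma subtorus_mono_map:
  assumes "set bs \<subseteq> lattice_of_rank n" "\<And>i. i < n \<Longrightarrow> sroot i 1 \<in> set bs"
  shows "subtorus (length bs) n (mono_map n bs ` torus n)"
  unfolding subtorus_def using torus_hom_mono_map[OF assms(1)] inj_mono_map[OF assms(2)] by blast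

lemma sroot_lattice: "i < n \<Longrightarrow> sroot i s \<in> lattice_of_rank n"
  by (simp add: lattice_of_rank_def sroot_def)

lemma length_concat_pairs: "length (concat (map (\<lambda>i. [f i, g i]) [0..<n])) = 2 * n"
  by (induction n) auto

lemma concat_pairs_nth:
  "j < 2 * n \<Longrightarrow> concat (map (\<lambda>i. [f i, g i]) [0..<n]) ! j = (if even j then f (j div 2) else g (j div 2))"
proof (induction n)
  case (Suc n)
  have "j < 2 * n + 2" using Suc.prems by simp
  then consider "j < 2 * n" | "j = 2 * n" | "j = 2 * n + 1" by linarith
  then show ?case
    using Suc.IH by cases (auto simp: nth_append length_concat_pairs)
qed simp

lemma fun_sum_apply: "(\<Sum>i\<in>I. f i) x = (\<Sum>i\<in>I. f i x :: 'b::comm_monoid_add)"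
  by (induction I rule: infinite_finite_induct) auto

context params
begin

abbreviation "N \<equiv> length xs"
definition "A = length (r_exponents e' k')"
definition "B = length (r_exponents e k)"

lemma N_eq: "N = A + 2 * r + B"
  by (simp add: target_weights_def A_def B_def length_concat_pairs)

lemma texp_xs:
  assumes "j < N"
  shows "texp (xs ! j) = (if A \<le> j \<and> j < A + 2 * r then sroot ((j - A) div 2) 1 else 0)"
proof -
  consider "j < A" | "A \<le> j" "j < A + 2 * r" | "A + 2 * r \<le> j" by linarith
  then show ?thesis
  proof cases
    case 1
    then show ?thesis by (simp add: target_weights_def nth_append A_def)
  next
    case 2
    then have j: "j - A < 2 * r" by linarith
    then have "xs ! j = concat (map (\<lambda>i. [tw i - vw 1, tw i + vw 1]) [0..<r]) ! (j - A)"
      using 2 by (simp add: target_weights_def nth_append A_def length_concat_pairs)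
    then show ?thesis using 2 j by (simp add: concat_pairs_nth)
  next
    case 3
    then have "\<not> j - A < 2 * r" by linarith
    then have "xs ! j = map (\<lambda>n. vw (2 * int n)) (r_exponents e k) ! (j - A - 2 * r)"
      using 3 by (simp add: target_weights_def nth_append A_def length_concat_pairs)
    then show ?thesis using 3 assms N_eq by (simp add: B_def)
  qed
qed

abbreviation "es \<equiv> map texp xs"

lemma es_lattice: "set es \<subseteq> lattice_of_rank r"
  by (auto simp: target_weights_def lattice_of_rank_def sroot_def)

lemma es_sroot: "i < r \<Longrightarrow> sroot i 1 \<in> set es"
proof -
  assume i: "i < r"
  then have "A + 2 * i < N" "texp (xs ! (A + 2 * i)) = sroot i 1"
    using texp_xs[of "A + 2 * i"] N_eq by auto
  then show ?thesis by (metis in_set_conv_nth length_map nth_map)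
qed

lemma subtorus_es: "subtorus N r (mono_map r es ` torus r)"
  using subtorus_mono_map[OF es_lattice es_sroot] by simp

lemma xi_split:
  assumes "v > 1" "t \<in> torus r"
  shows "xi mm mp v t = tmul (xi mm mp v (torus_one r)) (mono_map r es t)"
  using assms by (simp add: xi_eq torus_one_in tmul_def mono_map_def list_eq_iff_nth_eq val_def)

lemma xi_torus:
  assumes "v > 1" "t \<in> torus r"
  shows "xi mm mp v t \<in> torus N"
  using val_nz[OF assms(2), of v] assms(1) by (simp add: xi_eq[OF assms] torus_iff[of _ N])

lemma xi_morphism:
  assumes "v > 1"
  shows "torus_morphism r N (xi mm mp v)"
proof -
  have "regular_fun r (\<lambda>t. xi mm mp v t ! i)" if i: "i < N" for i
    by (rule regular_monomial[of "texp (xs ! i)" r _ "val v r (torus_one r) (xs ! i)"])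
       (use i es_lattice assms in \<open>auto simp: xi_eq val_def\<close>)
  then show ?thesis
    using xi_torus[OF assms] by (auto simp: torus_morphism_def)
qed

lemma L_coset:
  assumes "v > 1"
  shows "subtorus_coset N r (xi mm mp v ` torus r)"
proof -
  have "xi mm mp v ` torus r = tmul (xi mm mp v (torus_one r)) ` (mono_map r es ` torus r)"
    unfolding image_image using xi_split[OF assms] by (intro image_cong) auto
  then show ?thesis
    unfolding subtorus_coset_def using subtorus_es xi_torus[OF assms torus_one_in] by blast
qed

lemma L_residual:
  assumes "v > 1"
  shows "residual_coset T v (xi mm mp v ` torus r)"
  unfolding residual_coset_def rank_T
  using L_coset[OF assms] residual_count[OF assms] by (intro exI[of _ r]) auto

lemma chr_sum: "t \<in> torus n \<Longrightarrow> chr n (\<Sum>i\<in>I. f i) t = (\<Prod>i\<in>I. chr n (f i) t)"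
  by (induction I rule: infinite_finite_induct) (simp_all add: chr_add)

lemma xi_coord:
  assumes "v > 1" "t \<in> torus r" "i < r"
  shows "xi mm mp v t ! (A + 2 * i) = of_real (inverse v) * t ! i" "A + 2 * i < N"
proof -
  show l: "A + 2 * i < N" using assms(3) N_eq by simp
  have "xs ! (A + 2 * i) = tw i - vw 1"
    using assms(3) by (simp add: target_weights_def nth_append A_def length_concat_pairs concat_pairs_nth)
  then show "xi mm mp v t ! (A + 2 * i) = of_real (inverse v) * t ! i"
    using l assms by (simp add: xi_eq val_diff val_tw val_vw divide_inverse)
qed

text \<open>The coordinate \<open>t\<^sub>i\<close> is \<open>v\<close> times a coordinate of \<open>\<xi>(t)\<close>, so every Laurent polynomial in \<open>t\<close> is one in
  \<open>\<xi>(t)\<close>: the source ring is generated by \<open>1\<close> as a module.\<close>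

lemma xi_finite:
  assumes v: "v > 1"
  shows "finite_morphism r N (xi mm mp v)"
  unfolding finite_morphism_def
proof (intro conjI exI[of _ "{\<lambda>_. 1}"] allI impI)
  show "torus_morphism r N (xi mm mp v)" by (rule xi_morphism[OF v])
  show "\<forall>b\<in>{\<lambda>_. 1}. regular_fun r b"
    by (auto intro!: regular_monomial[of 0 r _ 1] simp: lattice_of_rank_def)
next
  fix f assume "regular_fun r f"
  then obtain X c where X: "finite X" "\<forall>t\<in>torus r. f t = (\<Sum>x\<in>X. c x * chr r x t)"
    unfolding regular_fun_def by blast
  define y where "y x = (\<Sum>i<r. sroot (A + 2 * i) (x i))" for x :: "nat \<Rightarrow> int"
  define d where "d x = (\<Prod>i<r. (complex_of_real v) powi x i)" for x :: "nat \<Rightarrow> int"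
  define g where "g t = (\<Sum>x\<in>X. c x * d x * chr N (y x) t)" for t
  have "regular_fun N g"
    unfolding g_def
  proof (intro regular_sum X(1))
    fix x
    have "y x \<in> lattice_of_rank N"
      unfolding y_def using N_eq by (auto simp: lattice_of_rank_def fun_sum_apply sroot_def intro!: sum.neutral)
    then show "regular_fun N (\<lambda>t. c x * d x * chr N (y x) t)"
      by (rule regular_monomial) (rule refl)
  qed
  moreover have "f t = g (xi mm mp v t)" if t: "t \<in> torus r" for t
  proof -
    have "d x * chr N (y x) (xi mm mp v t) = chr r x t" for x
    proof -
      have "chr N (y x) (xi mm mp v t) = (\<Prod>i<r. (of_real (inverse v) * t ! i) powi x i)"
        unfolding y_def chr_sum[OF xi_torus[OF v t]]
        using xi_coord[OF v t] by (intro prod.cong) (auto simp: chr_sroot)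
      then have "d x * chr N (y x) (xi mm mp v t) =
          (\<Prod>i<r. (complex_of_real v * (of_real (inverse v) * t ! i)) powi x i)"
        by (simp add: d_def prod.distrib[symmetric] power_int_mult_distrib)
      then show ?thesis using v by (simp add: chr_def mult.assoc[symmetric])
    qed
    then show ?thesis using X(2) t by (simp add: g_def mult.assoc)
  qed
  ultimately show "\<exists>g. (\<forall>b\<in>{\<lambda>_. 1}. regular_fun N (g b)) \<and>
      (\<forall>t\<in>torus r. f t = (\<Sum>b\<in>{\<lambda>_. 1}. g b (xi mm mp v t) * b t))"
    by (intro exI[of _ "\<lambda>_. g"]) auto
qed simp

lemma texp_sum: "texp (\<Sum>i\<in>I. f i) = (\<Sum>i\<in>I. texp (f i))"
  by (induction I rule: infinite_finite_induct) auto

lemma texp_root_weight_coord: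
  assumes "\<alpha> \<in> roots N" "i < r"
  shows "texp (root_weight xs \<alpha>) i = \<alpha> (A + 2 * i) + \<alpha> (A + 2 * i + 1)"
proof -
  have sm: "texp (smul n w) i = n * texp w i" if "n \<in> {-1, 0, 1}" for n w
    using that by (auto simp: smul_def)
  have "texp (root_weight xs \<alpha>) i = (\<Sum>j<N. \<alpha> j * texp (xs ! j) i)"
    unfolding root_weight_def texp_sum fun_sum_apply using root_coeff[OF assms(1)] by (intro sum.cong refl sm) blast
  also have "\<dots> = (\<Sum>j<N. (if j = A + 2 * i then \<alpha> (A + 2 * i) else 0) + (if j = A + 2 * i + 1 then \<alpha> (A + 2 * i + 1) else 0))"
  proof (intro sum.cong refl)
    fix j assume "j \<in> {..<N}"
    then show "\<alpha> j * texp (xs ! j) i = (if j = A + 2 * i then \<alpha> (A + 2 * i) else 0) + (if j = A + 2 * i + 1 then \<alpha> (A + 2 * i + 1) else 0)"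
      using assms(2) by (auto simp: texp_xs sroot_def)
  qed
  also have "\<dots> = \<alpha> (A + 2 * i) + \<alpha> (A + 2 * i + 1)"
    using assms(2) N_eq by (simp add: sum.distrib)
  finally show ?thesis .
qed

lemma texp_root_weight_zero_iff:
  assumes "\<alpha> \<in> roots N"
  shows "texp (root_weight xs \<alpha>) = 0 \<longleftrightarrow> (\<forall>i<r. \<alpha> (A + 2 * i) + \<alpha> (A + 2 * i + 1) = 0)"
proof -
  have "\<forall>x\<in>set xs. texp x \<in> lattice_of_rank r"
    using es_lattice by auto
  from texp_root_weight[OF this, of \<alpha>] have "texp (root_weight xs \<alpha>) i = 0" if "i \<ge> r" for i
    using that by (simp add: lattice_of_rank_def)
  then show ?thesis using texp_root_weight_coord[OF assms] by (auto simp: fun_eq_iff) (metis not_le)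
qed

text \<open>A root is constant on \<open>L\<close> if each \<open>t\<^sub>i\<close> has exponent \<open>0\<close> in its restriction.\<close>

lemma const_on_L:
  assumes v: "v > 1"
  shows "roots_const_on N (xi mm mp v ` torus r) =
    {\<alpha> \<in> roots N. \<forall>i<r. \<alpha> (A + 2 * i) + \<alpha> (A + 2 * i + 1) = 0}"
proof -
  have v0: "v > 0" using v by simp
  have 1: "(\<forall>s\<in>torus r. \<forall>t\<in>torus r. val v r s (root_weight xs \<alpha>) = val v r t (root_weight xs \<alpha>)) \<longleftrightarrow> texp (root_weight xs \<alpha>) = 0"
    (is "?l \<longleftrightarrow> ?r") for \<alpha>
  proof
    assume l: ?l
    let ?w = "root_weight xs \<alpha>"
    \<comment> \<open>Sign and power of \<open>v\<close> are dropped, since constancy concerns the remaining monomial only.\<close>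
    define w' :: wt where "w' = (0, 0, texp ?w)"
    have lat: "texp ?w \<in> lattice_of_rank r" using es_lattice by (intro texp_root_weight) auto
    have te: "texp w' = texp ?w" "fst w' = 0" "vexp w' = 0"
      by (simp_all add: w'_def texp_def vexp_def)
    have "val v r t w' = 1" if t: "t \<in> torus r" for t
    proof -
      have "val v r t ?w = val v r (torus_one r) ?w" using l t torus_one_in by blast
      then have "chr r (texp ?w) t = 1" using v0 by (auto simp: val_def split: if_splits)
      then show ?thesis by (simp add: val_def te)
    qed
    then have "w' = 0" using val_eq_1_iff[OF v, of w' r] lat te by simp
    then show ?r using te(1) by simp
  next
    assume ?r then show ?l by (simp add: val_def)
  qed
  have 2: "(\<forall>s\<in>xi mm mp v ` torus r. \<forall>t\<in>xi mm mp v ` torus r. chr N \<alpha> s = chr N \<alpha> t) \<longleftrightarrow>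
     (\<forall>s\<in>torus r. \<forall>t\<in>torus r. val v r s (root_weight xs \<alpha>) = val v r t (root_weight xs \<alpha>))" if "\<alpha> \<in> roots N" for \<alpha>
    using that v0 by (simp add: xi_eq[OF v] chr_map_val)
  have "(\<forall>s\<in>xi mm mp v ` torus r. \<forall>t\<in>xi mm mp v ` torus r. chr N \<alpha> s = chr N \<alpha> t) \<longleftrightarrow>
     (\<forall>i<r. \<alpha> (A + 2 * i) + \<alpha> (A + 2 * i + 1) = 0)" if "\<alpha> \<in> roots N" for \<alpha>
    by (simp only: 1 2[OF that] texp_root_weight_zero_iff[OF that])
  then show ?thesis
    unfolding roots_const_on_def by blast
qed

text \<open>The torus \<open>T\<^sub>L\<close> is parametrised by the coordinates outside the middle part and one coordinate for each
  pair \<open>(x, x\<^bsup>-1\<^esup>)\<close> of the middle part.\<close>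

definition TL_exp :: "nat \<Rightarrow> nat \<Rightarrow> int" where
  "TL_exp j = (if j < A then sroot j 1
     else if j < A + 2 * r then sroot (A + (j - A) div 2) (if even (j - A) then 1 else -1)
     else sroot (j - r) 1)"

definition TL :: "complex list set" where
  "TL = mono_map (A + r + B) (map TL_exp [0..<N]) ` torus (A + r + B)"

lemma TL_subtorus: "subtorus N (A + r + B) TL"
proof -
  have "TL_exp j \<in> lattice_of_rank (A + r + B)" if "j < N" for j
    using that N_eq unfolding TL_exp_def by (auto intro!: sroot_lattice)
  then have l: "set (map TL_exp [0..<N]) \<subseteq> lattice_of_rank (A + r + B)" by auto
  have m: "sroot i 1 \<in> set (map TL_exp [0..<N])" if "i < A + r + B" for i
  proof -
    consider "i < A" | "A \<le> i" "i < A + r" | "A + r \<le> i" by linarith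
    then obtain j where "j < N" "TL_exp j = sroot i 1"
    proof cases
      case 1
      then show ?thesis using that N_eq by (intro that(1)[of i]) (auto simp: TL_exp_def)
    next
      case 2
      then show ?thesis using N_eq by (intro that(1)[of "A + 2 * (i - A)"]) (auto simp: TL_exp_def)
    next
      case 3
      then show ?thesis using \<open>i < A + r + B\<close> N_eq by (intro that(1)[of "i + r"]) (auto simp: TL_exp_def)
    qed
    then show ?thesis by force
  qed
  show ?thesis using subtorus_mono_map[OF l m] by (simp add: TL_def)
qed

lemma TL_eq: "TL = {s \<in> torus N. \<forall>i<r. s ! (A + 2 * i) * s ! (A + 2 * i + 1) = 1}"
(is "TL = ?R")
proof (intro equalityI subsetI)
  fix s assume "s \<in> TL"
  then obtain x where x: "x \<in> torus (A + r + B)" "s = mono_map (A + r + B) (map TL_exp [0..<N]) x"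
    by (auto simp: TL_def)
  have "s \<in> torus N"
    using x(1) by (auto simp: x(2) torus_iff[of _ N] mono_map_def chr_nz)
  moreover have "s ! (A + 2 * i) * s ! (A + 2 * i + 1) = 1" if "i < r" for i
  proof -
    have "x ! (A + i) \<noteq> 0" using x(1) that by (simp add: torus_iff)
    then show ?thesis
      using that N_eq by (simp add: x(2) mono_map_def TL_exp_def chr_sroot power_int_minus)
  qed
  ultimately show "s \<in> ?R" by blast
next
  fix s assume s: "s \<in> ?R"
  let ?k = "A + r + B"
  define x where "x = map (\<lambda>i. if i < A then s ! i else if i < A + r then s ! (A + 2 * (i - A)) else s ! (i + r)) [0..<?k]"
  have xn: "x ! i = (if i < A then s ! i else if i < A + r then s ! (A + 2 * (i - A)) else s ! (i + r))"
    if "i < ?k" for i using that by (simp add: x_def)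
  have "x \<in> torus ?k"
    using s N_eq by (auto simp: torus_iff x_def)
  moreover have "mono_map ?k (map TL_exp [0..<N]) x = s"
  proof (rule nth_equalityI)
    show "length (mono_map ?k (map TL_exp [0..<N]) x) = length s"
      using s by (simp add: mono_map_def torus_def)
  next
    fix j assume "j < length (mono_map ?k (map TL_exp [0..<N]) x)"
    then have j: "j < N" by (simp add: mono_map_def)
    consider "j < A" | i where "j = A + 2 * i" "i < r" | i where "j = A + 2 * i + 1" "i < r" | "A + 2 * r \<le> j"
    proof -
      have "j < A \<or> A + 2 * r \<le> j \<or> (j = A + 2 * ((j - A) div 2) \<and> (j - A) div 2 < r) \<or>
         (j = A + 2 * ((j - A) div 2) + 1 \<and> (j - A) div 2 < r)" by presburger
      then show ?thesis using that by blast
    qed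
    then have "chr ?k (TL_exp j) x = s ! j"
    proof cases
      case 1
      then show ?thesis using j N_eq by (simp add: TL_exp_def chr_sroot xn)
    next
      case (2 i)
      then show ?thesis by (simp add: TL_exp_def chr_sroot xn)
    next
      case (3 i)
      have "s ! (A + 2 * i) * s ! (A + 2 * i + 1) = 1" using s 3 by blast
      then have "inverse (s ! (A + 2 * i)) = s ! (A + 2 * i + 1)" by (rule inverse_unique)
      then show ?thesis using 3 by (simp add: TL_exp_def chr_sroot xn power_int_minus)
    next
      case 4
      then obtain i where i: "j = A + 2 * r + i" by (auto dest: le_Suc_ex)
      then have d: "j - r = A + r + i" "A + r + i < A + r + B" "A + r + i + r = j" using j N_eq by simp_all
      have "x ! (A + r + i) = s ! j" using xn[OF d(2)] unfolding d(3) by simp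
      moreover have "TL_exp j = sroot (A + r + i) 1" unfolding TL_exp_def d(1) using i by simp
      ultimately show ?thesis using d(2) by (simp only: chr_sroot power_int_1_right)
    qed
    then show "mono_map ?k (map TL_exp [0..<N]) x ! j = s ! j" using j by (simp add: mono_map_def)
  qed
  ultimately show "s \<in> TL" unfolding TL_def by blast
qed

abbreviation "RL \<equiv> {\<alpha> \<in> roots N. \<forall>i<r. \<alpha> (A + 2 * i) + \<alpha> (A + 2 * i + 1) = 0}"

text \<open>Test the cocharacter at \<open>z = 2\<close>.\<close>

lemma cochr_lattice_TL:
  "cochr_lattice N TL = {y \<in> lattice_of_rank N. \<forall>i<r. y (A + 2 * i) + y (A + 2 * i + 1) = 0}"
proof -
  have "(\<forall>z. z \<noteq> 0 \<longrightarrow> cochr N y z \<in> TL) \<longleftrightarrow> (\<forall>i<r. y (A + 2 * i) + y (A + 2 * i + 1) = 0)" for y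
  proof -
    have m: "cochr N y z \<in> TL \<longleftrightarrow> (\<forall>i<r. z powi (y (A + 2 * i) + y (A + 2 * i + 1)) = 1)"
      if "z \<noteq> 0" for z
      using that N_eq by (auto simp: TL_eq torus_iff cochr_def power_int_add)
    have "y (A + 2 * i) + y (A + 2 * i + 1) = 0"
      if "\<forall>z. z \<noteq> 0 \<longrightarrow> cochr N y z \<in> TL" "i < r" for i
    proof -
      have "complex_of_real (2 powi (y (A + 2 * i) + y (A + 2 * i + 1))) = of_real 1"
        using that m[of 2] by simp
      then have "(2::real) powi (y (A + 2 * i) + y (A + 2 * i + 1)) = 1" by (simp only: of_real_eq_iff)
      then show ?thesis using powi_eq_1_iff[of 2] by simp
    qed
    then show ?thesis using m by auto
  qed
  then show ?thesis by (simp add: cochr_lattice_def)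
qed

text \<open>The coroots of the short roots outside the middle part and of the long roots
  \<open>e\<^sub>x - e\<^sub>y\<close> for adjacent middle coordinates span. Their coefficients are \<open>y\<^sub>j / 2\<close>, as short coroots are
  \<open>2 e\<^sub>j\<close>, and the first coordinate of each pair.\<close>

lemma coroot_sat_RL:
  "coroot_sat N RL = {y \<in> lattice_of_rank N. \<forall>i<r. y (A + 2 * i) + y (A + 2 * i + 1) = 0}"
proof (intro equalityI subsetI)
  fix y assume "y \<in> coroot_sat N RL"
  then obtain c :: "(nat \<Rightarrow> int) \<Rightarrow> rat" where y: "y \<in> lattice_of_rank N"
    "\<And>j. of_int (y j) = (\<Sum>\<alpha>\<in>RL. c \<alpha> * of_int (coroot N \<alpha> j))"
    unfolding coroot_sat_def by blast
  have "y (A + 2 * i) + y (A + 2 * i + 1) = 0" if "i < r" for i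
  proof -
    have "(of_int (y (A + 2 * i) + y (A + 2 * i + 1)) :: rat) =
      (\<Sum>\<alpha>\<in>RL. c \<alpha> * of_int (coroot N \<alpha> (A + 2 * i) + coroot N \<alpha> (A + 2 * i + 1)))"
      by (simp only: y(2) of_int_add sum.distrib distrib_left)
    also have "\<dots> = 0"
    proof (intro sum.neutral ballI)
      fix \<alpha> assume "\<alpha> \<in> RL"
      then have "\<alpha> (A + 2 * i) + \<alpha> (A + 2 * i + 1) = 0" using that by blast
      then have "coroot N \<alpha> (A + 2 * i) + coroot N \<alpha> (A + 2 * i + 1) = 0"
        by (cases "\<alpha> \<in> short_roots N") (simp_all add: coroot_def)
      then show "c \<alpha> * of_int (coroot N \<alpha> (A + 2 * i) + coroot N \<alpha> (A + 2 * i + 1)) = 0"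
        by (simp only: of_int_0 mult_zero_right)
    qed
    finally show ?thesis by (simp only: of_int_eq_0_iff)
  qed
  with y(1) show "y \<in> {y \<in> lattice_of_rank N. \<forall>i<r. y (A + 2 * i) + y (A + 2 * i + 1) = 0}" by blast
next
  fix y assume y: "y \<in> {y \<in> lattice_of_rank N. \<forall>i<r. y (A + 2 * i) + y (A + 2 * i + 1) = 0}"
  define J where "J = {..<A} \<union> {A + 2 * r..<N}"
  define lr where "lr i = lroot (A + 2 * i) (A + 2 * i + 1) 1 (-1)" for i
  have J: "finite J" "J \<subseteq> {..<N}" using N_eq by (auto simp: J_def)
  have fin: "finite RL" by simp
  have s_in: "sroot j 1 \<in> RL" if "j \<in> J" for j
    using that J sroot_in[of j N 1] by (auto simp: roots_def sroot_def J_def)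
  have l_long: "lr i \<in> long_roots N" if "i < r" for i
    unfolding lr_def using that N_eq by (intro lroot_in) auto
  have l_in: "lr i \<in> RL" if "i < r" for i
  proof -
    have "lr i (A + 2 * l) + lr i (A + 2 * l + 1) = 0" for l
    proof (cases "l = i")
      case True
      then show ?thesis by (simp add: lr_def lroot_def)
    next
      case False
      moreover have "A + 2 * l \<noteq> A + 2 * i + 1" "A + 2 * l + 1 \<noteq> A + 2 * i" by presburger+
      ultimately show ?thesis by (simp add: lr_def lroot_def)
    qed
    moreover have "lr i \<in> roots N" using l_long[OF that] by (simp add: roots_def)
    ultimately show ?thesis by blast
  qed
  \<comment> \<open>The sums only serve to select the index belonging to \<open>\<alpha>\<close>.\<close>
  define c :: "(nat \<Rightarrow> int) \<Rightarrow> rat" where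
    "c \<alpha> = (\<Sum>j\<in>J. if \<alpha> = sroot j 1 then of_int (y j) / 2 else 0) +
           (\<Sum>i<r. if \<alpha> = lr i then of_int (y (A + 2 * i)) else 0)" for \<alpha>
  have cs: "coroot N (sroot j 1) x = (if x = j then 2 else 0)" if "j \<in> J" for j x
    using that J sroot_in[of j N 1] by (auto simp: coroot_def sroot_def)
  have cl: "coroot N (lr i) x = lr i x" if "i < r" for i x
    using l_long[OF that] short_not_long by (auto simp: coroot_def)
  have swap: "(\<Sum>\<alpha>\<in>RL. (\<Sum>j\<in>I. if \<alpha> = f j then h j else 0) * of_int (coroot N \<alpha> x)) =
      (\<Sum>j\<in>I. h j * of_int (coroot N (f j) x))"
    if "finite I" "\<And>j. j \<in> I \<Longrightarrow> f j \<in> RL" for I and f :: "nat \<Rightarrow> nat \<Rightarrow> int" and h :: "nat \<Rightarrow> rat" and x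
  proof -
    have "(\<Sum>\<alpha>\<in>RL. (\<Sum>j\<in>I. if \<alpha> = f j then h j else 0) * of_int (coroot N \<alpha> x)) =
      (\<Sum>j\<in>I. \<Sum>\<alpha>\<in>RL. if \<alpha> = f j then h j * of_int (coroot N (f j) x) else 0)"
      unfolding sum_distrib_right by (subst sum.swap) (intro sum.cong refl, auto)
    also have "\<dots> = (\<Sum>j\<in>I. h j * of_int (coroot N (f j) x))"
      using that(2) fin by (intro sum.cong refl) (simp add: sum.delta)
    finally show ?thesis .
  qed
  have "of_int (y x) = (\<Sum>\<alpha>\<in>RL. c \<alpha> * of_int (coroot N \<alpha> x))" for x
  proof -
    have "(\<Sum>\<alpha>\<in>RL. c \<alpha> * of_int (coroot N \<alpha> x)) =
       (\<Sum>j\<in>J. of_int (y j) / 2 * of_int (coroot N (sroot j 1) x)) +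
       (\<Sum>i<r. of_int (y (A + 2 * i)) * of_int (coroot N (lr i) x))"
      using swap[of J "\<lambda>j. sroot j 1" "\<lambda>j. of_int (y j) / 2" x, OF J(1) s_in]
        swap[of "{..<r}" lr "\<lambda>i. of_int (y (A + 2 * i))" x, OF finite_lessThan l_in]
      unfolding c_def distrib_right sum.distrib by (simp only: lessThan_iff)
    also have "(\<Sum>j\<in>J. of_int (y j) / 2 * of_int (coroot N (sroot j 1) x)) = (\<Sum>j\<in>J. if x = j then of_int (y x) else (0::rat))"
      by (intro sum.cong) (auto simp: cs)
    also have "\<dots> = (if x \<in> J then of_int (y x) else 0)" using J(1) by simp
    also have "(\<Sum>i<r. of_int (y (A + 2 * i)) * of_int (coroot N (lr i) x)) =
       (\<Sum>i<r. if x = A + 2 * i \<or> x = A + 2 * i + 1 then of_int (y x) else (0::rat))"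
    proof (intro sum.cong refl)
      fix i assume i: "i \<in> {..<r}"
      then have "y (A + 2 * i + 1) = - y (A + 2 * i)" using y by (auto simp: eq_neg_iff_add_eq_0 add.commute)
      then show "of_int (y (A + 2 * i)) * of_int (coroot N (lr i) x) =
         (if x = A + 2 * i \<or> x = A + 2 * i + 1 then of_int (y x) else (0::rat))"
        using i by (simp only: cl lessThan_iff) (auto simp: lr_def lroot_def)
    qed
    also have "\<dots> = (if A \<le> x \<and> x < A + 2 * r then of_int (y x) else 0)"
    proof (cases "A \<le> x \<and> x < A + 2 * r")
      case True
      have "(\<Sum>i<r. if x = A + 2 * i \<or> x = A + 2 * i + 1 then of_int (y x) else (0::rat)) =
         (\<Sum>i<r. if i = (x - A) div 2 then of_int (y x) else 0)"
        using True by (intro sum.cong refl if_cong) presburger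
      moreover have "(x - A) div 2 < r" using True by linarith
      ultimately show ?thesis using True by simp
    next
      case False
      then show ?thesis by (auto intro!: sum.neutral)
    qed
    also have "(if x \<in> J then of_int (y x) else 0) + (if A \<le> x \<and> x < A + 2 * r then of_int (y x) else 0) = (of_int (y x) :: rat)"
      using y N_eq by (auto simp: J_def lattice_of_rank_def)
    finally show ?thesis ..
  qed
  then show "y \<in> coroot_sat N RL" using y unfolding coroot_sat_def by blast
qed

text \<open>The base point has middle coordinates \<open>v\<^bsup>-1\<^esup>\<close> and \<open>v\<close>, with product \<open>1\<close>.\<close>

lemma xi_T2:
  assumes v: "v > 1"
  shows "stm_T2 r N (xi mm mp v)"
proof -
  let ?p = "xi mm mp v (torus_one r)"
  have one: "torus_one r \<in> torus r" by (rule torus_one_in)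
  have "is_T_L N (xi mm mp v ` torus r) TL"
    unfolding is_T_L_def const_on_L[OF v] cochr_lattice_TL coroot_sat_RL using TL_subtorus by blast
  moreover have "?p \<in> TL"
  proof -
    have "?p ! (A + 2 * i) * ?p ! (A + 2 * i + 1) = 1" if "i < r" for i
    proof -
      have "xs ! (A + 2 * i) = tw i - vw 1" "xs ! (A + 2 * i + 1) = tw i + vw 1"
        using that concat_pairs_nth[of "2 * i" r "\<lambda>i. tw i - vw 1" "\<lambda>i. tw i + vw 1"]
          concat_pairs_nth[of "2 * i + 1" r "\<lambda>i. tw i - vw 1" "\<lambda>i. tw i + vw 1"]
        by (simp_all add: target_weights_def nth_append A_def length_concat_pairs)
      then show ?thesis
        using that N_eq v by (simp add: xi_eq[OF v one] val_def power_int_minus)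
    qed
    then show ?thesis using xi_torus[OF v one] by (simp add: TL_eq)
  qed
  moreover have "torus_hom r N (\<lambda>t. tmul (xi mm mp v t) (tinv ?p))"
  proof -
    have eq: "tmul (xi mm mp v t) (tinv ?p) = mono_map r es t" if t: "t \<in> torus r" for t
    proof -
      have "val v r t w * inverse (val v r (torus_one r) w) = chr r (texp w) t" for w
        using v by (simp add: val_def)
      then show ?thesis
        by (simp add: xi_eq[OF v t] xi_eq[OF v one] tmul_def tinv_def mono_map_def list_eq_iff_nth_eq)
    qed
    have hom: "torus_hom r N (mono_map r es)" using torus_hom_mono_map[OF es_lattice] by simp
    have reg: "regular_fun r (\<lambda>t. tmul (xi mm mp v t) (tinv ?p) ! i)" if "i < N" for i
    proof -
      have "regular_fun r (\<lambda>t. mono_map r es t ! i)" using hom that by (simp add: torus_hom_def torus_morphism_def)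
      then show ?thesis unfolding regular_fun_def using eq by simp
    qed
    show ?thesis
      unfolding torus_hom_def torus_morphism_def
    proof (intro conjI ballI allI impI)
      show "(\<lambda>t. tmul (xi mm mp v t) (tinv ?p)) ` torus r \<subseteq> torus N"
        using hom eq by (auto simp: torus_hom_def torus_morphism_def)
      show "tmul (xi mm mp v (tmul s t)) (tinv ?p) =
          tmul (tmul (xi mm mp v s) (tinv ?p)) (tmul (xi mm mp v t) (tinv ?p))"
        if "s \<in> torus r" "t \<in> torus r" for s t
        using hom that by (simp add: eq tmul_torus torus_hom_def)
    qed (rule reg)
  qed
  ultimately show ?thesis
    unfolding stm_T2_def using one by blast
qed

lemma xi_spectral_transfer: "spectral_transfer_morphism S T (xi mm mp)"
  unfolding spectral_transfer_morphism_def
  using xi_pullback_mu xi_morphism L_residual xi_finite xi_T2 by (simp add: rank_S rank_T)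

end

theorem proposition5p2p1:
  fixes r :: nat and m_minus m_plus :: real
  assumes "m_minus > 0" and "m_plus > 0"
    and "quarter_par m_minus" and "quarter_par m_plus"
  shows "spectral_transfer_morphism
           (source_hecke r m_minus m_plus)
           (target_hecke (target_rank r m_minus m_plus) (delta m_minus) (delta m_plus))
           (xi m_minus m_plus)"
proof -
  obtain k' e' where m: "e' \<in> {0, 1}" "m_minus = real k' + (2 * real e' - 1) / 4"
    by (rule quarter_par_decomp[OF assms(1,3)])
  obtain k e where p: "e \<in> {0, 1}" "m_plus = real k + (2 * real e - 1) / 4"
    by (rule quarter_par_decomp[OF assms(2,4)])
  interpret params r e k e' k' m_minus m_plus
    using m p assms(1,2) by unfold_locales
  show ?thesis by (rule xi_spectral_transfer)
qed

end
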